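(* Let $K$ be a self-similar compact subset of $\mathbb{R}^d$ satisfying the Open Set Condition. Then a prevalent measure $\mu\in\mathcal{P}(K)$ satisfies, for every $\alpha\in[0,\dim_{\mathcal H}(K))$, $\dim_{\mathcal H}\big(E(\mu;\alpha)\big)=\dim_{\mathcal P}\big(E(\mu;\alpha)\big)=\alpha$.
   Context: A (non-empty) compact set $K\subset\mathbb{R}^d$ is self-similar if there are finitely many contractive similarity maps $S_1,\dots,S_m:\mathbb{R}^d\to\mathbb{R}^d$ such that $K=\bigcup_i S_i(K)$. It satisfies the Open Set Condition if there is an open, non-empty, bounded set $\mathcal{O}\subset\mathbb{R}^d$ with $S_i(\mathcal{O})\subset\mathcal{O}$ for all $i$ and $S_i(\mathcal{O})\cap S_j(\mathcal{O})=\varnothing$ for all $i\neq j$. $\mathcal{P}(K)$ is the set of Borel probability measures on $K$ with the weak topology; it is a convex, completely metrizable subset of the topological vector space $\mathcal{M}(K)$ of finite signed Borel measures on $K$ with the weak topology. For $\mu\in\mathcal{P}(K)$ and $x\in K$, $\underline{\dim}_{\rm loc}(\mu;x)=\liminf_{r\to 0}\frac{\log\mu(B(x,r))}{\log r}$ and $\overline{\dim}_{\rm loc}(\mu;x)=\limsup_{r\to 0}\frac{\log\mu(B(x,r))}{\log r}$ (with $\log 0=-\infty$), and $E(\mu;\alpha)=\{x\in K:\ \underline{\dim}_{\rm loc}(\mu;x)=\overline{\dim}_{\rm loc}(\mu;x)=\alpha\}$. $\dim_{\mathcal H}$ and $\dim_{\mathcal P}$ are Hausdorff and packing dimension, with value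 $0$ on the empty set. Prevalence. Let $X$ be a topological vector space, $C\subset X$ a convex subset which is completely metrizable in the relative topology induced from $X$, $E\subset C$ a Borel set and $c\in C$. $E$ is shy in $C$ at $c$ if for every $\eta>0$ and every neighbourhood $U$ of $0$ there is a Borel probability measure $\Lambda$ on $X$ such that (1) $\operatorname{supp}(\Lambda)$ is compact and $\operatorname{supp}(\Lambda)\subset U+c$; (2) $\operatorname{supp}(\Lambda)\subset\eta C+(1-\eta)c$; (3) for all $x\in X$, $\Lambda(x+E)=0$. A Borel subset of $C$ is prevalent if its complement in $C$ is shy in $C$ at some point $c\in C$. "A prevalent measure $\mu\in\mathcal{P}(K)$ satisfies a property" means, with $X=\mathcal{M}(K)$ and $C=\mathcal{P}(K)$, that the set of measures in $\mathcal{P}(K)$ satisfying the property is prevalent in $\mathcal{P}(K)$. *)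

theory Defs
  imports "HOL-Analysis.Analysis" "HOL-Probability.Probability_Measure"
begin

section \<open>Self-similar sets\<close>

definition contractive_similarity :: "('a::metric_space \<Rightarrow> 'a) \<Rightarrow> bool" where
  "contractive_similarity f \<longleftrightarrow>
    (\<exists>r. 0 < r \<and> r < 1 \<and> (\<forall>x y. dist (f x) (f y) = r * dist x y))"

text \<open>The maps are indexed by \<open>{..<m}\<close>.\<close>

definition self_similar_by ::
    "nat \<Rightarrow> (nat \<Rightarrow> 'a::euclidean_space \<Rightarrow> 'a) \<Rightarrow> 'a set \<Rightarrow> bool" where
  "self_similar_by m S K \<longleftrightarrow>
    compact K \<and> K \<noteq> {} \<and> (\<forall>i<m. contractive_similarity (S i)) \<and> K = (\<Union>i<m. S i ` K)"

definition open_set_condition ::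
    "nat \<Rightarrow> (nat \<Rightarrow> 'a::euclidean_space \<Rightarrow> 'a) \<Rightarrow> bool" where
  "open_set_condition m S \<longleftrightarrow>
    (\<exists>V. open V \<and> V \<noteq> {} \<and> bounded V \<and> (\<forall>i<m. S i ` V \<subseteq> V) \<and>
      (\<forall>i<m. \<forall>j<m. i \<noteq> j \<longrightarrow> S i ` V \<inter> S j ` V = {}))"


section \<open>Hausdorff and packing dimension\<close>

text \<open>
  The conventions are \<open>diam(\<emptyset>)\<^sup>s = 0\<close> and \<open>diam(U)\<^sup>0 = 1\<close> for nonempty \<open>U\<close>; they are spelled
  out because \<open>0 powr 0 = 0\<close>.
\<close>

definition diam_powr :: "real \<Rightarrow> 'a::metric_space set \<Rightarrow> ennreal" where
  "diam_powr s U =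
    (if U = {} then 0 else if s = 0 then 1 else ennreal (diameter U powr s))"

text \<open>Boundedness is required of the covering sets since \<open>diameter\<close> is unspecified otherwise.\<close>

definition hausdorff_premeasure :: "real \<Rightarrow> real \<Rightarrow> 'a::metric_space set \<Rightarrow> ennreal" where
  "hausdorff_premeasure s \<delta> A =
    (INF U \<in> {U :: nat \<Rightarrow> 'a set.
        A \<subseteq> (\<Union>i. U i) \<and> (\<forall>i. bounded (U i) \<and> diameter (U i) \<le> \<delta>)}.
      \<Sum>i. diam_powr s (U i))"

definition hausdorff_measure :: "real \<Rightarrow> 'a::metric_space set \<Rightarrow> ennreal" where
  "hausdorff_measure s A = (SUP \<delta> \<in> {0<..}. hausdorff_premeasure s \<delta> A)"

definition hausdorff_dim :: "'a::metric_space set \<Rightarrow> ereal" where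
  "hausdorff_dim A = Inf {ereal s | s. 0 \<le> s \<and> hausdorff_measure s A = 0}"

text \<open>
  A packing is encoded as a countable set of pairs (centre, radius); the balls are closed and
  pairwise disjoint.
\<close>

definition packings :: "real \<Rightarrow> 'a::metric_space set \<Rightarrow> ('a \<times> real) set set" where
  "packings \<delta> A =
    {D. countable D \<and> D \<subseteq> A \<times> {0<..\<delta>} \<and>
        (\<forall>(x, r) \<in> D. \<forall>(y, t) \<in> D. (x, r) \<noteq> (y, t) \<longrightarrow> cball x r \<inter> cball y t = {})}"

definition packing_premeasure :: "real \<Rightarrow> 'a::metric_space set \<Rightarrow> ennreal" where
  "packing_premeasure s A =
    (INF \<delta> \<in> {0<..}. SUP D \<in> packings \<delta> A. \<Sum>\<^sub>\<infinity>(x, r) \<in> D. ennreal ((2 * r) powr s))"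

definition packing_measure :: "real \<Rightarrow> 'a::metric_space set \<Rightarrow> ennreal" where
  "packing_measure s A =
    (INF B \<in> {B :: nat \<Rightarrow> 'a set. A \<subseteq> (\<Union>i. B i)}. \<Sum>i. packing_premeasure s (B i))"

definition packing_dim :: "'a::metric_space set \<Rightarrow> ereal" where
  "packing_dim A = Inf {ereal s | s. 0 \<le> s \<and> packing_measure s A = 0}"


section \<open>Finite signed Borel measures\<close>

text \<open>
  Signed measures are countably additive real-valued functions on the Borel sets, extended by 0
  to the other sets so that equality is equality of measures.
\<close>

typedef (overloaded) 'a::topological_space signed_measure =
  "{\<nu> :: 'a set \<Rightarrow> real.
      (\<forall>A. A \<notin> sets borel \<longrightarrow> \<nu> A = 0) \<and>
      (\<forall>A :: nat \<Rightarrow> 'a set. range A \<subseteq> sets borel \<longrightarrow> disjoint_family A \<longrightarrow>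
        (\<lambda>i. \<nu> (A i)) sums \<nu> (\<Union>i. A i))}"
  morphisms smeas Abs_signed_measure
  by (rule exI[of _ "\<lambda>_. 0"]) auto

setup_lifting type_definition_signed_measure

instantiation signed_measure :: (topological_space) real_vector
begin

lift_definition zero_signed_measure :: "'a signed_measure" is "\<lambda>_. 0"
  by auto

lift_definition plus_signed_measure ::
    "'a signed_measure \<Rightarrow> 'a signed_measure \<Rightarrow> 'a signed_measure" is "\<lambda>\<mu> \<nu> A. \<mu> A + \<nu> A"
  by (auto intro: sums_add)

lift_definition uminus_signed_measure :: "'a signed_measure \<Rightarrow> 'a signed_measure" is "\<lambda>\<nu> A. - \<nu> A"
  by (auto intro: sums_minus)

lift_definition minus_signed_measure ::
    "'a signed_measure \<Rightarrow> 'a signed_measure \<Rightarrow> 'a signed_measure" is "\<lambda>\<mu> \<nu> A. \<mu> A - \<nu> A"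
  by (auto intro: sums_diff)

lift_definition scaleR_signed_measure ::
    "real \<Rightarrow> 'a signed_measure \<Rightarrow> 'a signed_measure" is "\<lambda>c \<nu> A. c * \<nu> A"
  by (auto intro: sums_mult)

instance
  by standard (transfer; simp add: algebra_simps)+

end

text \<open>
  Integration against \<open>\<nu>\<close> uses the Jordan decomposition: the positive part is
  \<open>\<nu>\<^sup>+(A) = sup {\<nu>(B) | B \<subseteq> A Borel}\<close>, and the negative part of \<open>\<nu>\<close> is the positive part of \<open>- \<nu>\<close>.
\<close>

definition pos_part :: "'a::topological_space signed_measure \<Rightarrow> 'a measure" where
  "pos_part \<nu> =
    measure_of UNIV (sets borel) (\<lambda>A. SUP B \<in> {B \<in> sets borel. B \<subseteq> A}. ennreal (smeas \<nu> B))"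

definition signed_integral ::
    "'a::topological_space signed_measure \<Rightarrow> 'a set \<Rightarrow> ('a \<Rightarrow> real) \<Rightarrow> real" where
  "signed_integral \<nu> K f =
    (LINT x:K|pos_part \<nu>. f x) - (LINT x:K|pos_part (- \<nu>). f x)"

text \<open>
  Signed measures on \<open>K\<close> and probability measures on \<open>K\<close> are regarded as measures on the ambient
  space which vanish off \<open>K\<close>.
\<close>

definition signed_measures_on :: "'a::topological_space set \<Rightarrow> 'a signed_measure set" where
  "signed_measures_on K = {\<nu>. \<forall>A \<in> sets borel. A \<inter> K = {} \<longrightarrow> smeas \<nu> A = 0}"

definition prob_measures_on :: "'a::topological_space set \<Rightarrow> 'a signed_measure set" where
  "prob_measures_on K = {\<mu> \<in> signed_measures_on K. (\<forall>A. 0 \<le> smeas \<mu> A) \<and> smeas \<mu> K = 1}"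

text \<open>
  The coarsest topology on the signed measures on \<open>K\<close> making \<open>\<nu> \<mapsto> \<integral>\<^sub>K f d\<nu>\<close> continuous for every
  continuous \<open>f\<close> on \<open>K\<close> (which is bounded as \<open>K\<close> will be compact).
\<close>

definition weak_topology :: "'a::topological_space set \<Rightarrow> 'a signed_measure topology" where
  "weak_topology K = topology_generated_by
    {{\<nu> \<in> signed_measures_on K. signed_integral \<nu> K f \<in> V} | f V. continuous_on K f \<and> open V}"


section \<open>Local dimensions\<close>

definition ereal_ln :: "real \<Rightarrow> ereal" where
  "ereal_ln t = (if t \<le> 0 then - \<infinity> else ereal (ln t))"

definition lower_local_dim :: "'a::metric_space signed_measure \<Rightarrow> 'a \<Rightarrow> ereal" where
  "lower_local_dim \<mu> x =
    Liminf (at_right 0) (\<lambda>r. ereal_ln (smeas \<mu> (ball x r)) / ereal (ln r))"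

definition upper_local_dim :: "'a::metric_space signed_measure \<Rightarrow> 'a \<Rightarrow> ereal" where
  "upper_local_dim \<mu> x =
    Limsup (at_right 0) (\<lambda>r. ereal_ln (smeas \<mu> (ball x r)) / ereal (ln r))"

definition local_dim_level :: "'a::metric_space set \<Rightarrow> 'a signed_measure \<Rightarrow> real \<Rightarrow> 'a set" where
  "local_dim_level K \<mu> \<alpha> =
    {x \<in> K. lower_local_dim \<mu> x = ereal \<alpha> \<and> upper_local_dim \<mu> x = ereal \<alpha>}"


section \<open>Prevalence\<close>

text \<open>
  A topological vector space \<open>X\<close> is given by a topology \<open>T\<close> whose underlying set
  \<open>topspace T\<close> is a linear subspace of the type \<open>'x\<close>.
\<close>

definition borel_of :: "'x topology \<Rightarrow> 'x measure" where
  "borel_of T = sigma (topspace T) {U. openin T U}"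

definition msupport :: "'x topology \<Rightarrow> 'x measure \<Rightarrow> 'x set" where
  "msupport T \<Lambda> = {x \<in> topspace T. \<forall>U. openin T U \<longrightarrow> x \<in> U \<longrightarrow> emeasure \<Lambda> U \<noteq> 0}"

text \<open>
  \<open>\<Lambda>(x + E) = 0\<close> is expressed by \<open>null_sets\<close>, as \<open>emeasure\<close> is 0 on nonmeasurable sets.
  Neighbourhoods of 0 may be taken open.
\<close>

definition shy_at :: "'x::real_vector topology \<Rightarrow> 'x set \<Rightarrow> 'x \<Rightarrow> 'x set \<Rightarrow> bool" where
  "shy_at T C c E \<longleftrightarrow>
    E \<in> sets (borel_of T) \<and> E \<subseteq> C \<and> c \<in> C \<and>
    (\<forall>\<eta>>0. \<forall>U. openin T U \<and> 0 \<in> U \<longrightarrow>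
      (\<exists>\<Lambda>. prob_space \<Lambda> \<and> space \<Lambda> = topspace T \<and> sets \<Lambda> = sets (borel_of T) \<and>
        compactin T (msupport T \<Lambda>) \<and>
        msupport T \<Lambda> \<subseteq> (\<lambda>u. u + c) ` U \<and>
        msupport T \<Lambda> \<subseteq> (\<lambda>y. \<eta> *\<^sub>R y + (1 - \<eta>) *\<^sub>R c) ` C \<and>
        (\<forall>x \<in> topspace T. (\<lambda>y. x + y) ` E \<in> null_sets \<Lambda>)))"

definition prevalent_Borel :: "'x::real_vector topology \<Rightarrow> 'x set \<Rightarrow> 'x set \<Rightarrow> bool" where
  "prevalent_Borel T C B \<longleftrightarrow>
    B \<in> sets (borel_of T) \<and> B \<subseteq> C \<and> (\<exists>c \<in> C. shy_at T C c (C - B))"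

text \<open>
  The usual extension to sets which need not be Borel: a subset of \<open>C\<close> is prevalent if it contains
  a prevalent Borel set, that is, if its complement in \<open>C\<close> lies in a shy Borel set. On Borel
  sets nothing changes, as \<open>prevalent_iff_prevalent_Borel\<close> shows.
\<close>

definition prevalent :: "'x::real_vector topology \<Rightarrow> 'x set \<Rightarrow> 'x set \<Rightarrow> bool" where
  "prevalent T C A \<longleftrightarrow> A \<subseteq> C \<and> (\<exists>B \<subseteq> A. prevalent_Borel T C B)"

lemma prevalent_iff_prevalent_Borel:
  assumes A: "A \<in> sets (borel_of T)" "A \<subseteq> C"
    and sub: "subspace (topspace T)"
    and transl: "\<And>x. x \<in> topspace T \<Longrightarrow> continuous_map T T (\<lambda>y. x + y)"
  shows "prevalent T C A \<longleftrightarrow> prevalent_Borel T C A"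
proof
  assume "prevalent_Borel T C A"
  then show "prevalent T C A"
    using A by (auto simp: prevalent_def)
next
  assume "prevalent T C A"
  then obtain B c where B: "B \<subseteq> A" "B \<in> sets (borel_of T)" "c \<in> C" "shy_at T C c (C - B)"
    by (auto simp: prevalent_def prevalent_Borel_def)
  have sp: "space (borel_of T) = topspace T"
    unfolding borel_of_def by (rule space_measure_of) (auto dest: openin_subset)
  have op: "U \<in> sets (borel_of T)" if "openin T U" for U
  proof -
    have "{U. openin T U} \<subseteq> Pow (topspace T)"
      by (auto dest: openin_subset)
    then show ?thesis
      using that unfolding borel_of_def by (simp add: sigma_sets.Basic)
  qed
  have "C = B \<union> (C - B)"
    using B A by auto
  also have "\<dots> \<in> sets (borel_of T)"
    using B(2,4) unfolding shy_at_def by (intro sets.Un) auto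
  finally have CA: "C - A \<in> sets (borel_of T)"
    using A by auto
  have tr: "(\<lambda>y. x + y) ` (C - A) \<in> sets (borel_of T)" if x: "x \<in> topspace T" for x
  proof -
    have nx: "- x \<in> topspace T"
      using sub x by (rule subspace_neg)
    have sub_top: "C - A \<subseteq> topspace T"
      using sets.sets_into_space[OF CA] sp by simp
    have "(\<lambda>y. - x + y) \<in> measurable (borel_of T) (sigma (topspace T) {U. openin T U})"
    proof (rule measurable_measure_of)
      show "{U. openin T U} \<subseteq> Pow (topspace T)"
        by (auto dest: openin_subset)
      show "(\<lambda>y. - x + y) \<in> space (borel_of T) \<rightarrow> topspace T"
        using subspace_add[OF sub nx] by (simp add: sp)
      fix U assume "U \<in> {U. openin T U}"
      then have "openin T {y \<in> topspace T. - x + y \<in> U}"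
        using openin_continuous_map_preimage[OF transl[OF nx]] by blast
      then have "{y \<in> topspace T. - x + y \<in> U} \<in> sets (borel_of T)"
        by (rule op)
      moreover have "(\<lambda>y. - x + y) -` U \<inter> space (borel_of T) =
          {y \<in> topspace T. - x + y \<in> U}"
        unfolding sp by blast
      ultimately show "(\<lambda>y. - x + y) -` U \<inter> space (borel_of T) \<in> sets (borel_of T)"
        by simp
    qed
    then have "(\<lambda>y. - x + y) \<in> measurable (borel_of T) (borel_of T)"
      by (simp add: borel_of_def)
    from measurable_sets[OF this CA] have
      "(\<lambda>y. - x + y) -` (C - A) \<inter> topspace T \<in> sets (borel_of T)"
      by (simp only: sp)
    moreover have "(\<lambda>y. - x + y) -` (C - A) \<inter> topspace T = (\<lambda>y. x + y) ` (C - A)"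
    proof (intro equalityI subsetI)
      fix y assume "y \<in> (\<lambda>y. - x + y) -` (C - A) \<inter> topspace T"
      then show "y \<in> (\<lambda>y. x + y) ` (C - A)"
        by (intro image_eqI[of _ _ "- x + y"]) auto
    next
      fix y assume "y \<in> (\<lambda>y. x + y) ` (C - A)"
      then show "y \<in> (\<lambda>y. - x + y) -` (C - A) \<inter> topspace T"
        using sub_top subspace_add[OF sub x] by auto
    qed
    ultimately show ?thesis
      by simp
  qed
  have "(\<lambda>y. x + y) ` (C - A) \<in> null_sets \<Lambda>"
    if "sets \<Lambda> = sets (borel_of T)" "x \<in> topspace T"
      and "(\<lambda>y. x + y) ` (C - B) \<in> null_sets \<Lambda>" for \<Lambda> x
    using that tr B(1) by (intro null_sets_subset[OF that(3)]) auto
  with B(4) CA have "shy_at T C c (C - A)"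
    unfolding shy_at_def by simp metis
  then show "prevalent_Borel T C A"
    using A B(3) by (auto simp: prevalent_Borel_def)
qed

end

(*
  The probe is a segment from a Dirac measure at a point p of K towards an atomic probability
  measure pi: two elements of a translate of the segment differ, away from p, by a multiple of pi,
  so all but at most one element of the translate lying in P(K) dominate a positive multiple of pi
  off p. It remains to choose pi such that every such measure mu has the stated spectrum.

  The upper bound dim_P E(mu; a) <= a holds for every mu. For the lower bound let F be a subset of
  K with H^a(F) > 0 on which pi(B(x, r)) >= c r^b for each b > a and small r. Then mu has upper
  local dimension at most a on F minus p, while, by a covering argument, the set where its lower
  local dimension is less than a is H^a-null for every mu.

  To find one pi for all a, pass to subsystems with equal ratios whose dimension is close to that
  of K (pigeonhole on the types of long words). There the sets F are given by words which are free
  on a set of positions of density a / s and constant elsewhere; the position sets increase with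
  a, so countably many of these sets, and finite nets in them, suffice to define pi.
*)
theory Submission
  imports Defs "HOL-Probability.Probability_Mass_Function"
begin

section \<open>Hausdorff and packing measures\<close>

text \<open>Measurability of the set in the theorem is never addressed: what is shown to be Borel is
  the smaller set of probability measures dominating a multiple of pi off p, a countable union of
  closed sets. A segment inside P(K) has a direction of total mass 0; for pi minus the Dirac measure
  at p the loss sits at p alone, and a single point is H^a-null for a > 0. The obstacle is that one
  pi has to serve a continuum of exponents. With equal ratios the scale of a word depends on its
  length alone, so with N = rho^(-s) maps and free positions of density a / s about rho^(-a n) words
  of length n remain. The count is never smaller, which keeps H^a positive at the exact exponent a;
  it is larger by a factor exp(O(sqrt n)) at most, which is absorbed in passing to b > a and so is
  invisible to the local dimension. Monotonicity in a then puts the set of a real exponent inside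
  that of a slightly larger rational one. Positivity of H^a is obtained by counting words, without
  constructing a measure on the limit set.\<close>

lemma ennreal_le_mult_iff:
  fixes h X :: ennreal
  assumes "0 < k"
  shows "h \<le> ennreal k * X \<longleftrightarrow> ennreal (1 / k) * h \<le> X"
proof -
  have e: "ennreal (1 / k) * (ennreal k * Y) = Y" "ennreal k * (ennreal (1 / k) * Y) = Y" for Y
    using assms by (simp_all add: mult.assoc[symmetric] ennreal_mult[symmetric])
  show ?thesis
    using mult_left_mono[of h "ennreal k * X" "ennreal (1 / k)"]
      mult_left_mono[of "ennreal (1 / k) * h" X "ennreal k"] by (auto simp: e)
qed

lemma diam_powr_pos: "0 < s \<Longrightarrow> diam_powr s U = ennreal (diameter U powr s)"
  by (auto simp: diam_powr_def)

lemma diam_powr_le: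
  assumes "diameter U \<le> d" "0 \<le> s" "0 < d" "bounded U"
  shows "diam_powr s U \<le> ennreal (d powr s)"
  using assms diameter_ge_0[of U]
  by (auto simp: diam_powr_def intro!: ennreal_leI powr_mono2)

text \<open>Lets covers be indexed by any countable set and their cost be controlled by finite sums.
  The index set is enumerated and the sequence padded with empty sets, which cost 0 under
  \<open>diam_powr\<close> and have diameter 0, hence \<open>0 \<le> \<delta>\<close>.\<close>

lemma hausdorff_premeasure_le_finite_sums:
  assumes I: "countable I" and cov: "A \<subseteq> (\<Union>i\<in>I. U i)" and \<delta>: "0 \<le> \<delta>"
    and U: "\<And>i. i \<in> I \<Longrightarrow> bounded (U i) \<and> diameter (U i) \<le> \<delta>"
    and le: "\<And>J. finite J \<Longrightarrow> J \<subseteq> I \<Longrightarrow> (\<Sum>i\<in>J. diam_powr s (U i)) \<le> c"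
  shows "hausdorff_premeasure s \<delta> A \<le> c"
proof -
  define e where "e = to_nat_on I"
  have inj: "inj_on e I" unfolding e_def using I by (rule inj_on_to_nat_on)
  define W where "W n = (if n \<in> e ` I then U (inv_into I e n) else {})" for n
  have We: "W (e i) = U i" if "i \<in> I" for i
    using that inj by (simp add: W_def)
  have "(\<Sum>n<k. diam_powr s (W n)) \<le> c" for k
  proof -
    let ?J = "{i \<in> I. e i < k}"
    have "finite (e ` ?J)" by (rule finite_subset[of _ "{..<k}"]) auto
    then have finJ: "finite ?J"
      by (rule finite_imageD) (rule inj_on_subset[OF inj], auto)
    have "(\<Sum>n<k. diam_powr s (W n)) = (\<Sum>n\<in>e ` ?J. diam_powr s (W n))"
      by (rule sum.mono_neutral_right) (auto simp: W_def diam_powr_def)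
    also have "\<dots> = (\<Sum>i\<in>?J. diam_powr s (U i))"
      using inj by (subst sum.reindex) (auto simp: We inj_on_def intro!: sum.cong)
    also have "\<dots> \<le> c"
      using finJ by (intro le) auto
    finally show ?thesis .
  qed
  then have "(\<Sum>n. diam_powr s (W n)) \<le> c"
    by (simp add: suminf_eq_SUP SUP_least)
  moreover have "A \<subseteq> (\<Union>n. W n)"
    using cov We by fastforce
  moreover have "bounded (W n) \<and> diameter (W n) \<le> \<delta>" for n
    using U \<delta> inj by (auto simp: W_def)
  ultimately show ?thesis
    unfolding hausdorff_premeasure_def by (intro INF_lower2[of W]) auto
qed

lemma hausdorff_premeasure_cover:
  assumes "hausdorff_premeasure s \<delta> A < c"
  obtains U :: "nat \<Rightarrow> 'a::metric_space set" where "A \<subseteq> (\<Union>i. U i)"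
    "\<And>i. bounded (U i)" "\<And>i. diameter (U i) \<le> \<delta>" "(\<Sum>i. diam_powr s (U i)) < c"
  using assms unfolding hausdorff_premeasure_def INF_less_iff by auto

lemma hausdorff_premeasure_mono: "A \<subseteq> B \<Longrightarrow> hausdorff_premeasure s \<delta> A \<le> hausdorff_premeasure s \<delta> B"
  unfolding hausdorff_premeasure_def by (intro INF_superset_mono) auto

lemma hausdorff_measure_mono: "A \<subseteq> B \<Longrightarrow> hausdorff_measure s A \<le> hausdorff_measure s B"
  unfolding hausdorff_measure_def by (intro SUP_mono) (auto intro: hausdorff_premeasure_mono)

lemma hausdorff_premeasure_antimono:
  "\<delta> \<le> \<epsilon> \<Longrightarrow> hausdorff_premeasure s \<epsilon> A \<le> hausdorff_premeasure s \<delta> A"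
  unfolding hausdorff_premeasure_def by (intro INF_superset_mono) (auto intro: order.trans)

lemma hausdorff_premeasure_le: "0 < \<delta> \<Longrightarrow> hausdorff_premeasure s \<delta> A \<le> hausdorff_measure s A"
  unfolding hausdorff_measure_def by (intro SUP_upper) auto

text \<open>Covers of the \<open>A i\<close> that are optimal up to
  \<open>\<epsilon> / 2 ^ Suc i\<close> are merged into one cover indexed by pairs; a finite set of
  pairs lies in a square, whose sum is bounded by the iterated series.\<close>

lemma hausdorff_premeasure_countable_subadditive:
  fixes A :: "nat \<Rightarrow> 'a::metric_space set"
  assumes \<delta>: "0 < \<delta>"
  shows "hausdorff_premeasure s \<delta> (\<Union>i. A i) \<le> (\<Sum>i. hausdorff_premeasure s \<delta> (A i))"
proof (rule ennreal_le_epsilon)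
  let ?h = "hausdorff_premeasure s \<delta>"
  fix \<epsilon> :: real
  assume top: "(\<Sum>i. ?h (A i)) < top" and \<epsilon>: "0 < \<epsilon>"
  have "\<exists>U :: nat \<Rightarrow> 'a set. A i \<subseteq> (\<Union>j. U j) \<and> (\<forall>j. bounded (U j) \<and> diameter (U j) \<le> \<delta>) \<and>
      (\<Sum>j. diam_powr s (U j)) \<le> ?h (A i) + ennreal (\<epsilon> * (1 / 2) ^ Suc i)" for i
  proof -
    have "?h (A i) \<le> (\<Sum>i. ?h (A i))"
      using sum_le_suminf[of "\<lambda>i. ?h (A i)" "{i}"] by simp
    then have "?h (A i) \<noteq> top" using top by (auto simp: top_unique)
    moreover have "0 < ennreal (\<epsilon> * (1 / 2) ^ Suc i)" using \<epsilon> by simp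
    ultimately have "?h (A i) < ?h (A i) + ennreal (\<epsilon> * (1 / 2) ^ Suc i)"
      using ennreal_add_left_cancel_less[of "?h (A i)" 0] by simp
    from hausdorff_premeasure_cover[OF this] obtain U :: "nat \<Rightarrow> 'a set" where
      "A i \<subseteq> (\<Union>j. U j)" "\<And>j. bounded (U j)" "\<And>j. diameter (U j) \<le> \<delta>"
      "(\<Sum>j. diam_powr s (U j)) < ?h (A i) + ennreal (\<epsilon> * (1 / 2) ^ Suc i)" by metis
    then show ?thesis by (intro exI[of _ U]) (auto intro: less_imp_le)
  qed
  then obtain U :: "nat \<Rightarrow> nat \<Rightarrow> 'a set" where U: "\<And>i. A i \<subseteq> (\<Union>j. U i j)"
    "\<And>i j. bounded (U i j) \<and> diameter (U i j) \<le> \<delta>"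
    "\<And>i. (\<Sum>j. diam_powr s (U i j)) \<le> ?h (A i) + ennreal (\<epsilon> * (1 / 2) ^ Suc i)"
    by metis
  have geo: "(\<Sum>i. ennreal (\<epsilon> * (1 / 2) ^ Suc i)) = ennreal \<epsilon>"
  proof (rule suminf_ennreal_eq)
    show "(\<lambda>i. \<epsilon> * (1 / 2) ^ Suc i) sums \<epsilon>"
      using sums_mult[OF power_half_series, of \<epsilon>] by simp
  qed (use \<epsilon> in auto)
  have tot: "(\<Sum>i. \<Sum>j. diam_powr s (U i j)) \<le> (\<Sum>i. ?h (A i)) + ennreal \<epsilon>"
  proof -
    have "(\<Sum>i. \<Sum>j. diam_powr s (U i j)) \<le> (\<Sum>i. ?h (A i) + ennreal (\<epsilon> * (1 / 2) ^ Suc i))"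
      by (intro suminf_le U) auto
    also have "\<dots> = (\<Sum>i. ?h (A i)) + ennreal \<epsilon>"
      by (subst suminf_add[symmetric]) (simp_all only: geo summableI)
    finally show ?thesis .
  qed
  have "?h (\<Union>i. A i) \<le> (\<Sum>i. \<Sum>j. diam_powr s (U i j))"
  proof (rule hausdorff_premeasure_le_finite_sums)
    show "(\<Union>i. A i) \<subseteq> (\<Union>ij\<in>(UNIV :: (nat \<times> nat) set). case ij of (i, j) \<Rightarrow> U i j)"
      using U(1) by fastforce
    show "bounded (case ij of (i, j) \<Rightarrow> U i j) \<and> diameter (case ij of (i, j) \<Rightarrow> U i j) \<le> \<delta>" for ij
      using U(2) by (cases ij) auto
    fix J :: "(nat \<times> nat) set" assume J: "finite J"
    obtain n where n: "J \<subseteq> {..<n} \<times> {..<n}"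
    proof -
      obtain n where "\<forall>x\<in>fst ` J \<union> snd ` J. x < n"
        using finite_nat_set_iff_bounded[of "fst ` J \<union> snd ` J"] J by auto
      then show ?thesis by (intro that[of n]) force
    qed
    have "(\<Sum>ij\<in>J. diam_powr s (case ij of (i, j) \<Rightarrow> U i j))
        \<le> (\<Sum>ij\<in>{..<n} \<times> {..<n}. diam_powr s (case ij of (i, j) \<Rightarrow> U i j))"
      using n by (intro sum_mono2) auto
    also have "\<dots> = (\<Sum>i<n. \<Sum>j<n. diam_powr s (U i j))"
      by (simp add: sum.cartesian_product case_prod_unfold)
    also have "\<dots> \<le> (\<Sum>i<n. \<Sum>j. diam_powr s (U i j))"
      by (intro sum_mono sum_le_suminf) auto
    also have "\<dots> \<le> (\<Sum>i. \<Sum>j. diam_powr s (U i j))"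
      by (intro sum_le_suminf) auto
    finally show "(\<Sum>ij\<in>J. diam_powr s (case ij of (i, j) \<Rightarrow> U i j)) \<le> (\<Sum>i. \<Sum>j. diam_powr s (U i j))" .
  qed (use \<delta> in auto)
  with tot show "?h (\<Union>i. A i) \<le> (\<Sum>i. ?h (A i)) + ennreal \<epsilon>"
    by (rule order.trans[rotated])
qed

lemma hausdorff_measure_countable_subadditive:
  fixes A :: "nat \<Rightarrow> 'a::metric_space set"
  shows "hausdorff_measure s (\<Union>i. A i) \<le> (\<Sum>i. hausdorff_measure s (A i))"
proof -
  have "hausdorff_premeasure s \<delta> (\<Union>i. A i) \<le> (\<Sum>i. hausdorff_measure s (A i))" if "0 < \<delta>" for \<delta>
  proof -
    have "hausdorff_premeasure s \<delta> (\<Union>i. A i) \<le> (\<Sum>i. hausdorff_premeasure s \<delta> (A i))"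
      by (rule hausdorff_premeasure_countable_subadditive[OF that])
    also have "\<dots> \<le> (\<Sum>i. hausdorff_measure s (A i))"
      by (intro suminf_le hausdorff_premeasure_le that) auto
    finally show ?thesis .
  qed
  then show ?thesis
    unfolding hausdorff_measure_def[of s "\<Union>i. A i"] by (intro SUP_least) auto
qed

lemma hausdorff_measure_UN_null:
  fixes A :: "nat \<Rightarrow> 'a::metric_space set"
  assumes "\<And>i. hausdorff_measure s (A i) = 0"
  shows "hausdorff_measure s (\<Union>i. A i) = 0"
  using hausdorff_measure_countable_subadditive[of s A] assms by simp

lemma hausdorff_measure_Un_null:
  assumes "hausdorff_measure s A = 0" "hausdorff_measure s B = 0"
  shows "hausdorff_measure s (A \<union> B) = 0"
proof -
  have "A \<union> B = (\<Union>i::nat. if i = 0 then A else B)" by (auto split: if_splits)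
  then show ?thesis
    using hausdorff_measure_UN_null[of s "\<lambda>i. if i = 0 then A else B"] assms by simp
qed

text \<open>Positivity of the exponent matters: for \<open>s = 0\<close> a point has measure
  1.\<close>

lemma hausdorff_measure_singleton:
  assumes "0 < s"
  shows "hausdorff_measure s {x} = 0"
proof -
  have "hausdorff_premeasure s \<delta> {x} \<le> 0" if "0 < \<delta>" for \<delta>
    by (rule hausdorff_premeasure_le_finite_sums[where I = "{()}" and U = "\<lambda>_. {x}"])
      (use that assms in \<open>auto simp: diam_powr_pos subset_singleton_iff\<close>)
  then show ?thesis by (simp add: hausdorff_measure_def)
qed

lemma hausdorff_measure_null_mono:
  assumes null: "hausdorff_measure s A = 0" and st: "0 \<le> s" "s \<le> t"
  shows "hausdorff_measure t A = 0"
proof (cases "s = t")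
  case False
  then have t: "0 < t" "s < t" using st by auto
  have "hausdorff_premeasure t \<delta> A \<le> 0" if \<delta>: "0 < \<delta>" for \<delta>
  proof -
    have le: "diam_powr t U \<le> diam_powr s U" if "diameter U \<le> 1" "bounded U" for U :: "'a set"
    proof (cases "U = {}")
      case False
      have d: "0 \<le> diameter U" using that diameter_ge_0 by blast
      have "diameter U powr t \<le> diameter U powr s" if "s \<noteq> 0"
        using powr_mono'[of s t "diameter U"] t d \<open>diameter U \<le> 1\<close> by auto
      moreover have "diameter U powr t \<le> 1"
        using d that t by (intro powr_le1) auto
      ultimately show ?thesis
        using False t by (auto simp: diam_powr_def intro: ennreal_leI)
    qed (simp add: diam_powr_def)
    \<comment> \<open>The cost decreases in the exponent only for sets of diameter at most 1, so the
      mesh is cut down to \<open>min \<delta> 1\<close>.\<close>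
    have "hausdorff_premeasure t \<delta> A \<le> hausdorff_premeasure t (min \<delta> 1) A"
      by (rule hausdorff_premeasure_antimono) auto
    also have "\<dots> \<le> hausdorff_premeasure s (min \<delta> 1) A"
      unfolding hausdorff_premeasure_def
      by (intro INF_mono) (auto intro!: bexI suminf_le le)
    also have "\<dots> \<le> hausdorff_measure s A"
      using \<delta> by (intro hausdorff_premeasure_le) auto
    finally show ?thesis using null by simp
  qed
  then show ?thesis by (simp add: hausdorff_measure_def)
qed (use null in simp)

lemma hausdorff_dim_le: "0 \<le> s \<Longrightarrow> hausdorff_measure s A = 0 \<Longrightarrow> hausdorff_dim A \<le> ereal s"
  unfolding hausdorff_dim_def by (rule Inf_lower) auto

lemma packing_dim_le: "0 \<le> s \<Longrightarrow> packing_measure s A = 0 \<Longrightarrow> packing_dim A \<le> ereal s"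
  unfolding packing_dim_def by (rule Inf_lower) auto

lemma hausdorff_dim_nonneg: "0 \<le> hausdorff_dim A"
  unfolding hausdorff_dim_def by (rule Inf_greatest) auto

lemma hausdorff_dim_ge:
  assumes "hausdorff_measure s A \<noteq> 0"
  shows "ereal s \<le> hausdorff_dim A"
  unfolding hausdorff_dim_def
proof (rule Inf_greatest)
  fix d assume "d \<in> {ereal s | s. 0 \<le> s \<and> hausdorff_measure s A = 0}"
  then obtain t where "d = ereal t" "0 \<le> t" "hausdorff_measure t A = 0" by auto
  then show "ereal s \<le> d"
    using hausdorff_measure_null_mono[of t A s] assms by (cases "t \<le> s") auto
qed

lemma hausdorff_measure_nonzero_below_dim:
  "0 \<le> s \<Longrightarrow> ereal s < hausdorff_dim A \<Longrightarrow> hausdorff_measure s A \<noteq> 0"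
  using hausdorff_dim_le[of s A] by auto

section \<open>Comparison of Hausdorff and packing measures by the Vitali covering lemma\<close>

lemma Vitali_cballs:
  fixes A :: "'a::euclidean_space set"
  assumes r: "\<And>x. x \<in> A \<Longrightarrow> 0 < r x \<and> r x \<le> B"
  shows "\<exists>C\<subseteq>A. countable C \<and> (\<forall>x\<in>C. \<forall>y\<in>C. x \<noteq> y \<longrightarrow> cball x (r x) \<inter> cball y (r y) = {}) \<and>
    A \<subseteq> (\<Union>x\<in>C. cball x (5 * r x))"
proof -
  have "A \<subseteq> (\<Union>x\<in>A. cball (id x) (r x))"
    using r by (force intro: less_imp_le)
  from Vitali_covering_lemma_cballs[OF this r] obtain C where
    "countable C" "C \<subseteq> A" "pairwise (\<lambda>i j. disjnt (cball (id i) (r i)) (cball (id j) (r j))) C"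
    "A \<subseteq> (\<Union>i\<in>C. cball (id i) (5 * r i))" by blast
  then show ?thesis
    by (intro exI[of _ C]) (auto simp: pairwise_def disjnt_def)
qed

text \<open>Disjoint balls of one radius \<open>\<rho>\<close> with centres in \<open>A\<close> form
  a packing, and their fivefold enlargements cover \<open>A\<close>. The enlarged diameter
  \<open>10 * \<rho>\<close> against the \<open>2 * \<rho>\<close> counted in a packing gives the
  factor \<open>5 powr s\<close>.\<close>

lemma hausdorff_premeasure_le_packing:
  fixes A :: "'a::euclidean_space set"
  assumes s: "0 \<le> s" and \<delta>: "0 < \<delta>" and \<epsilon>: "0 < \<epsilon>"
  shows "hausdorff_premeasure s \<delta> A
    \<le> ennreal (5 powr s) * (SUP D\<in>packings \<epsilon> A. \<Sum>\<^sub>\<infinity>(x, r)\<in>D. ennreal ((2 * r) powr s))"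
proof -
  \<comment> \<open>Small enough for both sides: radius at most \<open>\<epsilon>\<close> in the
    packing, diameter \<open>10 * \<rho>\<close> at most \<open>\<delta>\<close> in the
    cover.\<close>
  define \<rho> where "\<rho> = min \<epsilon> (\<delta> / 10)"
  have \<rho>: "0 < \<rho>" "\<rho> \<le> \<epsilon>" "10 * \<rho> \<le> \<delta>" using \<delta> \<epsilon> by (auto simp: \<rho>_def)
  obtain C where C: "countable C" "C \<subseteq> A"
    "\<forall>x\<in>C. \<forall>y\<in>C. x \<noteq> y \<longrightarrow> cball x \<rho> \<inter> cball y \<rho> = {}"
    "A \<subseteq> (\<Union>x\<in>C. cball x (5 * \<rho>))"
    using Vitali_cballs[of A "\<lambda>_. \<rho>" \<rho>] \<rho> by auto
  have diam: "diameter (cball x (5 * \<rho>)) = 10 * \<rho>" for x :: 'a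
    using \<rho> by (simp add: diameter_cball)
  show ?thesis
  proof (rule hausdorff_premeasure_le_finite_sums[OF C(1) C(4)])
    fix J assume J: "finite J" "J \<subseteq> C"
    have "(\<Sum>x\<in>J. diam_powr s (cball x (5 * \<rho>))) \<le> (\<Sum>x\<in>J. ennreal (5 powr s) * ennreal ((2 * \<rho>) powr s))"
    proof (rule sum_mono)
      fix x :: 'a
      have "diam_powr s (cball x (5 * \<rho>)) \<le> ennreal ((10 * \<rho>) powr s)"
        using \<rho> s diam[of x] by (intro diam_powr_le) auto
      also have "(10 * \<rho>) powr s = 5 powr s * (2 * \<rho>) powr s"
        using \<rho> by (subst powr_mult[symmetric]) auto
      finally show "diam_powr s (cball x (5 * \<rho>)) \<le> ennreal (5 powr s) * ennreal ((2 * \<rho>) powr s)"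
        by (simp add: ennreal_mult)
    qed
    also have "\<dots> = ennreal (5 powr s) * (\<Sum>(x, r)\<in>(\<lambda>x. (x, \<rho>)) ` J. ennreal ((2 * r) powr s))"
      by (subst sum.reindex) (auto simp: inj_on_def mult.left_commute)
    also have "\<dots> \<le> ennreal (5 powr s) * (SUP D\<in>packings \<epsilon> A. \<Sum>\<^sub>\<infinity>(x, r)\<in>D. ennreal ((2 * r) powr s))"
    proof (rule mult_left_mono)
      have "(\<lambda>x. (x, \<rho>)) ` J \<in> packings \<epsilon> A"
        unfolding packings_def
      proof (intro CollectI conjI)
        show "countable ((\<lambda>x. (x, \<rho>)) ` J)" using J(1) by (simp add: countable_finite)
        show "(\<lambda>x. (x, \<rho>)) ` J \<subseteq> A \<times> {0<..\<epsilon>}" using J(2) C(2) \<rho> by auto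
        have "\<forall>x\<in>J. \<forall>y\<in>J. x \<noteq> y \<longrightarrow> cball x \<rho> \<inter> cball y \<rho> = {}"
          using J(2) C(3) by blast
        then show "\<forall>(x, r)\<in>(\<lambda>x. (x, \<rho>)) ` J. \<forall>(y, t)\<in>(\<lambda>x. (x, \<rho>)) ` J.
            (x, r) \<noteq> (y, t) \<longrightarrow> cball x r \<inter> cball y t = {}"
          by simp
      qed
      then show "(\<Sum>(x, r)\<in>(\<lambda>x. (x, \<rho>)) ` J. ennreal ((2 * r) powr s))
          \<le> (SUP D\<in>packings \<epsilon> A. \<Sum>\<^sub>\<infinity>(x, r)\<in>D. ennreal ((2 * r) powr s))"
        using J by (intro SUP_upper2) auto
    qed simp
    finally show "(\<Sum>x\<in>J. diam_powr s (cball x (5 * \<rho>)))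
      \<le> ennreal (5 powr s) * (SUP D\<in>packings \<epsilon> A. \<Sum>\<^sub>\<infinity>(x, r)\<in>D. ennreal ((2 * r) powr s))" .
  qed (use \<delta> \<rho> diam in auto)
qed

lemma hausdorff_measure_le_packing_premeasure:
  fixes A :: "'a::euclidean_space set"
  assumes s: "0 \<le> s"
  shows "hausdorff_measure s A \<le> ennreal (5 powr s) * packing_premeasure s A"
proof -
  have "hausdorff_premeasure s \<delta> A \<le> ennreal (5 powr s) * packing_premeasure s A" if "0 < \<delta>" for \<delta>
  proof -
    have "ennreal (1 / 5 powr s) * hausdorff_premeasure s \<delta> A \<le> packing_premeasure s A"
      unfolding packing_premeasure_def
      using hausdorff_premeasure_le_packing[OF s that, of _ A]
      by (intro INF_greatest) (simp flip: ennreal_le_mult_iff)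
    then show ?thesis by (simp add: ennreal_le_mult_iff)
  qed
  then show ?thesis by (auto simp: hausdorff_measure_def intro: SUP_least)
qed

text \<open>The Hausdorff measure is already countably subadditive, so its bound by the packing
  premeasure survives the countable decompositions over which \<open>packing_measure\<close> takes
  its infimum.\<close>

lemma hausdorff_dim_le_packing_dim:
  fixes A :: "'a::euclidean_space set"
  shows "hausdorff_dim A \<le> packing_dim A"
  unfolding packing_dim_def
proof (rule Inf_greatest)
  fix d assume "d \<in> {ereal s | s. 0 \<le> s \<and> packing_measure s A = 0}"
  then obtain s where s: "d = ereal s" "0 \<le> s" "packing_measure s A = 0" by auto
  have "hausdorff_measure s A \<le> ennreal (5 powr s) * (\<Sum>i. packing_premeasure s (B i))"
    if B: "A \<subseteq> (\<Union>i. B i)" for B :: "nat \<Rightarrow> 'a set"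
  proof -
    have "hausdorff_measure s A \<le> (\<Sum>i. hausdorff_measure s (B i))"
      by (rule order.trans[OF hausdorff_measure_mono[OF B] hausdorff_measure_countable_subadditive])
    also have "\<dots> \<le> (\<Sum>i. ennreal (5 powr s) * packing_premeasure s (B i))"
      by (intro suminf_le hausdorff_measure_le_packing_premeasure s(2)) auto
    finally show ?thesis by simp
  qed
  then have "ennreal (1 / 5 powr s) * hausdorff_measure s A \<le> packing_measure s A"
    unfolding packing_measure_def by (intro INF_greatest) (simp flip: ennreal_le_mult_iff)
  then have "hausdorff_measure s A = 0" using s(3) by (simp add: ennreal_eq_0_iff)
  then show "hausdorff_dim A \<le> d" using s hausdorff_dim_le by auto
qed

section \<open>Density theorems\<close>

lemma sum_measure_disjoint_le:
  assumes M: "finite_measure M" and J: "finite J" "\<And>x. x \<in> J \<Longrightarrow> X x \<in> sets M"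
    and d: "\<And>x y. x \<in> J \<Longrightarrow> y \<in> J \<Longrightarrow> x \<noteq> y \<Longrightarrow> X x \<inter> X y = {}"
  shows "(\<Sum>x\<in>J. measure M (X x)) \<le> measure M (space M)"
proof -
  interpret finite_measure M by (rule M)
  have "(\<Sum>x\<in>J. measure M (X x)) = measure M (\<Union>x\<in>J. X x)"
    using J d by (intro finite_measure_finite_Union[symmetric]) (auto simp: disjoint_family_on_def)
  then show ?thesis by (simp add: bounded_measure)
qed

lemma ennreal_powr_tendsto_0:
  assumes "0 < u"
  shows "((\<lambda>\<epsilon>::real. ennreal (c * \<epsilon> powr u * m)) \<longlongrightarrow> 0) (at_right 0)"
proof -
  have lim: "((\<lambda>\<epsilon>::real. \<epsilon> powr u) \<longlongrightarrow> 0 powr u) (at_right 0)"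
  proof (rule tendsto_powr'[OF tendsto_ident_at tendsto_const])
    have "\<forall>\<^sub>F \<epsilon>::real in at_right 0. 0 \<le> \<epsilon>"
      by (rule eventually_mono[OF eventually_at_right_less]) simp
    then show "0 \<noteq> (0::real) \<or> 0 < u \<and> (\<forall>\<^sub>F \<epsilon>::real in at_right 0. 0 \<le> \<epsilon>)"
      using assms by simp
  qed
  have "((\<lambda>\<epsilon>::real. c * \<epsilon> powr u * m) \<longlongrightarrow> c * 0 powr u * m) (at_right 0)"
    by (intro tendsto_mult tendsto_const lim)
  then show ?thesis
    by (auto dest: tendsto_ennrealI)
qed

text \<open>One good radius \<open>r x \<le> \<epsilon>\<close> per point is enough for a cover. For
  a disjoint Vitali subfamily, \<open>(10 * r) powr t\<close> is at most
  \<open>10 powr t * \<epsilon> powr (t - s)\<close> times the mass of the ball, and the masses add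
  up to at most the total mass; then \<open>\<epsilon>\<close> tends to 0.\<close>

lemma hausdorff_measure_null_if_frequently_ge:
  fixes M :: "'a::euclidean_space measure"
  assumes M: "finite_measure M" "sets M = sets borel" and st: "0 \<le> s" "s < t"
    and A: "\<And>x. x \<in> A \<Longrightarrow> \<exists>\<^sub>F r in at_right 0. r powr s \<le> measure M (ball x r)"
  shows "hausdorff_measure t A = 0"
proof -
  interpret finite_measure M by (rule M)
  define m where "m = measure M (space M)"
  have "hausdorff_premeasure t \<delta> A \<le> ennreal (10 powr t * \<epsilon> powr (t - s) * m)"
    if \<delta>: "0 < \<delta>" and \<epsilon>: "0 < \<epsilon>" "10 * \<epsilon> \<le> \<delta>" for \<delta> \<epsilon>
  proof -
    have "\<exists>r. 0 < r \<and> r \<le> \<epsilon> \<and> r powr s \<le> measure M (ball x r)" if "x \<in> A" for x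
    proof -
      have "\<forall>\<^sub>F r in at_right 0. r \<in> {0<..<\<epsilon>}"
        using \<epsilon> by (intro eventually_at_right_real)
      from frequently_eventually_conj[OF A[OF that] this] show ?thesis
        by (auto dest!: frequently_ex intro: less_imp_le)
    qed
    then obtain r where r: "\<And>x. x \<in> A \<Longrightarrow> 0 < r x \<and> r x \<le> \<epsilon> \<and> r x powr s \<le> measure M (ball x (r x))"
      by metis
    then have r': "0 < r x \<and> r x \<le> \<epsilon>" if "x \<in> A" for x using that by blast
    obtain C where C': "C \<subseteq> A \<and> countable C \<and>
        (\<forall>x\<in>C. \<forall>y\<in>C. x \<noteq> y \<longrightarrow> cball x (r x) \<inter> cball y (r y) = {}) \<and>
        A \<subseteq> (\<Union>x\<in>C. cball x (5 * r x))"
      using Vitali_cballs[of A r, OF r'] ..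
    have C: "countable C" "C \<subseteq> A"
      "\<forall>x\<in>C. \<forall>y\<in>C. x \<noteq> y \<longrightarrow> cball x (r x) \<inter> cball y (r y) = {}"
      "A \<subseteq> (\<Union>x\<in>C. cball x (5 * r x))"
      using C' by simp_all
    have rC: "0 < r x" "r x \<le> \<epsilon>" "r x powr s \<le> measure M (cball x (r x))" if "x \<in> C" for x
    proof -
      show "0 < r x" "r x \<le> \<epsilon>" using r C that by auto
      have "measure M (ball x (r x)) \<le> measure M (cball x (r x))"
        using M by (intro finite_measure_mono) auto
      then show "r x powr s \<le> measure M (cball x (r x))" using r[of x] C that by auto
    qed
    have diam: "diameter (cball x (5 * r x)) = 10 * r x" if "x \<in> C" for x
      using rC[OF that] by (simp add: diameter_cball)
    show ?thesis
    proof (rule hausdorff_premeasure_le_finite_sums[OF C(1) C(4)])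
      fix J assume J: "finite J" "J \<subseteq> C"
      have "(\<Sum>x\<in>J. diam_powr t (cball x (5 * r x)))
          \<le> (\<Sum>x\<in>J. ennreal (10 powr t * \<epsilon> powr (t - s) * measure M (cball x (r x))))"
      proof (rule sum_mono)
        fix x assume "x \<in> J"
        then have x: "x \<in> C" using J by auto
        have "r x powr t = r x powr (t - s) * r x powr s" by (simp flip: powr_add)
        also have "\<dots> \<le> \<epsilon> powr (t - s) * measure M (cball x (r x))"
          using rC[OF x] st by (intro mult_mono powr_mono2) auto
        finally have "(10 * r x) powr t \<le> 10 powr t * \<epsilon> powr (t - s) * measure M (cball x (r x))"
          using rC[OF x] by (simp add: powr_mult)
        then show "diam_powr t (cball x (5 * r x))
            \<le> ennreal (10 powr t * \<epsilon> powr (t - s) * measure M (cball x (r x)))"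
          using st rC[OF x] by (simp add: diam_powr_pos diam[OF x] ennreal_leI)
      qed
      also have "\<dots> = ennreal (10 powr t * \<epsilon> powr (t - s) * (\<Sum>x\<in>J. measure M (cball x (r x))))"
        by (simp add: sum_ennreal sum_distrib_left)
      also have "\<dots> \<le> ennreal (10 powr t * \<epsilon> powr (t - s) * m)"
        unfolding m_def
      proof (intro ennreal_leI mult_left_mono sum_measure_disjoint_le M(1) J(1))
        show "cball x (r x) \<inter> cball y (r y) = {}" if "x \<in> J" "y \<in> J" "x \<noteq> y" for x y
          using C(3) J(2) that by blast
      qed (use M in auto)
      finally show "(\<Sum>x\<in>J. diam_powr t (cball x (5 * r x))) \<le> ennreal (10 powr t * \<epsilon> powr (t - s) * m)" .
    qed (use \<delta> \<epsilon> diam rC in \<open>force+\<close>)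
  qed
  note le = this
  have "hausdorff_premeasure t \<delta> A \<le> 0" if \<delta>: "0 < \<delta>" for \<delta>
  proof (rule tendsto_lowerbound)
    show "((\<lambda>\<epsilon>. ennreal (10 powr t * \<epsilon> powr (t - s) * m)) \<longlongrightarrow> 0) (at_right 0)"
      using st by (intro ennreal_powr_tendsto_0) simp
    have "\<forall>\<^sub>F \<epsilon> in at_right 0. \<epsilon> \<in> {0<..<\<delta> / 10}"
      using \<delta> by (intro eventually_at_right_real) auto
    then show "\<forall>\<^sub>F \<epsilon> in at_right 0. hausdorff_premeasure t \<delta> A \<le> ennreal (10 powr t * \<epsilon> powr (t - s) * m)"
      by eventually_elim (use le[OF \<delta>] in auto)
  qed simp
  then show ?thesis by (simp add: hausdorff_measure_def)
qed

text \<open>The supremum over packings gives no control over the radii, so the mass bound is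
  required at all radii below one \<open>r0\<close> common to all points. Disjointness is part of a
  packing, hence the masses again add up to at most the total mass.\<close>

lemma packing_premeasure_null_if_ge:
  fixes M :: "'a::euclidean_space measure"
  assumes M: "finite_measure M" "sets M = sets borel" and st: "0 \<le> s" "s < t" and r0: "0 < r0"
    and A: "\<And>x r. x \<in> A \<Longrightarrow> 0 < r \<Longrightarrow> r < r0 \<Longrightarrow> r powr s \<le> measure M (ball x r)"
  shows "packing_premeasure t A = 0"
proof -
  interpret finite_measure M by (rule M)
  define m where "m = measure M (space M)"
  have le: "packing_premeasure t A \<le> ennreal (2 powr t * \<delta> powr (t - s) * m)"
    if \<delta>: "0 < \<delta>" "\<delta> < r0" for \<delta>
  proof -
    have "(\<Sum>\<^sub>\<infinity>(x, r)\<in>D. ennreal ((2 * r) powr t)) \<le> ennreal (2 powr t * \<delta> powr (t - s) * m)"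
      if D: "D \<in> packings \<delta> A" for D
    proof -
      have "(\<Sum>z\<in>J. case z of (x, r) \<Rightarrow> ennreal ((2 * r) powr t)) \<le> ennreal (2 powr t * \<delta> powr (t - s) * m)"
        if J: "finite J" "J \<subseteq> D" for J
      proof -
        have "(\<Sum>z\<in>J. case z of (x, r) \<Rightarrow> ennreal ((2 * r) powr t))
            \<le> (\<Sum>z\<in>J. ennreal (2 powr t * \<delta> powr (t - s) * measure M (cball (fst z) (snd z))))"
        proof (rule sum_mono)
          fix z assume "z \<in> J"
          then obtain x r where z: "z = (x, r)" "x \<in> A" "0 < r" "r \<le> \<delta>"
            using J D by (cases z) (auto simp: packings_def)
          have "r powr s \<le> measure M (ball x r)" using z \<delta> by (intro A) auto
          also have "\<dots> \<le> measure M (cball x r)" using M by (intro finite_measure_mono) auto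
          finally have r: "r powr s \<le> measure M (cball x r)" .
          have "r powr t = r powr (t - s) * r powr s" by (simp flip: powr_add)
          also have "\<dots> \<le> \<delta> powr (t - s) * measure M (cball x r)"
            using r z st by (intro mult_mono powr_mono2) auto
          finally have "(2 * r) powr t \<le> 2 powr t * \<delta> powr (t - s) * measure M (cball x r)"
            using z by (simp add: powr_mult)
          then show "(case z of (x, r) \<Rightarrow> ennreal ((2 * r) powr t))
              \<le> ennreal (2 powr t * \<delta> powr (t - s) * measure M (cball (fst z) (snd z)))"
            using z by (simp add: ennreal_leI)
        qed
        also have "\<dots> = ennreal (2 powr t * \<delta> powr (t - s) * (\<Sum>z\<in>J. measure M (cball (fst z) (snd z))))"
          by (simp add: sum_ennreal sum_distrib_left)
        also have "\<dots> \<le> ennreal (2 powr t * \<delta> powr (t - s) * m)"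
          unfolding m_def
        proof (intro ennreal_leI mult_left_mono sum_measure_disjoint_le M(1) J(1))
          fix y z assume yz: "y \<in> J" "z \<in> J" "y \<noteq> z"
          have "\<forall>y\<in>D. \<forall>z\<in>D. y \<noteq> z \<longrightarrow> cball (fst y) (snd y) \<inter> cball (fst z) (snd z) = {}"
            using D by (simp add: packings_def case_prod_unfold prod_eq_iff)
          then show "cball (fst y) (snd y) \<inter> cball (fst z) (snd z) = {}"
            using J(2) yz by blast
        qed (use M in auto)
        finally show ?thesis .
      qed
      then show ?thesis
        by (subst nonneg_infsum_complete) (auto intro!: SUP_least)
    qed
    then show ?thesis
      unfolding packing_premeasure_def using \<delta> by (intro INF_lower2[of \<delta>] SUP_least) auto
  qed
  have "packing_premeasure t A \<le> 0"
  proof (rule tendsto_lowerbound)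
    show "((\<lambda>\<epsilon>. ennreal (2 powr t * \<epsilon> powr (t - s) * m)) \<longlongrightarrow> 0) (at_right 0)"
      using st by (intro ennreal_powr_tendsto_0) simp
    have "\<forall>\<^sub>F \<epsilon> in at_right 0. \<epsilon> \<in> {0<..<r0}"
      using r0 by (intro eventually_at_right_real) auto
    then show "\<forall>\<^sub>F \<epsilon> in at_right 0. packing_premeasure t A \<le> ennreal (2 powr t * \<epsilon> powr (t - s) * m)"
      by eventually_elim (use le in auto)
  qed simp
  then show ?thesis by simp
qed

lemma packing_measure_null_if_eventually_ge:
  fixes M :: "'a::euclidean_space measure"
  assumes M: "finite_measure M" "sets M = sets borel" and st: "0 \<le> s" "s < t"
    and A: "\<And>x. x \<in> A \<Longrightarrow> \<forall>\<^sub>F r in at_right 0. r powr s \<le> measure M (ball x r)"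
  shows "packing_measure t A = 0"
proof -
  define B where "B n = {x \<in> A. \<forall>r. 0 < r \<and> r < inverse (Suc n) \<longrightarrow> r powr s \<le> measure M (ball x r)}" for n
  have "A \<subseteq> (\<Union>n. B n)"
  proof
    fix x assume x: "x \<in> A"
    then obtain b where b: "0 < b" "\<And>r. 0 < r \<Longrightarrow> r < b \<Longrightarrow> r powr s \<le> measure M (ball x r)"
      using A[OF x] unfolding eventually_at_right_field by auto
    obtain n where "inverse (real (Suc n)) < b" using reals_Archimedean[OF b(1)] by blast
    then have "x \<in> B n" using x b(2) by (auto simp: B_def)
    then show "x \<in> (\<Union>n. B n)" by auto
  qed
  moreover have "packing_premeasure t (B n) = 0" for n
    by (rule packing_premeasure_null_if_ge[OF M st, of "inverse (Suc n)"]) (auto simp: B_def)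
  ultimately have "packing_measure t A \<le> (\<Sum>n::nat. 0)"
    unfolding packing_measure_def by (intro INF_lower2[of B]) auto
  then show ?thesis by simp
qed

section \<open>The Jordan decomposition\<close>

lemma smeas_not_borel: "A \<notin> sets borel \<Longrightarrow> smeas \<nu> A = 0"
  using smeas[of \<nu>] by auto

lemma smeas_sums:
  "range A \<subseteq> sets borel \<Longrightarrow> disjoint_family A \<Longrightarrow> (\<lambda>i. smeas \<nu> (A i)) sums smeas \<nu> (\<Union>i. A i)"
  using smeas[of \<nu>] by auto

lemma smeas_empty [simp]: "smeas \<nu> {} = 0"
proof -
  have "(\<lambda>i::nat. smeas \<nu> {}) sums smeas \<nu> (\<Union>i::nat. {})"
    by (rule smeas_sums) (auto simp: disjoint_family_on_def)
  then have "(\<lambda>i::nat. smeas \<nu> {}) \<longlonglongrightarrow> 0"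
    by (intro summable_LIMSEQ_zero) (auto simp: sums_iff)
  then show ?thesis
    by (simp add: LIMSEQ_const_iff)
qed

lemma smeas_Un:
  assumes "A \<in> sets borel" "B \<in> sets borel" "A \<inter> B = {}"
  shows "smeas \<nu> (A \<union> B) = smeas \<nu> A + smeas \<nu> B"
proof -
  have "(\<lambda>i. smeas \<nu> (binaryset A B i)) sums smeas \<nu> (\<Union>i. binaryset A B i)"
    using assms by (intro smeas_sums)
      (auto simp: binaryset_def disjoint_family_on_def split: if_splits)
  moreover have "(\<lambda>i. smeas \<nu> (binaryset A B i)) sums (smeas \<nu> A + smeas \<nu> B)"
    by (rule binaryset_sums) auto
  ultimately show ?thesis
    by (metis sums_unique2 UN_binaryset_eq)
qed

lemma smeas_Diff:
  assumes "A \<in> sets borel" "B \<in> sets borel" "B \<subseteq> A"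
  shows "smeas \<nu> (A - B) = smeas \<nu> A - smeas \<nu> B"
  using smeas_Un[of B "A - B" \<nu>] assms by (auto simp: Un_absorb1)

text \<open>The set function underlying \<open>pos_part\<close>. It is studied by itself because
  \<open>measure_of\<close> returns it only once it is known to be countably additive.\<close>

definition upper_var :: "'a::topological_space signed_measure \<Rightarrow> 'a set \<Rightarrow> ennreal" where
  "upper_var \<nu> A = (SUP B \<in> {B \<in> sets borel. B \<subseteq> A}. ennreal (smeas \<nu> B))"

lemma upper_var_upper: "B \<in> sets borel \<Longrightarrow> B \<subseteq> A \<Longrightarrow> ennreal (smeas \<nu> B) \<le> upper_var \<nu> A"
  unfolding upper_var_def by (rule SUP_upper) auto

lemma upper_var_mono: "A \<subseteq> B \<Longrightarrow> upper_var \<nu> A \<le> upper_var \<nu> B"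
  unfolding upper_var_def by (rule SUP_subset_mono) auto

lemma upper_var_empty [simp]: "upper_var \<nu> {} = 0"
  proof -
  have "{B \<in> sets borel. B \<subseteq> {}} = {{} :: 'a set}" by auto
  then show ?thesis by (simp add: upper_var_def)
qed

lemma upper_var_super:
  assumes "A \<inter> B = {}"
  shows "upper_var \<nu> A + upper_var \<nu> B \<le> upper_var \<nu> (A \<union> B)"
proof -
  let ?S = "\<lambda>A. {B \<in> sets borel. B \<subseteq> A} :: 'a set set"
  have ne: "?S X \<noteq> {}" for X by auto
  have le: "ennreal (smeas \<nu> X) + ennreal (smeas \<nu> Y) \<le> upper_var \<nu> (A \<union> B)"
    if XY: "X \<in> ?S A" "Y \<in> ?S B" for X Y
  proof -
    \<comment> \<open>\<open>ennreal\<close> truncates negative numbers to 0, so the union is used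
      only if both values are nonnegative; otherwise one of the two sets alone is a sufficient
      competitor.\<close>
    consider "smeas \<nu> X \<ge> 0" "smeas \<nu> Y \<ge> 0" | "smeas \<nu> X \<le> 0" | "smeas \<nu> Y \<le> 0" by linarith
    then show ?thesis
    proof cases
      case 1
      then have "ennreal (smeas \<nu> X) + ennreal (smeas \<nu> Y) = ennreal (smeas \<nu> (X \<union> Y))"
        using XY assms by (subst smeas_Un) (auto simp: ennreal_plus)
      also have "\<dots> \<le> upper_var \<nu> (A \<union> B)"
        using XY by (intro upper_var_upper) auto
      finally show ?thesis .
    next
      case 2
      then show ?thesis
        using XY upper_var_upper[of Y "A \<union> B" \<nu>] by (auto simp: ennreal_neg)
    next
      case 3
      then show ?thesis
        using XY upper_var_upper[of X "A \<union> B" \<nu>] by (auto simp: ennreal_neg)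
    qed
  qed
  have "upper_var \<nu> A + ennreal (smeas \<nu> Y) \<le> upper_var \<nu> (A \<union> B)" if "Y \<in> ?S B" for Y
  proof -
    have "upper_var \<nu> A + ennreal (smeas \<nu> Y)
        = (SUP X\<in>?S A. ennreal (smeas \<nu> X) + ennreal (smeas \<nu> Y))"
      unfolding upper_var_def by (rule ennreal_SUP_add_left[OF ne, symmetric])
    also have "\<dots> \<le> upper_var \<nu> (A \<union> B)"
      using le that by (intro SUP_least) auto
    finally show ?thesis .
  qed
  then have "(SUP Y\<in>?S B. upper_var \<nu> A + ennreal (smeas \<nu> Y)) \<le> upper_var \<nu> (A \<union> B)"
    by (intro SUP_least) auto
  moreover have "(SUP Y\<in>?S B. upper_var \<nu> A + ennreal (smeas \<nu> Y)) = upper_var \<nu> A + upper_var \<nu> B"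
    unfolding upper_var_def[of \<nu> B] by (rule ennreal_SUP_add_right[OF ne, symmetric])
  ultimately show ?thesis
    by simp
qed

text \<open>Finite superadditivity and monotonicity give one inequality. For the other, a competitor
  \<open>B\<close> in the union is cut along the \<open>A i\<close>, and the negative pieces are
  dropped from the partial sums.\<close>

lemma upper_var_suminf:
  assumes A: "range A \<subseteq> sets borel" "disjoint_family A"
  shows "(\<Sum>i. upper_var \<nu> (A i)) = upper_var \<nu> (\<Union>i. A i)"
proof (rule antisym)
  have fin: "(\<Sum>i<n. upper_var \<nu> (A i)) \<le> upper_var \<nu> (\<Union>i<n. A i)" for n
  proof (induction n)
    case (Suc n)
    have "(\<Sum>i<Suc n. upper_var \<nu> (A i)) \<le> upper_var \<nu> (\<Union>i<n. A i) + upper_var \<nu> (A n)"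
      using Suc by (simp add: add_mono)
    also have "\<dots> \<le> upper_var \<nu> ((\<Union>i<n. A i) \<union> A n)"
      using A(2) by (intro upper_var_super) (auto simp: disjoint_family_on_def, metis disjoint_iff less_irrefl)
    also have "(\<Union>i<n. A i) \<union> A n = (\<Union>i<Suc n. A i)"
      by (auto simp: lessThan_Suc)
    finally show ?case .
  qed simp
  have "(\<Sum>i<n. upper_var \<nu> (A i)) \<le> upper_var \<nu> (\<Union>i. A i)" for n
    by (rule order.trans[OF fin]) (auto intro: upper_var_mono)
  then show "(\<Sum>i. upper_var \<nu> (A i)) \<le> upper_var \<nu> (\<Union>i. A i)"
    by (simp add: suminf_eq_SUP SUP_least)
  show "upper_var \<nu> (\<Union>i. A i) \<le> (\<Sum>i. upper_var \<nu> (A i))"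
    unfolding upper_var_def[of \<nu> "\<Union>i. A i"]
  proof (rule SUP_least)
    fix B :: "'a set" assume "B \<in> {B \<in> sets borel. B \<subseteq> (\<Union>i. A i)}"
    then have B: "B \<in> sets borel" "B = (\<Union>i. B \<inter> A i)" by auto
    have "(\<lambda>i. smeas \<nu> (B \<inter> A i)) sums smeas \<nu> (\<Union>i. B \<inter> A i)"
      using A B(1) by (intro smeas_sums) (auto simp: disjoint_family_on_def)
    then have s: "(\<lambda>i. smeas \<nu> (B \<inter> A i)) sums smeas \<nu> B"
      using B(2) by simp
    have up: "ennreal (smeas \<nu> (B \<inter> A i)) \<le> upper_var \<nu> (A i)" for i
      using A B(1) by (intro upper_var_upper) auto
    show "ennreal (smeas \<nu> B) \<le> (\<Sum>i. upper_var \<nu> (A i))"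
    proof (rule LIMSEQ_le_const2)
      show "(\<lambda>n. ennreal (\<Sum>i<n. smeas \<nu> (B \<inter> A i))) \<longlonglongrightarrow> ennreal (smeas \<nu> B)"
        using s unfolding sums_def by (intro tendsto_ennrealI)
      have "ennreal (\<Sum>i<n. smeas \<nu> (B \<inter> A i)) \<le> (\<Sum>i. upper_var \<nu> (A i))" for n
      proof -
        have "ennreal (\<Sum>i<n. smeas \<nu> (B \<inter> A i)) \<le> ennreal (\<Sum>i<n. max 0 (smeas \<nu> (B \<inter> A i)))"
          by (intro ennreal_leI sum_mono) auto
        also have "\<dots> = (\<Sum>i<n. ennreal (max 0 (smeas \<nu> (B \<inter> A i))))"
          by (rule sum_ennreal[symmetric]) auto
        also have "\<dots> \<le> (\<Sum>i<n. upper_var \<nu> (A i))"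
          using up by (intro sum_mono) (auto simp: max_def ennreal_neg split: if_splits)
        also have "\<dots> \<le> (\<Sum>i. upper_var \<nu> (A i))"
          by (rule sum_le_suminf) auto
        finally show ?thesis .
      qed
      then show "\<exists>N. \<forall>n\<ge>N. ennreal (\<Sum>i<n. smeas \<nu> (B \<inter> A i)) \<le> (\<Sum>i. upper_var \<nu> (A i))"
        by blast
    qed
  qed
qed

lemma sets_pos_part [simp, measurable_cong]: "sets (pos_part \<nu>) = sets borel"
  and space_pos_part [simp]: "space (pos_part \<nu>) = UNIV"
  unfolding pos_part_def using sets.sigma_sets_eq[of borel] by simp_all

lemma emeasure_pos_part: "A \<in> sets borel \<Longrightarrow> emeasure (pos_part \<nu>) A = upper_var \<nu> A"
proof -
  assume A: "A \<in> sets borel"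
  have "pos_part \<nu> = measure_of UNIV (sets borel) (upper_var \<nu>)"
    unfolding pos_part_def upper_var_def ..
  moreover have "countably_additive (sets borel) (upper_var \<nu>)"
    unfolding countably_additive_def using upper_var_suminf by blast
  moreover have "sigma_algebra UNIV (sets (borel :: 'a measure))"
    using sets.sigma_algebra_axioms[of borel] by simp
  ultimately show ?thesis
    using A emeasure_measure_of_sigma[of UNIV "sets borel" "upper_var \<nu>" A]
    by (simp add: positive_def)
qed

text \<open>
  If the positive variation were infinite, one could repeatedly split off a set of
  \<open>\<nu>\<close>-measure at least 1 in modulus while keeping a remainder of infinite variation,
  contradicting countable additivity on the pieces.
\<close>

lemma upper_var_finite: "upper_var \<nu> UNIV \<noteq> top"
proof
  assume top: "upper_var \<nu> UNIV = top"
  have step: "\<exists>E'. E' \<in> sets borel \<and> upper_var \<nu> E' = top \<and> E' \<subseteq> E \<and> 1 \<le> \<bar>smeas \<nu> (E - E')\<bar>"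
    if E: "E \<in> sets borel" "upper_var \<nu> E = top" for E
  proof -
    \<comment> \<open>With \<open>smeas \<nu> B\<close> above
      \<open>\<bar>smeas \<nu> E\<bar> + 1\<close>, both \<open>B\<close> and \<open>E - B\<close>
      have modulus at least 1, so either of them may be the piece split off.\<close>
    have "ennreal (\<bar>smeas \<nu> E\<bar> + 1) < upper_var \<nu> E" using E by simp
    then obtain B where B: "B \<in> sets borel" "B \<subseteq> E" "ennreal (\<bar>smeas \<nu> E\<bar> + 1) < ennreal (smeas \<nu> B)"
      unfolding upper_var_def less_SUP_iff by auto
    have B3: "\<bar>smeas \<nu> E\<bar> + 1 < smeas \<nu> B"
      using B(3) by (subst (asm) ennreal_less_iff) auto
    have "upper_var \<nu> B + upper_var \<nu> (E - B) = upper_var \<nu> E"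
      using plus_emeasure[of B "pos_part \<nu>" "E - B"] E B
      by (simp add: emeasure_pos_part Un_absorb1)
    then consider "upper_var \<nu> B = top" | "upper_var \<nu> (E - B) = top"
      using E by (metis ennreal_add_eq_top)
    then show ?thesis
    proof cases
      case 1
      have "smeas \<nu> (E - B) = smeas \<nu> E - smeas \<nu> B" using E B by (intro smeas_Diff)
      then show ?thesis using 1 B B3 by (intro exI[of _ B]) auto
    next
      case 2
      have "E - (E - B) = B" using B by auto
      then show ?thesis using 2 E B B3 by (intro exI[of _ "E - B"]) auto
    qed
  qed
  then obtain h where h: "\<And>E. E \<in> sets borel \<Longrightarrow> upper_var \<nu> E = top \<Longrightarrow>
      h E \<in> sets borel \<and> upper_var \<nu> (h E) = top \<and> h E \<subseteq> E \<and> 1 \<le> \<bar>smeas \<nu> (E - h E)\<bar>"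
    by metis
  define E where "E n = (h ^^ n) UNIV" for n
  have E: "E n \<in> sets borel \<and> upper_var \<nu> (E n) = top" for n
    unfolding E_def by (induction n) (use top h in auto)
  have ES: "E (Suc n) = h (E n)" for n by (simp add: E_def)
  have dec: "decseq E"
    using E h ES by (intro decseq_SucI) metis
  define D where "D n = E n - E (Suc n)" for n
  have "disjoint_family D"
  proof -
    have "D i \<inter> D j = {}" if "i < j" for i j
    proof -
      have "E j \<subseteq> E (Suc i)" using dec that by (auto simp: decseq_def)
      then show ?thesis by (auto simp: D_def)
    qed
    then show ?thesis
      unfolding disjoint_family_on_def by (metis inf_commute nat_neq_iff)
  qed
  moreover have "range D \<subseteq> sets borel" using E by (auto simp: D_def)
  ultimately have "(\<lambda>n. smeas \<nu> (D n)) \<longlonglongrightarrow> 0"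
    by (intro summable_LIMSEQ_zero sums_summable[OF smeas_sums])
  then have "eventually (\<lambda>n. \<bar>smeas \<nu> (D n)\<bar> < 1) sequentially"
    by (auto simp: tendsto_iff dist_real_def)
  moreover have "1 \<le> \<bar>smeas \<nu> (D n)\<bar>" for n
    using E h ES D_def by metis
  ultimately show False
    by (auto simp: not_less[symmetric] eventually_sequentially)
qed

lemma finite_measure_pos_part: "finite_measure (pos_part \<nu>)"
  by (rule finite_measureI) (simp add: emeasure_pos_part upper_var_finite)

lemma smeas_uminus: "smeas (- \<nu>) A = - smeas \<nu> A"
  and smeas_add: "smeas (\<nu> + \<rho>) A = smeas \<nu> A + smeas \<rho> A"
  and smeas_diff: "smeas (\<nu> - \<rho>) A = smeas \<nu> A - smeas \<rho> A"
  and smeas_scaleR: "smeas (c *\<^sub>R \<nu>) A = c * smeas \<nu> A"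
  and smeas_zero: "smeas 0 A = 0"
  by (transfer; simp)+

lemmas smeas_simps = smeas_uminus smeas_add smeas_diff smeas_scaleR smeas_zero

lemma smeas_eqI: "(\<And>A. A \<in> sets borel \<Longrightarrow> smeas \<nu> A = smeas \<rho> A) \<Longrightarrow> \<nu> = \<rho>"
  by (metis smeas_inject smeas_not_borel ext)

text \<open>No Hahn set is needed: for \<open>B \<subseteq> A\<close> the value of \<open>B\<close>
  is that of \<open>A\<close> minus that of \<open>A - B\<close>, hence at most the value of
  \<open>A\<close> plus the negative part of \<open>A\<close>. The supremum over \<open>B\<close>
  gives one inequality, and the same for \<open>- \<nu>\<close> the other.\<close>

lemma measure_pos_part_diff:
  assumes A: "A \<in> sets borel"
  shows "measure (pos_part \<nu>) A - measure (pos_part (- \<nu>)) A = smeas \<nu> A"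
proof -
  interpret P: finite_measure "pos_part \<nu>" by (rule finite_measure_pos_part)
  interpret N: finite_measure "pos_part (- \<nu>)" by (rule finite_measure_pos_part)
  have le: "measure (pos_part \<nu>) A \<le> smeas \<nu> A + measure (pos_part (- \<nu>)) A" for \<nu> :: "'a signed_measure"
  proof -
    interpret P: finite_measure "pos_part \<nu>" by (rule finite_measure_pos_part)
    interpret N: finite_measure "pos_part (- \<nu>)" by (rule finite_measure_pos_part)
    have le': "smeas \<nu> B \<le> smeas \<nu> A + measure (pos_part (- \<nu>)) A" if B: "B \<in> sets borel" "B \<subseteq> A" for B
    proof -
      have "ennreal (smeas (- \<nu>) (A - B)) \<le> emeasure (pos_part (- \<nu>)) A"
        using A B by (subst emeasure_pos_part) (auto intro: upper_var_upper)
      then have "smeas (- \<nu>) (A - B) \<le> measure (pos_part (- \<nu>)) A"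
        by (simp add: N.emeasure_eq_measure ennreal_le_iff)
      then show ?thesis
        using smeas_Diff[OF A B, of \<nu>] by (simp add: smeas_simps)
    qed
    have "0 \<le> smeas \<nu> A + measure (pos_part (- \<nu>)) A" using le'[of "{}"] by simp
    then have "emeasure (pos_part \<nu>) A \<le> ennreal (smeas \<nu> A + measure (pos_part (- \<nu>)) A)"
      using A le' by (subst emeasure_pos_part) (auto simp: upper_var_def intro!: SUP_least ennreal_leI)
    then show ?thesis
      using \<open>0 \<le> smeas \<nu> A + measure (pos_part (- \<nu>)) A\<close>
      by (simp add: P.emeasure_eq_measure ennreal_le_iff)
  qed
  show ?thesis
    using le[of \<nu>] le[of "- \<nu>"] by (simp add: smeas_simps)
qed

text \<open>The Jordan parts of a sum are not the sums of the Jordan parts, so linearity of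
  \<open>signed_integral\<close> cannot be read off termwise. It follows from a linear relation
  between finite measures, which carries over to integrals of bounded functions.\<close>

lemma zero_combination_integral:
  fixes M :: "'i \<Rightarrow> 'a::topological_space measure" and c :: "'i \<Rightarrow> real"
  assumes fin: "\<And>i. i \<in> I \<Longrightarrow> finite_measure (M i)"
    and sets: "\<And>i. i \<in> I \<Longrightarrow> sets (M i) = sets borel"
    and zero: "\<And>A. A \<in> sets borel \<Longrightarrow> (\<Sum>i\<in>I. c i * measure (M i) A) = 0"
    and f: "f \<in> borel_measurable borel" and bd: "\<And>x. \<bar>f x\<bar> \<le> B"
  shows "(\<Sum>i\<in>I. c i * (LINT x|M i. f x)) = 0"
proof -
  have sp: "space (M i) = UNIV" if "i \<in> I" for i
    using sets_eq_imp_space_eq[OF sets[OF that]] by simp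
  have meas: "u \<in> borel_measurable (M i)" if "u \<in> borel_measurable borel" "i \<in> I"
    for u :: "'a \<Rightarrow> real" and i
    using that(1) measurable_cong_sets[OF sets[OF that(2)] refl] by blast
  have int: "integrable (M i) u"
    if "u \<in> borel_measurable borel" "i \<in> I" "\<And>x. \<bar>u x\<bar> \<le> b" for u :: "'a \<Rightarrow> real" and i b
    using that by (intro finite_measure.integrable_const_bound[OF fin, of _ _ b] meas) auto
  \<comment> \<open>The bound is a premise inside the induction formula: the summands and
    approximants of a bounded nonnegative function inherit it and are therefore integrable.\<close>
  have nonneg: "(\<exists>b. \<forall>x. u x \<le> b) \<longrightarrow> (\<Sum>i\<in>I. c i * (LINT x|M i. u x)) = 0"
    if um: "u \<in> borel_measurable borel" "\<And>x. 0 \<le> u x" for u :: "'a \<Rightarrow> real"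
    using um
  proof (induction u rule: borel_measurable_induct_real)
    case (set A)
    then show ?case using zero[of A] sp by simp
  next
    case (mult u k)
    show ?case
    proof (cases "k = 0")
      case False
      show ?thesis
      proof
        assume "\<exists>b. \<forall>x. k * u x \<le> b"
        then obtain b where b: "\<And>x. k * u x \<le> b" by auto
        then have "\<forall>x. u x \<le> b / k"
          using mult(1) False by (auto simp: field_simps)
        then have "(\<Sum>i\<in>I. c i * (LINT x|M i. u x)) = 0"
          using mult by blast
        then show "(\<Sum>i\<in>I. c i * (LINT x|M i. k * u x)) = 0"
          by (simp add: mult.left_commute flip: sum_distrib_left)
      qed
    qed simp
  next
    case (add u v)
    show ?case
    proof
      assume "\<exists>b. \<forall>x. v x + u x \<le> b"
      then obtain b where b: "\<And>x. v x + u x \<le> b" by auto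
      have ub: "u x \<le> b" "v x \<le> b" for x using b[of x] add.hyps(2,4)[of x] by linarith+
      have "(LINT x|M i. v x + u x) = (LINT x|M i. v x) + (LINT x|M i. u x)" if "i \<in> I" for i
        using add ub that by (intro Bochner_Integration.integral_add int[where b = b]) auto
      then have "(\<Sum>i\<in>I. c i * (LINT x|M i. v x + u x))
          = (\<Sum>i\<in>I. c i * (LINT x|M i. v x)) + (\<Sum>i\<in>I. c i * (LINT x|M i. u x))"
        by (simp add: distrib_left sum.distrib)
      moreover have "(\<Sum>i\<in>I. c i * (LINT x|M i. u x)) = 0"
        using add.IH(1) ub by blast
      moreover have "(\<Sum>i\<in>I. c i * (LINT x|M i. v x)) = 0"
        using add.IH(2) ub by blast
      ultimately show "(\<Sum>i\<in>I. c i * (LINT x|M i. v x + u x)) = 0" by simp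
    qed
  next
    case (seq U)
    show ?case
    proof
      assume "\<exists>b. \<forall>x. u x \<le> b"
      then obtain b where b: "\<And>x. u x \<le> b" by auto
      have Ub: "U i x \<le> b" for i x
      proof -
        have "incseq (\<lambda>i. U i x)" using seq.hyps(3) by (auto simp: incseq_def le_fun_def)
        then have "U i x \<le> u x" using seq.hyps(4) by (intro incseq_le) auto
        then show ?thesis using b[of x] by linarith
      qed
      have "(\<lambda>n. LINT x|M i. U n x) \<longlonglongrightarrow> (LINT x|M i. u x)" if "i \<in> I" for i
      proof (rule integral_dominated_convergence[where w = "\<lambda>_. b"])
        show "integrable (M i) (\<lambda>_. b)"
          using fin[OF that] by (rule finite_measure.integrable_const)
        show "AE x in M i. norm (U n x) \<le> b" for n
          using seq.hyps(2) Ub by (intro AE_I2) auto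
        show "AE x in M i. (\<lambda>n. U n x) \<longlonglongrightarrow> u x"
          using seq.hyps(4) by (intro AE_I2) auto
        show "u \<in> borel_measurable (M i)" by (rule meas[OF um(1) that])
        show "U n \<in> borel_measurable (M i)" for n by (rule meas[OF seq.hyps(1) that])
      qed
      then have "(\<lambda>n. \<Sum>i\<in>I. c i * (LINT x|M i. U n x)) \<longlonglongrightarrow> (\<Sum>i\<in>I. c i * (LINT x|M i. u x))"
        by (intro tendsto_intros)
      moreover have "(\<Sum>i\<in>I. c i * (LINT x|M i. U n x)) = 0" for n
        using seq.IH[of n] Ub by blast
      ultimately show "(\<Sum>i\<in>I. c i * (LINT x|M i. u x)) = 0"
        by (simp add: LIMSEQ_const_iff)
    qed
  qed
  \<comment> \<open>The general case reduces to nonnegative functions by adding the constant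
    \<open>B\<close>.\<close>
  have nB: "\<bar>f x + B\<bar> \<le> 2 * B" "0 \<le> f x + B" "f x + B \<le> 2 * B" "0 \<le> B" for x
    using bd[of x] by auto
  have eq: "(LINT x|M i. f x + B) = (LINT x|M i. f x) + (LINT x|M i. B)" if "i \<in> I" for i
    using f bd that nB by (intro Bochner_Integration.integral_add int[where b = B]) auto
  have "(\<lambda>x. f x + B) \<in> borel_measurable borel" using f by simp
  then have "(\<Sum>i\<in>I. c i * (LINT x|M i. f x + B)) = 0"
    using nonneg[of "\<lambda>x. f x + B"] nB by blast
  moreover have "(\<Sum>i\<in>I. c i * (LINT x|M i. B)) = 0"
    using nonneg[of "\<lambda>x. B"] nB(4) by auto
  ultimately show ?thesis
    using eq by (simp add: distrib_left sum.distrib)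
qed

lemma
  fixes K :: "'a::t2_space set" and f :: "'a \<Rightarrow> real"
  assumes K: "compact K" and f: "continuous_on K f"
  shows indicator_continuous_measurable: "(\<lambda>x. indicator K x * f x) \<in> borel_measurable borel"
    and indicator_continuous_bounded: "\<exists>B. \<forall>x. \<bar>indicator K x * f x\<bar> \<le> B"
proof -
  show "(\<lambda>x. indicator K x * f x) \<in> borel_measurable borel"
    using borel_measurable_continuous_on_indicator[OF borel_compact[OF K] f] by simp
  obtain B where B: "\<And>x. x \<in> K \<Longrightarrow> \<bar>f x\<bar> \<le> B"
    using compact_imp_bounded[OF compact_continuous_image[OF f K]]
    by (auto simp: bounded_iff)
  have "\<forall>x. \<bar>indicator K x * f x\<bar> \<le> max B 0"
    using B by (auto simp: indicator_def intro: max.coboundedI1)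
  then show "\<exists>B. \<forall>x. \<bar>indicator K x * f x\<bar> \<le> B" ..
qed

lemma signed_integral_alt:
  "signed_integral \<nu> K f = (LINT x|pos_part \<nu>. indicator K x * f x)
    - (LINT x|pos_part (- \<nu>). indicator K x * f x)"
  by (simp add: signed_integral_def set_lebesgue_integral_def)

lemma signed_integral_lincomb:
  fixes K :: "'a::t2_space set"
  assumes K: "compact K" and f: "continuous_on K f"
  shows "signed_integral (a *\<^sub>R \<nu> + b *\<^sub>R \<rho>) K f = a * signed_integral \<nu> K f + b * signed_integral \<rho> K f"
proof -
  let ?\<sigma> = "a *\<^sub>R \<nu> + b *\<^sub>R \<rho>"
  \<comment> \<open>The six Jordan parts are tied together only by
    \<open>measure_pos_part_diff\<close> for the three signed measures; the coefficients
    \<open>c\<close> spell out this single relation.\<close>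
  define M where "M i = [pos_part ?\<sigma>, pos_part (- ?\<sigma>), pos_part \<nu>, pos_part (- \<nu>), pos_part \<rho>, pos_part (- \<rho>)] ! i" for i
  define c where "c i = [1, - 1, - a, a, - b, b] ! i" for i
  obtain B where B: "\<And>x. \<bar>indicator K x * f x\<bar> \<le> B"
    using indicator_continuous_bounded[OF K f] by auto
  have cases: "i \<in> {..<6} \<Longrightarrow> i \<in> {0, 1, 2, 3, 4, 5}" for i :: nat by auto
  have I: "{..<6::nat} = {0, 1, 2, 3, 4, 5}" by auto
  have "(\<Sum>i<6. c i * (LINT x|M i. indicator K x * f x)) = 0"
  proof (rule zero_combination_integral[where B = B])
    show "finite_measure (M i)" "sets (M i) = sets borel" if "i \<in> {..<6}" for i
      using cases[OF that] by (auto simp: M_def finite_measure_pos_part)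
    fix A :: "'a set" assume A: "A \<in> sets borel"
    show "(\<Sum>i<6. c i * measure (M i) A) = 0"
    proof -
      have "measure (pos_part ?\<sigma>) A - measure (pos_part (- ?\<sigma>)) A
          = a * (measure (pos_part \<nu>) A - measure (pos_part (- \<nu>)) A)
            + b * (measure (pos_part \<rho>) A - measure (pos_part (- \<rho>)) A)"
        unfolding measure_pos_part_diff[OF A] by (simp add: smeas_simps)
      then show ?thesis
        unfolding I by (simp add: M_def c_def right_diff_distrib del: minus_add_distrib)
    qed
  qed (use B indicator_continuous_measurable[OF K f] in auto)
  then show ?thesis
    unfolding I signed_integral_alt by (simp add: M_def c_def algebra_simps)
qed

lemma signed_integral_add:
  "compact K \<Longrightarrow> continuous_on K f \<Longrightarrow>
    signed_integral (\<nu> + \<rho>) K f = signed_integral \<nu> K f + signed_integral \<rho> K f"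
  for K :: "'a::t2_space set"
  using signed_integral_lincomb[of K f 1 \<nu> 1 \<rho>] by simp

lemma signed_integral_diff:
  "compact K \<Longrightarrow> continuous_on K f \<Longrightarrow>
    signed_integral (\<nu> - \<rho>) K f = signed_integral \<nu> K f - signed_integral \<rho> K f"
  for K :: "'a::t2_space set"
  using signed_integral_lincomb[of K f 1 \<nu> "-1" \<rho>] by simp

lemma pos_part_uminus_null:
  assumes "\<And>B. B \<in> sets borel \<Longrightarrow> B \<subseteq> A \<Longrightarrow> 0 \<le> smeas \<nu> B" "A \<in> sets borel"
  shows "A \<in> null_sets (pos_part (- \<nu>))"
proof -
  have "emeasure (pos_part (- \<nu>)) A \<le> 0"
    unfolding emeasure_pos_part[OF assms(2)] upper_var_def
    using assms by (intro SUP_least) (simp add: smeas_simps ennreal_neg)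
  then show ?thesis using assms(2) by (intro null_setsI) auto
qed

lemma measure_pos_part_nonneg:
  assumes "\<And>B. B \<in> sets borel \<Longrightarrow> 0 \<le> smeas \<nu> B" "A \<in> sets borel"
  shows "measure (pos_part \<nu>) A = smeas \<nu> A"
  using measure_pos_part_diff[OF assms(2), of \<nu>] pos_part_uminus_null[of A \<nu>] assms
  by (simp add: null_setsD1 measure_def)

text \<open>Off \<open>Z\<close> the negative part is null, and on \<open>Z\<close> the integrand
  vanishes.\<close>

lemma signed_integral_nonneg:
  fixes K :: "'a::t2_space set"
  assumes K: "compact K" and f: "continuous_on K f" "\<And>x. x \<in> K \<Longrightarrow> 0 \<le> f x"
    "\<And>x. x \<in> K \<inter> Z \<Longrightarrow> f x = 0"
    and Z: "Z \<in> sets borel" and \<nu>: "\<And>A. A \<in> sets borel \<Longrightarrow> A \<inter> Z = {} \<Longrightarrow> 0 \<le> smeas \<nu> A"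
  shows "0 \<le> signed_integral \<nu> K f"
proof -
  have "- Z \<in> null_sets (pos_part (- \<nu>))"
    using Z by (intro pos_part_uminus_null \<nu>) auto
  then have "AE x in pos_part (- \<nu>). indicator K x * f x = 0"
    by (rule AE_I') (use f(3) in \<open>auto simp: indicator_def\<close>)
  then have "(LINT x|pos_part (- \<nu>). indicator K x * f x) = 0"
    by (rule integral_eq_zero_AE)
  moreover have "0 \<le> (LINT x|pos_part \<nu>. indicator K x * f x)"
    using f(2) by (intro Bochner_Integration.integral_nonneg) (auto simp: indicator_def)
  ultimately show ?thesis
    by (simp add: signed_integral_alt)
qed

text \<open>Converse to \<open>signed_integral_nonneg\<close>. A compact subset of
  \<open>A \<inter> K\<close> has positive distance from \<open>Z\<close>, so its indicator is a
  limit of test functions vanishing on \<open>Z\<close>; this compares the Jordan parts on compact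
  sets, and inner regularity extends the comparison to \<open>A \<inter> K\<close>.\<close>

lemma smeas_nonneg_of_integral:
  fixes K :: "'a::euclidean_space set"
  assumes K: "compact K" and \<nu>: "\<nu> \<in> signed_measures_on K" and Z: "closed Z"
    and int: "\<And>f. continuous_on UNIV f \<Longrightarrow> (\<And>x. 0 \<le> f x) \<Longrightarrow> (\<And>x. x \<in> Z \<Longrightarrow> f x = 0) \<Longrightarrow>
      0 \<le> signed_integral \<nu> K f"
    and A: "A \<in> sets borel" "A \<inter> Z = {}"
  shows "0 \<le> smeas \<nu> A"
proof -
  let ?P = "pos_part \<nu>" and ?N = "pos_part (- \<nu>)"
  interpret P: finite_measure ?P by (rule finite_measure_pos_part)
  interpret N: finite_measure ?N by (rule finite_measure_pos_part)
  have Kb: "K \<in> sets borel" using K by (rule borel_compact)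
  have comp: "measure ?N F \<le> measure ?P F" if F: "compact F" "F \<subseteq> A \<inter> K" for F
  proof (cases "F = {}")
    case False
    have clF: "closed F" using F(1) by (rule compact_imp_closed)
    obtain d where d: "0 < d" "\<And>x y. x \<in> F \<Longrightarrow> y \<in> Z \<Longrightarrow> d \<le> dist x y"
      using separate_compact_closed[OF F(1) Z] F(2) A(2) by blast
    \<comment> \<open>A slope of at least \<open>1 / d\<close> makes \<open>h n\<close> vanish at
      distance \<open>d\<close> from \<open>F\<close>, hence on \<open>Z\<close>; the growing term
      \<open>real n\<close> makes \<open>h n\<close> tend to the indicator of
      \<open>F\<close>.\<close>
    define h where "h n x = max 0 (1 - (real n + 1 / d) * infdist x F)" for n x
    have cont: "continuous_on UNIV (h n)" for n
      unfolding h_def by (intro continuous_intros)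
    have h01: "0 \<le> h n x" "h n x \<le> 1" for n x
      using d(1) infdist_nonneg[of x F] by (auto simp: h_def)
    have hZ: "h n x = 0" if "x \<in> Z" for n x
    proof -
      obtain y where "y \<in> F" "infdist x F = dist x y"
        using infdist_attains_inf[OF clF False] by auto
      then have "d \<le> infdist x F" using d(2) that by (metis dist_commute)
      then have "1 \<le> (real n + 1 / d) * infdist x F"
        using d(1) mult_mono[of "1 / d" "real n + 1 / d" d "infdist x F"] by simp
      then show ?thesis by (simp add: h_def)
    qed
    have lim: "(\<lambda>n. h n x) \<longlonglongrightarrow> indicator F x" for x
    proof (cases "x \<in> F")
      case False
      then have pos: "0 < infdist x F"
        using clF \<open>F \<noteq> {}\<close> infdist_pos_not_in_closed by blast
      have "eventually (\<lambda>n. h n x = 0) sequentially"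
      proof -
        obtain n0 :: nat where n0: "1 / infdist x F < n0" using reals_Archimedean2 by blast
        have "h n x = 0" if "n \<ge> n0" for n
        proof -
          have "1 \<le> real n0 * infdist x F" using n0 pos by (simp add: field_simps)
          also have "\<dots> \<le> (real n + 1 / d) * infdist x F"
            using that d(1) pos by (intro mult_right_mono) (auto simp: add_increasing2)
          finally show ?thesis by (simp add: h_def)
        qed
        then show ?thesis by (auto simp: eventually_sequentially)
      qed
      then show ?thesis using False by (simp add: tendsto_eventually)
    qed (simp add: h_def)
    have conv: "(\<lambda>n. LINT x|M. indicator K x * h n x) \<longlonglongrightarrow> measure M F"
      if M: "finite_measure M" "sets M = sets borel" for M
    proof -
      have "(\<lambda>n. LINT x|M. indicator K x * h n x) \<longlonglongrightarrow> (LINT x|M. indicator F x)"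
      proof (rule integral_dominated_convergence[where w = "\<lambda>_. 1"])
        show "AE x in M. (\<lambda>n. indicator K x * h n x) \<longlonglongrightarrow> indicator F x"
        proof (rule AE_I2)
          fix x
          have "(\<lambda>n. indicator K x * h n x) \<longlonglongrightarrow> indicator K x * indicator F x"
            by (intro tendsto_intros lim)
          then show "(\<lambda>n. indicator K x * h n x) \<longlonglongrightarrow> (indicator F x :: real)"
            using F(2) by (auto simp: indicator_def split: if_splits)
        qed
        show "AE x in M. norm (indicator K x * h n x) \<le> 1" for n
          using h01 by (intro AE_I2) (auto simp: indicator_def)
        show "integrable M (\<lambda>_. 1::real)"
          using M(1) by (rule finite_measure.integrable_const)
        show "(indicator F :: 'a \<Rightarrow> real) \<in> borel_measurable M"
          using clF M(2) by (intro borel_measurable_indicator) auto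
        show "(\<lambda>x. indicator K x * h n x) \<in> borel_measurable M" for n
          using indicator_continuous_measurable[OF K continuous_on_subset[OF cont subset_UNIV]]
            measurable_cong_sets[OF M(2) refl] by blast
      qed
      moreover have "space M = UNIV" using sets_eq_imp_space_eq[OF M(2)] by simp
      ultimately show ?thesis by simp
    qed
    have "(LINT x|?N. indicator K x * h n x) \<le> (LINT x|?P. indicator K x * h n x)" for n
      using int[OF cont h01(1) hZ, of n] by (simp add: signed_integral_alt)
    then show ?thesis
      by (intro LIMSEQ_le[OF conv conv]) (auto simp: finite_measure_pos_part)
  qed simp
  have "emeasure ?N (A \<inter> K) = (SUP F\<in>{F. F \<subseteq> A \<inter> K \<and> compact F}. emeasure ?N F)"
    using A Kb N.emeasure_finite by (intro inner_regular) auto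
  also have "\<dots> \<le> emeasure ?P (A \<inter> K)"
  proof (rule SUP_least)
    fix F assume F: "F \<in> {F. F \<subseteq> A \<inter> K \<and> compact F}"
    then have "emeasure ?N F \<le> emeasure ?P F"
      using comp by (auto simp: N.emeasure_eq_measure P.emeasure_eq_measure)
    also have "\<dots> \<le> emeasure ?P (A \<inter> K)"
      using F A Kb by (intro emeasure_mono) auto
    finally show "emeasure ?N F \<le> emeasure ?P (A \<inter> K)" .
  qed
  finally have "measure ?N (A \<inter> K) \<le> measure ?P (A \<inter> K)"
    by (simp add: N.emeasure_eq_measure P.emeasure_eq_measure)
  then have "0 \<le> smeas \<nu> (A \<inter> K)"
    using measure_pos_part_diff[of "A \<inter> K" \<nu>] A Kb by simp
  moreover have "smeas \<nu> A = smeas \<nu> (A \<inter> K) + smeas \<nu> (A - K)"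
    using smeas_Un[of "A \<inter> K" "A - K" \<nu>] A Kb by (auto simp: Int_Diff_Un)
  moreover have "smeas \<nu> (A - K) = 0"
    using \<nu> A Kb by (auto simp: signed_measures_on_def)
  ultimately show ?thesis by simp
qed

section \<open>The weak topology\<close>

lemma topspace_weak_topology [simp]: "topspace (weak_topology K) = signed_measures_on K"
proof -
  let ?B = "{{\<nu> \<in> signed_measures_on K. signed_integral \<nu> K f \<in> V} | f V. continuous_on K f \<and> open V}"
  have "signed_measures_on K \<in> ?B"
    by (rule CollectI, rule exI[of _ "\<lambda>_. 0"], rule exI[of _ UNIV]) simp
  then have "\<Union> ?B = signed_measures_on K"
    by (intro equalityI Union_upper Union_least) auto
  then show ?thesis
    unfolding weak_topology_def topology_generated_by_topspace .
qed

lemma subspace_signed_measures_on: "subspace (signed_measures_on K)"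
  by (auto simp: subspace_def signed_measures_on_def smeas_simps)

lemma openin_weak_topology:
  "continuous_on K f \<Longrightarrow> open V \<Longrightarrow>
    openin (weak_topology K) {\<nu> \<in> signed_measures_on K. signed_integral \<nu> K f \<in> V}"
  unfolding weak_topology_def by (rule topology_generated_by_Basis) auto

lemma continuous_map_signed_integral:
  "continuous_on K f \<Longrightarrow> continuous_map (weak_topology K) euclideanreal (\<lambda>\<nu>. signed_integral \<nu> K f)"
  by (auto simp: continuous_map_def openin_weak_topology)

lemma continuous_map_into_weak_topology:
  assumes "g \<in> topspace X \<rightarrow> signed_measures_on K"
    and "\<And>f. continuous_on K f \<Longrightarrow> continuous_map X euclideanreal (\<lambda>x. signed_integral (g x) K f)"
  shows "continuous_map X (weak_topology K) g"
  unfolding weak_topology_def continuous_on_generated_topo_iff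
proof (intro conjI allI impI)
  fix U assume "U \<in> {{\<nu> \<in> signed_measures_on K. signed_integral \<nu> K f \<in> V} | f V. continuous_on K f \<and> open V}"
  then obtain f V where fV: "U = {\<nu> \<in> signed_measures_on K. signed_integral \<nu> K f \<in> V}" "continuous_on K f" "open V"
    by auto
  have "g -` U \<inter> topspace X = {x \<in> topspace X. signed_integral (g x) K f \<in> V}"
    using assms(1) fV(1) by auto
  then show "openin X (g -` U \<inter> topspace X)"
    using openin_continuous_map_preimage[OF assms(2)[OF fV(2)], of V] fV(3) by simp
next
  have "\<Union> {{\<nu> \<in> signed_measures_on K. signed_integral \<nu> K f \<in> V} | f V. continuous_on K f \<and> open V}
      = signed_measures_on K"
    using topspace_weak_topology[of K] unfolding weak_topology_def topology_generated_by_topspace .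
  then show "g ` topspace X
      \<subseteq> \<Union> {{\<nu> \<in> signed_measures_on K. signed_integral \<nu> K f \<in> V} | f V. continuous_on K f \<and> open V}"
    using assms(1) by auto
qed

text \<open>Domination off \<open>Z\<close> is equivalent to inequalities between integrals of
  nonnegative continuous functions vanishing on \<open>Z\<close>, and each of these is a closed
  condition. The case \<open>Z = {}\<close> yields positivity, \<open>Z = {p}\<close> the sets used
  for prevalence.\<close>

lemma closedin_smeas_ge:
  fixes K :: "'a::euclidean_space set"
  assumes K: "compact K" and \<rho>: "\<rho> \<in> signed_measures_on K" and Z: "closed Z"
  shows "closedin (weak_topology K)
    {\<nu> \<in> signed_measures_on K. \<forall>A\<in>sets borel. A \<inter> Z = {} \<longrightarrow> smeas \<rho> A \<le> smeas \<nu> A}"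
    (is "closedin _ ?S")
proof -
  define \<F> where "\<F> = {f. continuous_on UNIV f \<and> (\<forall>x::'a. 0 \<le> (f x :: real)) \<and> (\<forall>x\<in>Z. f x = 0)}"
  have "\<nu> \<in> ?S \<longleftrightarrow> (\<nu> \<in> signed_measures_on K \<and> (\<forall>f\<in>\<F>. signed_integral \<rho> K f \<le> signed_integral \<nu> K f))"
    (is "?L \<longleftrightarrow> ?R") for \<nu>
  proof
    assume L: ?L
    have "signed_integral \<rho> K f \<le> signed_integral \<nu> K f" if f: "f \<in> \<F>" for f
    proof -
      have cf: "continuous_on K f" using f continuous_on_subset by (auto simp: \<F>_def)
      have "0 \<le> signed_integral (\<nu> - \<rho>) K f"
        using K cf f L Z by (intro signed_integral_nonneg[of K f Z]) (auto simp: \<F>_def smeas_simps)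
      then show ?thesis by (simp add: signed_integral_diff[OF K cf])
    qed
    then show ?R using L by simp
  next
    assume R: ?R
    have "0 \<le> smeas (\<nu> - \<rho>) A" if A: "A \<in> sets borel" "A \<inter> Z = {}" for A
    proof (rule smeas_nonneg_of_integral[OF K _ Z _ A])
      show "\<nu> - \<rho> \<in> signed_measures_on K"
        using R \<rho> subspace_signed_measures_on subspace_diff by blast
      fix f :: "'a \<Rightarrow> real"
      assume f: "continuous_on UNIV f" "\<And>x. 0 \<le> f x" "\<And>x. x \<in> Z \<Longrightarrow> f x = 0"
      then have cf: "continuous_on K f" using continuous_on_subset subset_UNIV by blast
      have "f \<in> \<F>" using f by (auto simp: \<F>_def)
      then show "0 \<le> signed_integral (\<nu> - \<rho>) K f"
        using R by (simp add: signed_integral_diff[OF K cf])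
    qed
    then show ?L using R by (auto simp: smeas_simps)
  qed
  then have "?S = topspace (weak_topology K) \<inter>
      (\<Inter>f\<in>\<F>. {\<nu> \<in> topspace (weak_topology K). signed_integral \<nu> K f \<in> {signed_integral \<rho> K f..}})"
    by auto
  also have "closedin (weak_topology K) \<dots>"
  proof (cases "\<F> = {}")
    case False
    have "closedin (weak_topology K)
        {\<nu> \<in> topspace (weak_topology K). signed_integral \<nu> K f \<in> {signed_integral \<rho> K f..}}"
      if "f \<in> \<F>" for f
    proof (rule closedin_continuous_map_preimage[OF continuous_map_signed_integral])
      show "continuous_on K f" using that continuous_on_subset by (auto simp: \<F>_def)
    qed auto
    then show ?thesis using False by (intro closedin_Int closedin_INT closedin_topspace) auto
  qed (use closedin_topspace[of "weak_topology K"] in simp)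
  finally show ?thesis .
qed

lemma signed_measure_eq_if_integrals:
  fixes K :: "'a::euclidean_space set"
  assumes K: "compact K" and \<nu>: "\<nu> \<in> signed_measures_on K" "\<rho> \<in> signed_measures_on K"
    and eq: "\<And>f. continuous_on UNIV f \<Longrightarrow> signed_integral \<nu> K f = signed_integral \<rho> K f"
  shows "\<nu> = \<rho>"
proof (rule smeas_eqI)
  have le: "smeas \<rho> A \<le> smeas \<nu> A"
    if \<nu>: "\<nu> \<in> signed_measures_on K" "\<rho> \<in> signed_measures_on K"
      and eq: "\<And>f. continuous_on UNIV f \<Longrightarrow> signed_integral \<nu> K f = signed_integral \<rho> K f"
      and A: "A \<in> sets borel" for A \<nu> \<rho>
  proof -
    have "0 \<le> smeas (\<nu> - \<rho>) A"
    proof (rule smeas_nonneg_of_integral[OF K _ closed_empty _ A])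
      show "\<nu> - \<rho> \<in> signed_measures_on K"
        using \<nu> subspace_signed_measures_on subspace_diff by blast
      fix f :: "'a \<Rightarrow> real" assume f: "continuous_on UNIV f"
      then have "continuous_on K f" using continuous_on_subset by auto
      then show "0 \<le> signed_integral (\<nu> - \<rho>) K f"
        using eq[OF f] by (simp add: signed_integral_diff[OF K])
    qed simp
    then show ?thesis by (simp add: smeas_simps)
  qed
  show "smeas \<nu> A = smeas \<rho> A" if "A \<in> sets borel" for A
    using le[OF \<nu> eq that] le[OF \<nu>(2,1) eq[symmetric] that] by simp
qed

text \<open>Makes compact sets closed, so that the support of a measure carried by a compact segment
  stays inside the segment.\<close>

lemma Hausdorff_space_weak_topology:
  fixes K :: "'a::euclidean_space set"
  assumes K: "compact K"
  shows "Hausdorff_space (weak_topology K)"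
  unfolding Hausdorff_space_def
proof (intro allI impI)
  fix \<nu> \<rho> assume h: "\<nu> \<in> topspace (weak_topology K) \<and> \<rho> \<in> topspace (weak_topology K) \<and> \<nu> \<noteq> \<rho>"
  then obtain f where f: "continuous_on UNIV f" "signed_integral \<nu> K f \<noteq> signed_integral \<rho> K f"
    using signed_measure_eq_if_integrals[OF K] by auto
  obtain U V where UV: "open U" "open V" "signed_integral \<nu> K f \<in> U" "signed_integral \<rho> K f \<in> V" "U \<inter> V = {}"
    using hausdorff[OF f(2)] by blast
  have cf: "continuous_on K f" using f(1) continuous_on_subset by auto
  show "\<exists>U V. openin (weak_topology K) U \<and> openin (weak_topology K) V \<and> \<nu> \<in> U \<and> \<rho> \<in> V \<and> disjnt U V"
    using h UV openin_weak_topology[OF cf UV(1)] openin_weak_topology[OF cf UV(2)]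
    by (intro exI[of _ "{\<nu> \<in> signed_measures_on K. signed_integral \<nu> K f \<in> U}"]
        exI[of _ "{\<nu> \<in> signed_measures_on K. signed_integral \<nu> K f \<in> V}"]) (auto simp: disjnt_def)
qed

text \<open>Positivity is domination of the zero measure, and total mass 1 is a condition on the
  integral of the constant 1.\<close>

lemma closedin_prob_measures_on:
  fixes K :: "'a::euclidean_space set"
  assumes K: "compact K"
  shows "closedin (weak_topology K) (prob_measures_on K)"
proof -
  have Kb: "K \<in> sets borel" using K by (rule borel_compact)
  have one: "signed_integral \<nu> K (\<lambda>_. 1) = smeas \<nu> K" for \<nu>
    using measure_pos_part_diff[OF Kb, of \<nu>] by (simp add: signed_integral_alt)
  have "prob_measures_on K =
      {\<nu> \<in> signed_measures_on K. \<forall>A\<in>sets borel. A \<inter> {} = {} \<longrightarrow> smeas 0 A \<le> smeas \<nu> A}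
      \<inter> {\<nu> \<in> topspace (weak_topology K). signed_integral \<nu> K (\<lambda>_. 1) \<in> {1}}"
    unfolding prob_measures_on_def one
    by (auto simp: smeas_simps) (metis smeas_not_borel order_refl)
  also have "closedin (weak_topology K) \<dots>"
  proof (intro closedin_Int)
    show "closedin (weak_topology K)
      {\<nu> \<in> signed_measures_on K. \<forall>A\<in>sets borel. A \<inter> {} = {} \<longrightarrow> smeas 0 A \<le> smeas \<nu> A}"
      by (rule closedin_smeas_ge[OF K subspace_0[OF subspace_signed_measures_on] closed_empty])
    show "closedin (weak_topology K) {\<nu> \<in> topspace (weak_topology K). signed_integral \<nu> K (\<lambda>_. 1) \<in> {1}}"
      by (rule closedin_continuous_map_preimage[OF continuous_map_signed_integral]) auto
  qed
  finally show ?thesis .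
qed

section \<open>Prevalence along a segment\<close>

lift_definition pmf_measure :: "'a::topological_space pmf \<Rightarrow> 'a signed_measure" is
  "\<lambda>P A. if A \<in> sets borel then measure (measure_pmf P) A else 0"
proof (intro conjI allI impI)
  fix P :: "'a pmf" and A :: "nat \<Rightarrow> 'a set"
  assume A: "range A \<subseteq> sets borel" "disjoint_family A"
  then have "(\<lambda>i. measure (measure_pmf P) (A i)) sums measure (measure_pmf P) (\<Union>i. A i)"
    by (intro measure_pmf.finite_measure_UNION) auto
  moreover have "(\<Union>i. A i) \<in> sets borel" using A by auto
  moreover have "A i \<in> sets borel" for i using A by auto
  ultimately show "(\<lambda>i. if A i \<in> sets borel then measure (measure_pmf P) (A i) else 0) sums
      (if (\<Union>i. A i) \<in> sets borel then measure (measure_pmf P) (\<Union>i. A i) else 0)"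
    by simp
qed simp

lemma pmf_measure_prob_measures_on:
  assumes "K \<in> sets borel" "set_pmf P \<subseteq> K"
  shows "pmf_measure P \<in> prob_measures_on K"
proof -
  have "measure (measure_pmf P) A = 0" if "A \<inter> K = {}" for A
    using that assms(2) by (subst measure_pmf_zero_iff) auto
  moreover have "measure (measure_pmf P) K = 1"
    using assms(2) measure_Int_set_pmf[of P K] measure_Int_set_pmf[of P UNIV]
    by (simp add: Int_absorb1)
  ultimately show ?thesis
    using assms(1) by (auto simp: prob_measures_on_def signed_measures_on_def pmf_measure.rep_eq)
qed

lemma prob_measures_on_convex:
  assumes "\<mu> \<in> prob_measures_on K" "\<nu> \<in> prob_measures_on K" "0 \<le> t" "t \<le> 1"
  shows "(1 - t) *\<^sub>R \<mu> + t *\<^sub>R \<nu> \<in> prob_measures_on K"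
  using assms by (auto simp: prob_measures_on_def signed_measures_on_def smeas_simps)

lemma space_borel_of [simp]: "space (borel_of T) = topspace T"
  unfolding borel_of_def by (rule space_measure_of) (auto dest: openin_subset)

lemma openin_sets_borel_of: "openin T U \<Longrightarrow> U \<in> sets (borel_of T)"
proof -
  have "{U. openin T U} \<subseteq> Pow (topspace T)"
    by (auto dest: openin_subset)
  moreover assume "openin T U"
  ultimately show ?thesis
    unfolding borel_of_def by simp
qed

lemma closedin_sets_borel_of: "closedin T U \<Longrightarrow> U \<in> sets (borel_of T)"
  using sets.Diff[OF sets.top openin_sets_borel_of, of T "topspace T - U"]
  by (auto simp: closedin_def Diff_Diff_Int Int_absorb1)

lemma continuous_map_measurable_borel_of:
  assumes g: "g \<in> space M \<rightarrow> topspace T"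
    and "\<And>U. openin T U \<Longrightarrow> g -` U \<inter> space M \<in> sets M"
  shows "g \<in> measurable M (borel_of T)"
  unfolding borel_of_def
  by (rule measurable_measure_of) (use assms in \<open>auto dest: openin_subset\<close>)

lemma closedin_msupport: "closedin T (msupport T \<Lambda>)"
proof -
  have "topspace T - msupport T \<Lambda> = \<Union>{U. openin T U \<and> emeasure \<Lambda> U = 0}"
    by (auto simp: msupport_def dest: openin_subset)
  moreover have "openin T (\<Union>{U. openin T U \<and> emeasure \<Lambda> U = 0})"
    by (rule openin_Union) auto
  ultimately show ?thesis
    by (auto simp: closedin_def msupport_def)
qed

text \<open>Shyness demands that translates be null sets, hence measurable. A translate is a
  preimage under the translation by \<open>- x\<close>, which is continuous because
  \<open>signed_integral\<close> is additive.\<close>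

lemma translate_sets_borel_of_weak_topology:
  fixes K :: "'a::t2_space set"
  assumes K: "compact K" and x: "x \<in> signed_measures_on K"
    and E: "E \<in> sets (borel_of (weak_topology K))"
  shows "(\<lambda>y. x + y) ` E \<in> sets (borel_of (weak_topology K))"
proof -
  let ?T = "weak_topology K"
  have nx: "- x \<in> signed_measures_on K"
    using subspace_neg[OF subspace_signed_measures_on x] .
  have cont: "continuous_map ?T ?T (\<lambda>y. - x + y)"
  proof (rule continuous_map_into_weak_topology)
    show "(\<lambda>y. - x + y) \<in> topspace ?T \<rightarrow> signed_measures_on K"
      using subspace_add[OF subspace_signed_measures_on nx] by simp
    fix f :: "'a \<Rightarrow> real" assume f: "continuous_on K f"
    have "continuous_map ?T euclideanreal (\<lambda>y. signed_integral (- x) K f + signed_integral y K f)"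
      by (intro continuous_map_add continuous_map_signed_integral f) auto
    then show "continuous_map ?T euclideanreal (\<lambda>y. signed_integral (- x + y) K f)"
      by (simp only: signed_integral_add[OF K f])
  qed
  have "(\<lambda>y. - x + y) \<in> measurable (borel_of ?T) (borel_of ?T)"
  proof (rule continuous_map_measurable_borel_of)
    show "(\<lambda>y. - x + y) \<in> space (borel_of ?T) \<rightarrow> topspace ?T"
      using subspace_add[OF subspace_signed_measures_on nx] by simp
    fix U assume "openin ?T U"
    from openin_sets_borel_of[OF openin_continuous_map_preimage[OF cont this]]
    show "(\<lambda>y. - x + y) -` U \<inter> space (borel_of ?T) \<in> sets (borel_of ?T)"
      by (simp add: vimage_def Int_def conj_commute)
  qed
  from measurable_sets[OF this E]
  have "(\<lambda>y. - x + y) -` E \<inter> signed_measures_on K \<in> sets (borel_of ?T)" by simp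
  moreover have "(\<lambda>y. - x + y) -` E \<inter> signed_measures_on K = (\<lambda>y. x + y) ` E"
  proof (intro equalityI subsetI)
    fix y assume "y \<in> (\<lambda>y. - x + y) -` E \<inter> signed_measures_on K"
    then show "y \<in> (\<lambda>y. x + y) ` E"
      by (intro image_eqI[of _ _ "- x + y"]) auto
  next
    fix y assume "y \<in> (\<lambda>y. x + y) ` E"
    then show "y \<in> (\<lambda>y. - x + y) -` E \<inter> signed_measures_on K"
      using sets.sets_into_space[OF E] subspace_add[OF subspace_signed_measures_on x] by auto
  qed
  ultimately show ?thesis by simp
qed

text \<open>The set \<open>A\<close> is arbitrary and may fail to be Borel; the Borel set inside it
  is \<open>B\<close>, where domination is tested with the multiples 1, 1/2, 1/3, ... of
  \<open>\<pi>\<close> only. Nothing is lost, since every positive multiple exceeds one of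
  these.\<close>

lemma prevalent_dominating:
  fixes K :: "'a::euclidean_space set"
  assumes K: "compact K" and p: "p \<in> K" and \<pi>: "\<pi> \<in> prob_measures_on K"
    and A: "A \<subseteq> prob_measures_on K"
    and dom: "\<And>\<mu> c. \<mu> \<in> prob_measures_on K \<Longrightarrow> 0 < c \<Longrightarrow>
      (\<And>X. X \<in> sets borel \<Longrightarrow> p \<notin> X \<Longrightarrow> c * smeas \<pi> X \<le> smeas \<mu> X) \<Longrightarrow> \<mu> \<in> A"
  shows "prevalent (weak_topology K) (prob_measures_on K) A"
proof -
  let ?T = "weak_topology K" and ?C = "prob_measures_on K"
  define S where "S n = {\<nu> \<in> signed_measures_on K. \<forall>X\<in>sets borel. X \<inter> {p} = {} \<longrightarrow>
      smeas (inverse (Suc n) *\<^sub>R \<pi>) X \<le> smeas \<nu> X}" for n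
  define B where "B = ?C \<inter> (\<Union>n. S n)"
  define c0 where "c0 = pmf_measure (return_pmf p)"
  define v where "v = \<pi> - c0"
  have Kb: "K \<in> sets borel" using K by (rule borel_compact)
  have Csub: "?C \<subseteq> signed_measures_on K" by (auto simp: prob_measures_on_def)
  note sub = subspace_signed_measures_on[of K]
  have c0: "c0 \<in> ?C"
    unfolding c0_def using Kb p by (intro pmf_measure_prob_measures_on) auto
  have c0p: "smeas c0 X = 0" if "p \<notin> X" for X
    using that by (simp add: c0_def pmf_measure.rep_eq)
  have v: "v \<in> signed_measures_on K"
    unfolding v_def using \<pi> c0 Csub by (intro subspace_diff[OF sub]) auto
  have C_borel: "?C \<in> sets (borel_of ?T)"
    by (rule closedin_sets_borel_of[OF closedin_prob_measures_on[OF K]])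
  have "S n \<in> sets (borel_of ?T)" for n
    unfolding S_def using \<pi> Csub
    by (intro closedin_sets_borel_of closedin_smeas_ge K subspace_scale[OF sub]) auto
  then have B_borel: "B \<in> sets (borel_of ?T)"
    unfolding B_def using C_borel by auto
  have BA: "B \<subseteq> A"
  proof
    fix \<mu> assume "\<mu> \<in> B"
    then obtain n where n: "\<mu> \<in> ?C" "\<mu> \<in> S n" by (auto simp: B_def)
    show "\<mu> \<in> A"
      by (rule dom[OF n(1), of "inverse (Suc n)"]) (use n(2) in \<open>auto simp: S_def smeas_simps\<close>)
  qed
  define E where "E = ?C - B"
  have E_borel: "E \<in> sets (borel_of ?T)"
    unfolding E_def using C_borel B_borel by auto
  have seg: "continuous_map euclideanreal ?T (\<lambda>t. a + (t * e) *\<^sub>R v)"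
    if a: "a \<in> signed_measures_on K" for a e
  proof (rule continuous_map_into_weak_topology)
    show "(\<lambda>t. a + (t * e) *\<^sub>R v) \<in> topspace euclideanreal \<rightarrow> signed_measures_on K"
      using a v subspace_add[OF sub] subspace_scale[OF sub] by auto
    fix f :: "'a \<Rightarrow> real" assume f: "continuous_on K f"
    have "signed_integral (a + (t * e) *\<^sub>R v) K f = signed_integral a K f + t * e * signed_integral v K f" for t
      using signed_integral_lincomb[OF K f, of 1 a "t * e" v] by simp
    then show "continuous_map euclideanreal euclideanreal (\<lambda>t. signed_integral (a + (t * e) *\<^sub>R v) K f)"
      by (auto intro!: continuous_intros)
  qed
  have "shy_at ?T ?C c0 E"
    unfolding shy_at_def
  proof (intro conjI allI impI)
    fix \<eta> :: real and U :: "'a signed_measure set"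
    assume \<eta>: "0 < \<eta>" and U: "openin ?T U \<and> 0 \<in> U"
    have "open {t::real. (t * 1) *\<^sub>R v \<in> U}"
      using openin_continuous_map_preimage[OF seg[OF subspace_0[OF sub], of 1], of U] U by simp
    moreover have "0 \<in> {t::real. (t * 1) *\<^sub>R v \<in> U}" using U by simp
    ultimately obtain \<epsilon> where ball: "0 < \<epsilon>" "ball 0 \<epsilon> \<subseteq> {t::real. (t * 1) *\<^sub>R v \<in> U}"
      by (rule openE)
    have \<epsilon>: "0 < \<epsilon>" "\<And>t. \<bar>t\<bar> < \<epsilon> \<Longrightarrow> t *\<^sub>R v \<in> U"
      using ball(1) subsetD[OF ball(2)] by (simp_all add: dist_real_def)
    \<comment> \<open>The length of the segment: \<open>e \<le> \<eta>\<close> serves the condition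
      on \<open>\<eta>\<close>, and \<open>e < \<epsilon>\<close> the neighbourhood
      \<open>U\<close>.\<close>
    define e where "e = min \<eta> (\<epsilon> / 2)"
    have e: "0 < e" "e \<le> \<eta>" "e < \<epsilon>" using \<eta> \<epsilon>(1) by (auto simp: e_def)
    define g where "g t = c0 + (t * e) *\<^sub>R v" for t
    define M where "M = uniform_measure lborel {0..1::real}"
    define \<Lambda> where "\<Lambda> = distr M (borel_of ?T) g"
    have gcont: "continuous_map euclideanreal ?T g"
      unfolding g_def using c0 Csub by (intro seg) auto
    have setsM: "sets M = sets borel" and spM: "space M = UNIV" by (auto simp: M_def)
    interpret M: prob_space M
      unfolding M_def by (rule prob_space_uniform_measure) auto
    have gtop: "g t \<in> signed_measures_on K" for t
      using gcont by (auto simp: continuous_map_def)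
    have gm: "g \<in> measurable M (borel_of ?T)"
    proof (rule continuous_map_measurable_borel_of)
      show "g \<in> space M \<rightarrow> topspace ?T" using gtop by auto
      fix W assume "openin ?T W"
      from openin_continuous_map_preimage[OF gcont this]
      show "g -` W \<inter> space M \<in> sets M"
        by (simp add: setsM spM vimage_def)
    qed
    have emM: "emeasure M X = emeasure lborel ({0..1} \<inter> X)" if "X \<in> sets borel" for X
      using that unfolding M_def by (simp add: emeasure_uniform_measure divide_ennreal_def)
    have em\<Lambda>: "emeasure \<Lambda> X = emeasure lborel ({0..1} \<inter> g -` X)" if "X \<in> sets (borel_of ?T)" for X
      using emeasure_distr[OF gm that] emM measurable_sets[OF gm that] by (simp add: \<Lambda>_def spM setsM)
    have comp: "compactin ?T (g ` {0..1})"
      by (rule image_compactin[OF _ gcont]) simp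
    have supp: "msupport ?T \<Lambda> \<subseteq> g ` {0..1}"
    proof (rule ccontr)
      assume "\<not> msupport ?T \<Lambda> \<subseteq> g ` {0..1}"
      then obtain y where y: "y \<in> msupport ?T \<Lambda>" "y \<notin> g ` {0..1}" by auto
      let ?W = "topspace ?T - g ` {0..1}"
      have W: "openin ?T ?W"
        using compactin_imp_closedin[OF Hausdorff_space_weak_topology[OF K] comp] by blast
      have "emeasure \<Lambda> ?W = emeasure lborel ({0..1} \<inter> g -` ?W)"
        by (rule em\<Lambda>[OF openin_sets_borel_of[OF W]])
      also have "{0..1} \<inter> g -` ?W = {}" by auto
      finally show False
        using y W unfolding msupport_def by auto
    qed
    show "\<exists>\<Lambda>. prob_space \<Lambda> \<and> space \<Lambda> = topspace ?T \<and> sets \<Lambda> = sets (borel_of ?T) \<and>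
        compactin ?T (msupport ?T \<Lambda>) \<and> msupport ?T \<Lambda> \<subseteq> (\<lambda>u. u + c0) ` U \<and>
        msupport ?T \<Lambda> \<subseteq> (\<lambda>y. \<eta> *\<^sub>R y + (1 - \<eta>) *\<^sub>R c0) ` ?C \<and>
        (\<forall>x\<in>topspace ?T. (\<lambda>y. x + y) ` E \<in> null_sets \<Lambda>)"
    proof (intro exI[of _ \<Lambda>] conjI ballI)
      show "prob_space \<Lambda>" unfolding \<Lambda>_def by (rule M.prob_space_distr[OF gm])
      show "space \<Lambda> = topspace ?T" "sets \<Lambda> = sets (borel_of ?T)" by (auto simp: \<Lambda>_def)
      show "compactin ?T (msupport ?T \<Lambda>)"
        by (rule closed_compactin[OF comp supp closedin_msupport])
      have "g t \<in> (\<lambda>u. u + c0) ` U" if t: "t \<in> {0..1}" for t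
      proof -
        have "0 \<le> t * e" "t * e \<le> 1 * e"
          using t e by (auto intro: mult_right_mono simp del: mult_1_left)
        then have "\<bar>t * e\<bar> < \<epsilon>" using e by linarith
        then have "(t * e) *\<^sub>R v \<in> U" by (rule \<epsilon>(2))
        then show ?thesis by (auto simp: g_def add.commute)
      qed
      then show "msupport ?T \<Lambda> \<subseteq> (\<lambda>u. u + c0) ` U" using supp by auto
      have "g t \<in> (\<lambda>y. \<eta> *\<^sub>R y + (1 - \<eta>) *\<^sub>R c0) ` ?C" if t: "t \<in> {0..1}" for t
      proof (rule image_eqI)
        \<comment> \<open>The point \<open>g t\<close> moves the fraction \<open>t * e\<close> of
          the way from \<open>c0\<close> to \<open>\<pi>\<close>; after contraction by
          \<open>\<eta>\<close> towards \<open>c0\<close> the fraction \<open>t * e / \<eta>\<close>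
          is needed.\<close>
        let ?s = "t * e / \<eta>"
        have "?s \<le> 1" using t e \<eta> mult_mono[of t 1 e \<eta>] by (simp add: field_simps)
        moreover have "0 \<le> ?s" using t e \<eta> by simp
        ultimately show "(1 - ?s) *\<^sub>R c0 + ?s *\<^sub>R \<pi> \<in> ?C"
          using c0 \<pi> by (intro prob_measures_on_convex) auto
        show "g t = \<eta> *\<^sub>R ((1 - ?s) *\<^sub>R c0 + ?s *\<^sub>R \<pi>) + (1 - \<eta>) *\<^sub>R c0"
          using \<eta> by (intro smeas_eqI) (simp add: g_def v_def smeas_simps field_simps)
      qed
      then show "msupport ?T \<Lambda> \<subseteq> (\<lambda>y. \<eta> *\<^sub>R y + (1 - \<eta>) *\<^sub>R c0) ` ?C" using supp by auto
      fix x assume "x \<in> topspace ?T"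
      then have xE: "(\<lambda>y. x + y) ` E \<in> sets (borel_of ?T)"
        by (intro translate_sets_borel_of_weak_topology K E_borel) auto
      let ?Z = "g -` ((\<lambda>y. x + y) ` E)"
      \<comment> \<open>Of two parameters hitting the translate, the larger one belongs to the
        measure that has gained \<open>(t - s) * e\<close> times \<open>\<pi>\<close> off
        \<open>p\<close>; this measure lies in some \<open>S n\<close> and so outside
        \<open>E\<close>.\<close>
      have no: False if st: "s \<in> ?Z" "t \<in> ?Z" "s < t" for s t
      proof -
        obtain \<mu> \<nu> where \<mu>: "\<mu> \<in> E" "g s = x + \<mu>" and \<nu>: "\<nu> \<in> E" "g t = x + \<nu>" using st by auto
        have "\<nu> = \<mu> + ((t - s) * e) *\<^sub>R v"
        proof -
          have "\<nu> - \<mu> = g t - g s" using \<mu> \<nu> by simp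
          also have "\<dots> = ((t - s) * e) *\<^sub>R v" by (simp add: g_def algebra_simps)
          finally show ?thesis by (simp add: algebra_simps)
        qed
        moreover have "0 < (t - s) * e" using st e by simp
        then obtain n where n: "inverse (real (Suc n)) < (t - s) * e"
          using reals_Archimedean by blast
        ultimately have "smeas (inverse (Suc n) *\<^sub>R \<pi>) X \<le> smeas \<nu> X" if X: "X \<in> sets borel" "p \<notin> X" for X
        proof -
          have "0 \<le> smeas \<mu> X" "0 \<le> smeas \<pi> X"
            using \<mu>(1) \<pi> by (auto simp: E_def prob_measures_on_def)
          then have "inverse (Suc n) * smeas \<pi> X \<le> smeas \<mu> X + (t - s) * e * smeas \<pi> X"
            using mult_right_mono[OF less_imp_le[OF n] \<open>0 \<le> smeas \<pi> X\<close>] by simp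
          then show ?thesis
            using \<open>\<nu> = \<mu> + ((t - s) * e) *\<^sub>R v\<close> c0p[OF X(2)] by (simp add: smeas_simps v_def)
        qed
        then have "\<nu> \<in> S n" using \<nu>(1) Csub by (auto simp: S_def E_def)
        then show False using \<nu>(1) by (auto simp: E_def B_def)
      qed
      have "finite ({0..1} \<inter> ?Z)"
      proof (cases "{0..1} \<inter> ?Z = {}")
        case False
        then obtain z where z: "z \<in> ?Z" by blast
        have "y = z" if "y \<in> ?Z" for y
          using no[OF that z] no[OF z that] by (meson linorder_less_linear)
        then have "{0..1} \<inter> ?Z \<subseteq> {z}" by blast
        then show ?thesis by (rule finite_subset) simp
      qed simp
      then have "emeasure lborel ({0..1} \<inter> ?Z) = 0"
        by (intro emeasure_lborel_countable countable_finite)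
      then show "(\<lambda>y. x + y) ` E \<in> null_sets \<Lambda>"
        using em\<Lambda>[OF xE] xE by (intro null_setsI) (auto simp: \<Lambda>_def)
    qed
  qed (use E_borel c0 in \<open>auto simp: E_def\<close>)
  then have "prevalent_Borel ?T ?C B"
    unfolding prevalent_Borel_def E_def using B_borel c0 by (auto simp: B_def)
  then show ?thesis
    using A BA by (auto simp: prevalent_def)
qed

section \<open>Iterated function systems\<close>

text \<open>Surjectivity is the point: after rescaling and translating the value at 0 to 0, the map
  is an isometry fixing the origin, hence an orthogonal transformation.\<close>

lemma similarity_image_ball:
  fixes f :: "'a::euclidean_space \<Rightarrow> 'a"
  assumes r: "0 < r" and f: "\<And>x y. dist (f x) (f y) = r * dist x y"
  shows "f ` ball x c = ball (f x) (r * c)"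
proof -
  define h where "h x = (1 / r) *\<^sub>R (f x - f 0)" for x
  have "dist (h x) (h y) = dist x y" for x y
  proof -
    have "h x - h y = (1 / r) *\<^sub>R (f x - f y)"
      by (simp add: h_def algebra_simps)
    then show ?thesis
      using r f[of x y] by (simp add: dist_norm)
  qed
  then have "orthogonal_transformation h"
    unfolding orthogonal_transformation_isometry by (simp add: h_def)
  then have surj: "surj h" by (rule orthogonal_transformation_surj)
  have "\<exists>x. f x = y" for y
  proof -
    obtain x where "h x = (1 / r) *\<^sub>R (y - f 0)" using surj by (metis surjD)
    then show ?thesis using r by (intro exI[of _ x]) (simp add: h_def)
  qed
  then have "y \<in> f ` ball x c" if "y \<in> ball (f x) (r * c)" for y
    using that r f by (metis image_eqI mem_ball mult_less_cancel_left_pos)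
  moreover have "f y \<in> ball (f x) (r * c)" if "y \<in> ball x c" for y
    using that r f by simp
  ultimately show ?thesis by blast
qed

text \<open>Comparison of Lebesgue measures; the volume of the unit ball cancels.\<close>

lemma card_disjoint_balls_le:
  fixes p :: "'b \<Rightarrow> 'a::euclidean_space"
  assumes A: "finite A" and a: "0 \<le> a" and b: "0 \<le> b"
    and sub: "\<And>i. i \<in> A \<Longrightarrow> ball (p i) a \<subseteq> ball y b"
    and disj: "\<And>i j. i \<in> A \<Longrightarrow> j \<in> A \<Longrightarrow> i \<noteq> j \<Longrightarrow> ball (p i) a \<inter> ball (p j) a = {}"
  shows "real (card A) * a ^ DIM('a) \<le> b ^ DIM('a)"
proof -
  let ?u = "measure lborel (ball (0::'a) 1)"
  have u: "0 < ?u" by (rule content_ball_pos) simp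
  have fin: "emeasure lborel (ball x c) < \<infinity>" for x :: 'a and c
    by (rule emeasure_lborel_ball_finite)
  have "(\<Sum>i\<in>A. measure lborel (ball (p i) a)) = measure lborel (\<Union>i\<in>A. ball (p i) a)"
    using A disj fin
    by (intro measure_finite_Union[symmetric]) (auto simp: disjoint_family_on_def top.not_eq_extremum)
  also have "\<dots> \<le> measure lborel (ball y b)"
    using sub fin[of y b] A by (intro measure_mono_fmeasurable) (auto simp: fmeasurable_def)
  finally have "(real (card A) * a ^ DIM('a)) * ?u \<le> b ^ DIM('a) * ?u"
    using a b by (simp add: content_ball_conv_unit_ball[of a] content_ball_conv_unit_ball[of b] mult.assoc)
  then show ?thesis using u by simp
qed

text \<open>The maps are only required to send \<open>K\<close> into itself: the subsystems to which
  the locale is applied again keep \<open>K\<close> and \<open>V\<close>, but their images of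
  \<open>K\<close> need not cover it.\<close>

locale osc_ifs =
  fixes N :: nat and g :: "nat \<Rightarrow> 'a::euclidean_space \<Rightarrow> 'a" and r :: "nat \<Rightarrow> real" and K V :: "'a set"
  assumes ratio_pos: "i < N \<Longrightarrow> 0 < r i" and ratio_less: "i < N \<Longrightarrow> r i < 1"
    and sim: "i < N \<Longrightarrow> dist (g i x) (g i y) = r i * dist x y"
    and compact_K: "compact K" and nonempty_K: "K \<noteq> {}" and g_K: "i < N \<Longrightarrow> g i ` K \<subseteq> K"
    and open_V: "open V" and nonempty_V: "V \<noteq> {}" and g_V: "i < N \<Longrightarrow> g i ` V \<subseteq> V"
    and disj_V: "i < N \<Longrightarrow> j < N \<Longrightarrow> i \<noteq> j \<Longrightarrow> g i ` V \<inter> g j ` V = {}"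
begin

section \<open>Words, their maps and their ratios\<close>

definition wmap :: "nat list \<Rightarrow> 'a \<Rightarrow> 'a" where
  "wmap w = foldr (\<lambda>i f. g i \<circ> f) w id"

definition wratio :: "nat list \<Rightarrow> real" where
  "wratio w = prod_list (map r w)"

definition wset :: "nat \<Rightarrow> nat list set" where
  "wset n = {w. length w = n \<and> set w \<subseteq> {..<N}}"

lemma wmap_simps [simp]: "wmap [] = id" "wmap (i # w) = g i \<circ> wmap w"
  by (simp_all add: wmap_def)

lemma wratio_simps [simp]: "wratio [] = 1" "wratio (i # w) = r i * wratio w"
  by (simp_all add: wratio_def)

lemma wmap_append: "wmap (u @ w) = wmap u \<circ> wmap w"
  by (induction u) (auto simp: comp_assoc)

lemma wratio_pos: "set w \<subseteq> {..<N} \<Longrightarrow> 0 < wratio w"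
  by (induction w) (auto simp: ratio_pos)

lemma wmap_sim: "set w \<subseteq> {..<N} \<Longrightarrow> dist (wmap w x) (wmap w y) = wratio w * dist x y"
  by (induction w) (auto simp: sim)

lemma wmap_K: "set w \<subseteq> {..<N} \<Longrightarrow> wmap w ` K \<subseteq> K"
proof (induction w)
  case (Cons i w)
  then have "g i ` wmap w ` K \<subseteq> g i ` K" by (intro image_mono) auto
  then show ?case using Cons g_K[of i] by (auto simp: image_comp)
qed simp

lemma wmap_V: "set w \<subseteq> {..<N} \<Longrightarrow> wmap w ` V \<subseteq> V"
proof (induction w)
  case (Cons i w)
  then have "g i ` wmap w ` V \<subseteq> g i ` V" by (intro image_mono) auto
  then show ?case using Cons g_V[of i] by (auto simp: image_comp)
qed simp

lemma compact_wmap_K: "set w \<subseteq> {..<N} \<Longrightarrow> compact (wmap w ` K)"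
proof (rule compact_continuous_image[OF _ compact_K])
  assume w: "set w \<subseteq> {..<N}"
  have "(wratio w)-lipschitz_on K (wmap w)"
    using wratio_pos[OF w] by (intro lipschitz_onI) (auto simp: wmap_sim[OF w])
  then show "continuous_on K (wmap w)" by (rule lipschitz_on_continuous_on)
qed

text \<open>A common first letter is removed by injectivity, and at the first difference
  \<open>disj_V\<close> applies. Equal lengths exclude that one word is a prefix of the
  other.\<close>

lemma wmap_V_disjoint:
  "length w = length u \<Longrightarrow> set w \<subseteq> {..<N} \<Longrightarrow> set u \<subseteq> {..<N} \<Longrightarrow> w \<noteq> u \<Longrightarrow>
    wmap w ` V \<inter> wmap u ` V = {}"
proof (induction w u rule: list_induct2)
  case (Cons i w j u)
  have sub: "wmap (i # w) ` V \<subseteq> g i ` V" "wmap (j # u) ` V \<subseteq> g j ` V"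
    using Cons wmap_V[of w] wmap_V[of u] by (auto simp flip: image_comp)
  show ?case
  proof (cases "i = j")
    case True
    have "inj (g i)"
    proof (rule injI)
      fix x y assume "g i x = g i y"
      then show "x = y" using sim[of i x y] ratio_pos[of i] Cons by simp
    qed
    then have "g i ` (wmap w ` V) \<inter> g i ` (wmap u ` V) = g i ` (wmap w ` V \<inter> wmap u ` V)"
      by (rule image_Int[symmetric])
    also have "wmap w ` V \<inter> wmap u ` V = {}" using Cons True by auto
    finally show ?thesis using True by (simp add: image_comp)
  next
    case False
    then have "g i ` V \<inter> g j ` V = {}" using disj_V[of i j] Cons.prems by auto
    then show ?thesis using sub by blast
  qed
qed simp

lemma wset_0 [simp]: "wset 0 = {[]}"
  by (auto simp: wset_def)

lemma wset_Suc: "wset (Suc n) = (\<lambda>(i, w). i # w) ` ({..<N} \<times> wset n)"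
  by (force simp: wset_def length_Suc_conv)

lemma finite_wset: "finite (wset n)"
  by (induction n) (auto simp: wset_Suc)

lemma sum_wratio_powr: "(\<Sum>w\<in>wset n. wratio w powr t) = (\<Sum>i<N. r i powr t) ^ n"
proof (induction n)
  case (Suc n)
  have "(\<Sum>w\<in>wset (Suc n). wratio w powr t) = (\<Sum>(i, w)\<in>{..<N} \<times> wset n. (r i * wratio w) powr t)"
    unfolding wset_Suc by (subst sum.reindex) (auto simp: inj_on_def case_prod_unfold)
  also have "\<dots> = (\<Sum>(i, w)\<in>{..<N} \<times> wset n. r i powr t * wratio w powr t)"
    using ratio_pos wratio_pos
    by (intro sum.cong) (auto simp: wset_def powr_mult less_imp_le)
  also have "\<dots> = (\<Sum>i<N. r i powr t) * (\<Sum>w\<in>wset n. wratio w powr t)"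
    by (simp add: sum_product sum.cartesian_product)
  finally show ?case using Suc by simp
qed simp

lemma wratio_le:
  assumes R: "\<And>i. i < N \<Longrightarrow> r i \<le> R"
  shows "set w \<subseteq> {..<N} \<Longrightarrow> wratio w \<le> R ^ length w"
proof (induction w)
  case (Cons i w)
  have "r i * wratio w \<le> R * R ^ length w"
    using Cons R[of i] ratio_pos[of i] wratio_pos[of w] by (intro mult_mono) auto
  then show ?case by simp
qed simp

section \<open>Subsystems with equal ratios\<close>

lemma wratio_eq_prod: "set w \<subseteq> {..<N} \<Longrightarrow> wratio w = (\<Prod>i<N. r i ^ count_list w i)"
proof (induction w)
  case (Cons j w)
  have "(\<Prod>i<N. r i ^ count_list (j # w) i) = (\<Prod>i<N. (if i = j then r i else 1) * r i ^ count_list w i)"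
    by (intro prod.cong) auto
  also have "\<dots> = (\<Prod>i<N. if i = j then r i else 1) * (\<Prod>i<N. r i ^ count_list w i)"
    by (rule prod.distrib)
  also have "(\<Prod>i<N. if i = j then r i else 1) = r j"
    using Cons by (simp add: prod.delta)
  finally show ?case using Cons by simp
qed simp

text \<open>A ratio depends only on how often each letter occurs, so among exponentially many words
  only polynomially many ratios appear.\<close>

lemma card_wratio_image: "card (wratio ` wset n) \<le> (n + 1) ^ N"
proof -
  let ?P = "PiE {..<N} (\<lambda>_. {..n})"
  have fin: "finite ?P" by (intro finite_PiE) auto
  have "wratio ` wset n \<subseteq> (\<lambda>c. \<Prod>i<N. r i ^ c i) ` ?P"
  proof
    fix x assume "x \<in> wratio ` wset n"
    then obtain w where w: "length w = n" "set w \<subseteq> {..<N}" "x = wratio w" by (auto simp: wset_def)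
    have "x = (\<Prod>i<N. r i ^ restrict (count_list w) {..<N} i)"
      using w by (simp add: wratio_eq_prod)
    moreover have "restrict (count_list w) {..<N} \<in> ?P"
      using w count_le_length[of w] by auto
    ultimately show "x \<in> (\<lambda>c. \<Prod>i<N. r i ^ c i) ` ?P" by blast
  qed
  then have "card (wratio ` wset n) \<le> card ?P"
    using fin by (meson card_image_le card_mono finite_imageI order.trans)
  also have "\<dots> = (n + 1) ^ N" by (simp add: card_PiE)
  finally show ?thesis .
qed

text \<open>The weights \<open>wratio w powr t\<close> of the words of length \<open>n\<close> add
  up to at least 1 and fall into at most \<open>(n + 1) ^ N\<close> ratio classes, so one class has
  weight at least \<open>1 / (n + 1) ^ N\<close>. Lowering the exponent from \<open>t\<close> to
  \<open>s\<close> gains a factor exponential in \<open>n\<close>, which outweighs this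
  loss.\<close>

lemma words_of_equal_ratio:
  assumes p: "1 \<le> (\<Sum>i<N. r i powr t)" and t: "0 \<le> s" "s < t"
  obtains n \<rho> where "0 < \<rho>" "\<rho> < 1" "1 \<le> real (card {w \<in> wset n. wratio w = \<rho>}) * \<rho> powr s"
proof -
  have N: "{..<N} \<noteq> {}" using p by (intro notI) simp
  define R where "R = Max (r ` {..<N})"
  have R: "r i \<le> R" if "i < N" for i using that by (auto simp: R_def)
  have "R \<in> r ` {..<N}" unfolding R_def using N by (intro Max_in) auto
  then have R01: "0 < R" "R < 1" using ratio_pos ratio_less by auto
  \<comment> \<open>Chosen so that \<open>(q ^ n) ^ N\<close> equals
    \<open>(R ^ n) powr (t - s)\<close>; the comparison of the polynomial with the exponential
    becomes \<open>(n + 1) * q ^ n < 1\<close>.\<close>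
  define q where "q = R powr ((t - s) / N)"
  have N0: "0 < real N" using N by auto
  have q: "0 < q" "q < 1" using R01 t N0 powr_less_mono'[of R 0 "(t - s) / N"] by (auto simp: q_def)
  have "(\<lambda>n. real n * q ^ n) \<longlonglongrightarrow> 0" using q by (intro powser_times_n_limit_0) auto
  moreover have "(\<lambda>n. q ^ n) \<longlonglongrightarrow> 0" using q by (intro LIMSEQ_realpow_zero) auto
  ultimately have "(\<lambda>n. real n * q ^ n + q ^ n) \<longlonglongrightarrow> 0 + 0" by (rule tendsto_add)
  then have "\<forall>\<^sub>F n in sequentially. real n * q ^ n + q ^ n < 1"
    by (rule order_tendstoD) simp
  then obtain n where n: "1 \<le> n" "real n * q ^ n + q ^ n < 1"
    using eventually_happens'[OF sequentially_bot, OF eventually_conj[OF eventually_ge_at_top[of 1]]] by blast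
  have small: "real ((n + 1) ^ N) * (R ^ n) powr (t - s) \<le> 1"
  proof -
    have "(real (n + 1) * q ^ n) ^ N \<le> 1"
      using n q by (intro power_le_one) (auto simp: algebra_simps)
    moreover have "(q ^ n) ^ N = (R ^ n) powr (t - s)"
    proof -
      have "(q ^ n) ^ N = q powr (real n * real N)"
        using q by (simp add: powr_realpow flip: power_mult of_nat_mult)
      also have "\<dots> = R powr (real n * (t - s))"
        using N0 by (simp add: q_def powr_powr mult.commute)
      also have "\<dots> = (R ^ n) powr (t - s)"
        using R01 by (simp add: powr_powr flip: powr_realpow)
      finally show ?thesis .
    qed
    ultimately show ?thesis by (simp add: power_mult_distrib)
  qed
  let ?W = "\<lambda>\<rho>. {w \<in> wset n. wratio w = \<rho>}"
  have "\<exists>\<rho>\<in>wratio ` wset n. 1 \<le> real ((n + 1) ^ N) * (real (card (?W \<rho>)) * \<rho> powr t)"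
  proof (rule ccontr)
    assume "\<not> ?thesis"
    then have lt: "real ((n + 1) ^ N) * (real (card (?W \<rho>)) * \<rho> powr t) < 1" if "\<rho> \<in> wratio ` wset n" for \<rho>
      using that by (auto simp: not_le)
    have ne: "wratio ` wset n \<noteq> {}"
    proof -
      obtain i where "i < N" using N by auto
      then have "replicate n i \<in> wset n" by (auto simp: wset_def)
      then show ?thesis by auto
    qed
    have "1 \<le> (\<Sum>w\<in>wset n. wratio w powr t)"
      unfolding sum_wratio_powr using p by (rule one_le_power)
    also have "\<dots> = (\<Sum>\<rho>\<in>wratio ` wset n. \<Sum>w\<in>?W \<rho>. wratio w powr t)"
      by (rule sum.image_gen[OF finite_wset])
    also have "\<dots> = (\<Sum>\<rho>\<in>wratio ` wset n. real (card (?W \<rho>)) * \<rho> powr t)"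
      by (intro sum.cong) auto
    finally have 1: "1 \<le> (\<Sum>\<rho>\<in>wratio ` wset n. real (card (?W \<rho>)) * \<rho> powr t)" .
    then have "real ((n + 1) ^ N) \<le> real ((n + 1) ^ N) * (\<Sum>\<rho>\<in>wratio ` wset n. real (card (?W \<rho>)) * \<rho> powr t)"
      by (simp add: mult_le_cancel_left1)
    also have "\<dots> = (\<Sum>\<rho>\<in>wratio ` wset n. real ((n + 1) ^ N) * (real (card (?W \<rho>)) * \<rho> powr t))"
      by (rule sum_distrib_left)
    also have "\<dots> < (\<Sum>\<rho>\<in>wratio ` wset n. 1)"
      using lt ne finite_wset by (intro sum_strict_mono) auto
    also have "\<dots> = real (card (wratio ` wset n))" by simp
    also have "\<dots> \<le> real ((n + 1) ^ N)"
      using card_wratio_image[of n] by (simp only: of_nat_le_iff)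
    finally show False by simp
  qed
  then obtain w where w: "w \<in> wset n" "1 \<le> real ((n + 1) ^ N) * (real (card (?W (wratio w))) * wratio w powr t)"
    by auto
  let ?\<rho> = "wratio w"
  have \<rho>: "0 < ?\<rho>" "?\<rho> \<le> R ^ n" using w wratio_pos wratio_le[OF R] by (auto simp: wset_def)
  have "?\<rho> < 1"
  proof -
    have "R ^ n < 1" using R01 n by (simp add: power_less_one_iff)
    then show ?thesis using \<rho> by simp
  qed
  moreover have "1 \<le> real (card (?W ?\<rho>)) * ?\<rho> powr s"
  proof -
    have "?\<rho> powr t = ?\<rho> powr s * ?\<rho> powr (t - s)" by (simp flip: powr_add)
    also have "\<dots> \<le> ?\<rho> powr s * (R ^ n) powr (t - s)"
      using \<rho> t by (intro mult_left_mono powr_mono2) auto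
    finally have "real ((n + 1) ^ N) * (real (card (?W ?\<rho>)) * ?\<rho> powr t)
        \<le> real ((n + 1) ^ N) * (real (card (?W ?\<rho>)) * (?\<rho> powr s * (R ^ n) powr (t - s)))"
      by (intro mult_left_mono) auto
    also have "\<dots> = (real ((n + 1) ^ N) * (R ^ n) powr (t - s)) * (real (card (?W ?\<rho>)) * ?\<rho> powr s)"
      by (simp only: mult_ac)
    also have "\<dots> \<le> 1 * (real (card (?W ?\<rho>)) * ?\<rho> powr s)"
      by (intro mult_right_mono small) auto
    finally show ?thesis using w(2) by simp
  qed
  ultimately show ?thesis using that[of ?\<rho> n] \<rho> by blast
qed

lemma diameter_wmap_K:
  assumes w: "set w \<subseteq> {..<N}"
  shows "diameter (wmap w ` K) \<le> wratio w * diameter K"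
proof (rule diameter_le)
  show "wmap w ` K \<noteq> {} \<or> 0 \<le> wratio w * diameter K" using nonempty_K by simp
  fix x y assume "x \<in> wmap w ` K" "y \<in> wmap w ` K"
  then obtain a b where ab: "a \<in> K" "b \<in> K" "x = wmap w a" "y = wmap w b" by auto
  have "dist a b \<le> diameter K"
    by (rule diameter_bounded_bound[OF compact_imp_bounded[OF compact_K] ab(1,2)])
  then show "norm (x - y) \<le> wratio w * diameter K"
    using wmap_sim[OF w, of a b] wratio_pos[OF w] ab(3,4) by (simp flip: dist_norm)
qed

text \<open>If the sum \<open>p\<close> were below 1, the covers of \<open>K\<close> by its images
  under words of length \<open>n\<close> would cost at most a constant times \<open>p ^ n\<close>,
  which tends to 0.\<close>

lemma sum_ratio_powr_ge_1:
  assumes K: "K = (\<Union>i<N. g i ` K)" and t: "0 < t" and H: "hausdorff_measure t K \<noteq> 0"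
  shows "1 \<le> (\<Sum>i<N. r i powr t)"
proof (rule ccontr)
  define p where "p = (\<Sum>i<N. r i powr t)"
  assume "\<not> 1 \<le> (\<Sum>i<N. r i powr t)"
  then have p: "0 \<le> p" "p < 1" by (auto simp: p_def sum_nonneg)
  have N: "{..<N} \<noteq> {}" using K nonempty_K by auto
  define R where "R = Max (r ` {..<N})"
  have R: "r i \<le> R" if "i < N" for i using that by (auto simp: R_def)
  have "R \<in> r ` {..<N}" unfolding R_def using N by (intro Max_in) auto
  then have R01: "0 < R" "R < 1" using ratio_pos ratio_less by auto
  have cov: "K \<subseteq> (\<Union>w\<in>wset n. wmap w ` K)" for n
  proof (induction n)
    case (Suc n)
    have "K \<subseteq> (\<Union>i<N. g i ` K)" using K by simp
    also have "\<dots> \<subseteq> (\<Union>i<N. g i ` (\<Union>w\<in>wset n. wmap w ` K))"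
      using Suc by (intro UN_mono image_mono) auto
    also have "\<dots> \<subseteq> (\<Union>w\<in>wset (Suc n). wmap w ` K)"
      by (fastforce simp: wset_Suc)
    finally show ?case .
  qed simp
  \<comment> \<open>The added 1 keeps \<open>d\<close> positive when \<open>K\<close> is a single
    point.\<close>
  define d where "d = diameter K + 1"
  have dK: "0 \<le> diameter K" by (rule diameter_ge_0[OF compact_imp_bounded[OF compact_K]])
  have d: "0 < d" using dK by (simp add: d_def)
  have "hausdorff_premeasure t \<delta> K \<le> 0" if \<delta>: "0 < \<delta>" for \<delta>
  proof (rule tendsto_lowerbound)
    have "(\<lambda>n. p ^ n * d powr t) \<longlonglongrightarrow> 0 * d powr t"
      using p by (intro tendsto_mult LIMSEQ_realpow_zero tendsto_const) auto
    then show "(\<lambda>n. ennreal (p ^ n * d powr t)) \<longlonglongrightarrow> 0"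
      by (auto dest: tendsto_ennrealI)
    have "(\<lambda>n. R ^ n * d) \<longlonglongrightarrow> 0 * d"
      using R01 by (intro tendsto_mult LIMSEQ_realpow_zero tendsto_const) auto
    then have "\<forall>\<^sub>F n in sequentially. R ^ n * d < \<delta>"
      using \<delta> by (intro order_tendstoD) auto
    then show "\<forall>\<^sub>F n in sequentially. hausdorff_premeasure t \<delta> K \<le> ennreal (p ^ n * d powr t)"
    proof eventually_elim
      case (elim n)
      have W: "wratio w * d \<le> \<delta>" "diameter (wmap w ` K) \<le> wratio w * d" "0 < wratio w" if "w \<in> wset n" for w
      proof -
        have w: "set w \<subseteq> {..<N}" "length w = n" using that by (auto simp: wset_def)
        show pos: "0 < wratio w" by (rule wratio_pos[OF w(1)])
        have "wratio w * d \<le> R ^ n * d" using wratio_le[OF R w(1)] w(2) d by simp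
        then show "wratio w * d \<le> \<delta>" using elim by simp
        have "wratio w * diameter K \<le> wratio w * d"
          using pos by (simp add: d_def)
        then show "diameter (wmap w ` K) \<le> wratio w * d"
          using diameter_wmap_K[OF w(1)] by simp
      qed
      show ?case
      proof (rule hausdorff_premeasure_le_finite_sums[OF countable_finite[OF finite_wset] cov[of n]])
        show "bounded (wmap w ` K) \<and> diameter (wmap w ` K) \<le> \<delta>" if "w \<in> wset n" for w
          using W[OF that] that compact_imp_bounded[OF compact_wmap_K[of w]] by (auto simp: wset_def)
        fix J assume J: "finite J" "J \<subseteq> wset n"
        have "(\<Sum>w\<in>J. diam_powr t (wmap w ` K)) \<le> (\<Sum>w\<in>J. ennreal (wratio w powr t * d powr t))"
        proof (rule sum_mono)
          fix w assume "w \<in> J"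
          then have w: "w \<in> wset n" using J by auto
          have "diam_powr t (wmap w ` K) \<le> ennreal ((wratio w * d) powr t)"
            using W[OF w] w t d compact_imp_bounded[OF compact_wmap_K[of w]]
            by (intro diam_powr_le) (auto simp: wset_def)
          then show "diam_powr t (wmap w ` K) \<le> ennreal (wratio w powr t * d powr t)"
            using W[OF w] d by (simp add: powr_mult)
        qed
        also have "\<dots> \<le> (\<Sum>w\<in>wset n. ennreal (wratio w powr t * d powr t))"
          using J finite_wset by (intro sum_mono2) auto
        also have "\<dots> = ennreal (p ^ n * d powr t)"
          by (simp add: sum_ennreal p_def flip: sum_wratio_powr sum_distrib_right)
        finally show "(\<Sum>w\<in>J. diam_powr t (wmap w ` K)) \<le> ennreal (p ^ n * d powr t)" .
      qed (use \<delta> in simp)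
    qed
  qed simp
  then have "hausdorff_measure t K = 0" by (simp add: hausdorff_measure_def)
  then show False using H by simp
qed

text \<open>An exponent \<open>t\<close> strictly between \<open>s\<close> and the dimension leaves
  room for the loss in \<open>words_of_equal_ratio\<close>. The words of the selected class serve as
  new maps; as they have equal length, their images of \<open>V\<close> are disjoint.\<close>

lemma homogeneous_subsystem:
  assumes K: "K = (\<Union>i<N. g i ` K)" and s: "0 < s" "ereal s < hausdorff_dim K"
  shows "\<exists>N' g' \<rho> s'. osc_ifs N' g' (\<lambda>_. \<rho>) K V \<and> s \<le> s' \<and> 0 < \<rho> \<and> \<rho> < 1 \<and>
    real N' = \<rho> powr (- s')"
proof -
  obtain t where t: "s < t" "ereal t < hausdorff_dim K"
    using ereal_dense2[OF s(2)] by auto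
  have "hausdorff_measure t K \<noteq> 0"
    using s t by (intro hausdorff_measure_nonzero_below_dim) auto
  then have "1 \<le> (\<Sum>i<N. r i powr t)"
    using s t by (intro sum_ratio_powr_ge_1 K) auto
  then obtain n \<rho> where \<rho>: "0 < \<rho>" "\<rho> < 1" "1 \<le> real (card {w \<in> wset n. wratio w = \<rho>}) * \<rho> powr s"
    using words_of_equal_ratio[of t s] s t by (metis less_imp_le)
  define W where "W = {w \<in> wset n. wratio w = \<rho>}"
  have finW: "finite W" using finite_wset by (auto simp: W_def)
  define N' where "N' = card W"
  obtain e where e: "bij_betw e {..<N'} W"
    using ex_bij_betw_nat_finite[OF finW] by (auto simp: N'_def atLeast0LessThan)
  have eW: "e k \<in> W" if "k < N'" for k using bij_betwE[OF e] that by auto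
  have eW': "set (e k) \<subseteq> {..<N}" "length (e k) = n" "wratio (e k) = \<rho>" if "k < N'" for k
    using eW[OF that] by (auto simp: W_def wset_def)
  have "osc_ifs N' (\<lambda>k. wmap (e k)) (\<lambda>_. \<rho>) K V"
  proof
    show "dist (wmap (e i) x) (wmap (e i) y) = \<rho> * dist x y" if "i < N'" for i x y
      using wmap_sim[OF eW'(1)[OF that]] eW'(3)[OF that] by simp
    show "wmap (e i) ` V \<inter> wmap (e j) ` V = {}" if "i < N'" "j < N'" "i \<noteq> j" for i j
    proof (rule wmap_V_disjoint)
      show "e i \<noteq> e j" using e that by (auto simp: bij_betw_def inj_on_def)
    qed (use eW' that in auto)
  qed (use \<rho> compact_K nonempty_K open_V nonempty_V eW' wmap_K wmap_V in auto)
  \<comment> \<open>The similarity dimension of the new system, that is, the solution of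
    \<open>real N' * \<rho> powr s' = 1\<close>.\<close>
  moreover define s' where "s' = - ln (real N') / ln \<rho>"
  have N': "0 < real N'" using \<rho> by (cases "N' = 0") (auto simp: N'_def W_def)
  have ln: "ln \<rho> < 0" using \<rho> by simp
  have eq: "real N' = \<rho> powr (- s')"
    using \<rho> N' ln by (simp add: s'_def powr_def)
  moreover have "s \<le> s'"
  proof -
    have "1 \<le> \<rho> powr (- s') * \<rho> powr s" using \<rho>(3) eq by (simp add: N'_def W_def)
    then have "1 \<le> \<rho> powr (s - s')" by (simp flip: powr_add)
    then show ?thesis using \<rho> powr_less_one[of \<rho> "s - s'"] powr_less_mono'[of \<rho> 0 "s - s'"] by (cases "s \<le> s'") auto
  qed
  ultimately show ?thesis using \<rho> by blast
qed

end

section \<open>Subsets with prescribed free positions\<close>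

primrec tree :: "nat \<Rightarrow> nat set \<Rightarrow> nat \<Rightarrow> nat list set" where
  "tree N D 0 = {[]}"
| "tree N D (Suc n) = (\<lambda>(w, i). w @ [i]) ` (tree N D n \<times> (if n \<in> D then {..<N} else {0}))"

lemma finite_tree: "finite (tree N D n)"
  by (induction n) auto

lemma card_Int_lessThan_Suc:
  "card (D \<inter> {..<Suc n}) = card (D \<inter> {..<n}) + (if n \<in> D then 1 else 0)"
  by (simp add: lessThan_Suc Int_insert_right)

lemma card_tree: "card (tree N D n) = N ^ card (D \<inter> {..<n})"
proof (induction n)
  case (Suc n)
  have "card (tree N D (Suc n)) = card (tree N D n \<times> (if n \<in> D then {..<N} else {0}))"
    unfolding tree.simps by (rule card_image) (auto simp: inj_on_def)
  then show ?case
    using Suc by (simp add: card_cartesian_product card_Int_lessThan_Suc)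
qed simp

lemma tree_subset: "0 < N \<Longrightarrow> w \<in> tree N D n \<Longrightarrow> length w = n \<and> set w \<subseteq> {..<N}"
proof (induction n arbitrary: w)
  case (Suc n)
  then obtain v i where v: "v \<in> tree N D n" "w = v @ [i]" "i < N"
    by (auto split: if_splits)
  then show ?case using Suc.IH[OF Suc.prems(1) v(1)] by simp
qed simp

text \<open>Each free position from \<open>l\<close> on multiplies the number of extensions of
  \<open>u\<close> by \<open>N\<close>, each frozen one by 1. The product form avoids a difference
  of exponents.\<close>

lemma card_tree_extensions:
  assumes "l \<le> n" "0 < N"
  shows "card {w \<in> tree N D n. take l w = u} * N ^ card (D \<inter> {..<l}) \<le> N ^ card (D \<inter> {..<n})"
  using assms(1)
proof (induction n rule: dec_induct)
  case base
  have "{w \<in> tree N D l. take l w = u} \<subseteq> {u}"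
    using tree_subset[OF assms(2), of _ D l] by auto
  then have "card {w \<in> tree N D l. take l w = u} \<le> card {u}"
    by (intro card_mono) auto
  then show ?case by simp
next
  case (step n)
  let ?L = "if n \<in> D then {..<N} else {0}"
  let ?E = "{w \<in> tree N D n. take l w = u}"
  have finE: "finite ?E" by (rule finite_subset[OF _ finite_tree[of N D n]]) auto
  have "{w \<in> tree N D (Suc n). take l w = u} \<subseteq> (\<lambda>(w, i). w @ [i]) ` (?E \<times> ?L)"
  proof
    fix w assume "w \<in> {w \<in> tree N D (Suc n). take l w = u}"
    then obtain v i where v: "v \<in> tree N D n" "i \<in> ?L" "w = v @ [i]" "take l w = u" by auto
    then have "take l v = u"
      using tree_subset[OF assms(2) v(1)] step by simp
    then show "w \<in> (\<lambda>(w, i). w @ [i]) ` (?E \<times> ?L)" using v by force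
  qed
  then have "card {w \<in> tree N D (Suc n). take l w = u} \<le> card ((\<lambda>(w, i). w @ [i]) ` (?E \<times> ?L))"
    using finE by (intro card_mono finite_imageI finite_cartesian_product) auto
  also have "\<dots> \<le> card (?E \<times> ?L)"
    using finE by (intro card_image_le finite_cartesian_product) auto
  also have "\<dots> = card ?E * card ?L" by (rule card_cartesian_product)
  finally have "card {w \<in> tree N D (Suc n). take l w = u} * N ^ card (D \<inter> {..<l})
      \<le> (card ?E * N ^ card (D \<inter> {..<l})) * card ?L"
    by (simp add: mult.commute mult.left_commute)
  also have "\<dots> \<le> N ^ card (D \<inter> {..<n}) * card ?L"
    using step by (intro mult_right_mono) auto
  also have "\<dots> = N ^ card (D \<inter> {..<Suc n})"
    by (simp add: card_Int_lessThan_Suc)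
  finally show ?case .
qed

lemma tree_mono: "D \<subseteq> E \<Longrightarrow> 0 < N \<Longrightarrow> tree N D n \<subseteq> tree N E n"
proof (induction n)
  case (Suc n)
  then show ?case
    unfolding tree.simps by (intro image_mono Sigma_mono) auto
qed simp

text \<open>Finds the generation belonging to a scale \<open>d\<close>: the least \<open>k\<close>
  with \<open>\<rho> ^ k \<le> d\<close> is a successor because \<open>d < 1\<close>.\<close>

lemma power_scale:
  fixes \<rho> d :: real
  assumes "0 < \<rho>" "\<rho> < 1" "0 < d" "d < 1"
  obtains l where "\<rho> ^ Suc l \<le> d" "d < \<rho> ^ l"
proof -
  obtain n where n: "\<rho> ^ n < d" using real_arch_pow_inv[OF assms(3,2)] by blast
  define k where "k = (LEAST n. \<rho> ^ n \<le> d)"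
  have k: "\<rho> ^ k \<le> d"
    unfolding k_def by (rule LeastI[of "\<lambda>n. \<rho> ^ n \<le> d" n]) (use n in simp)
  then have "k \<noteq> 0" using assms by (intro notI) simp
  then obtain l where l: "k = Suc l" by (cases k) auto
  have "\<not> \<rho> ^ l \<le> d"
    using not_less_Least[of l "\<lambda>n. \<rho> ^ n \<le> d"] l by (simp add: k_def[symmetric])
  then show ?thesis using that[of l] k l by simp
qed

locale homogeneous_ifs = osc_ifs N g "\<lambda>_. \<rho>" K V for N g \<rho> and K V :: "'a::euclidean_space set" +
  assumes rho: "0 < \<rho>" "\<rho> < 1" and N_pos: "0 < N"
begin

section \<open>Cylinders, limit sets and lower bounds for their Hausdorff measure\<close>

lemma wratio_eq: "wratio w = \<rho> ^ length w"
  by (induction w) auto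

definition cylinders :: "nat set \<Rightarrow> nat \<Rightarrow> 'a set" where
  "cylinders D n = (\<Union>w\<in>tree N D n. wmap w ` K)"

text \<open>A decreasing intersection of compact sets in place of a coding by infinite words:
  compactness is all that the covering argument needs.\<close>

definition limit_set :: "nat set \<Rightarrow> 'a set" where
  "limit_set D = (\<Inter>n. cylinders D n)"

lemmas tree_set = tree_subset[OF N_pos]

lemma compact_cylinders: "compact (cylinders D n)"
  unfolding cylinders_def using tree_set
  by (intro compact_UN finite_tree compact_wmap_K) blast

lemma cylinders_Suc: "cylinders D (Suc n) \<subseteq> cylinders D n"
proof
  fix x assume "x \<in> cylinders D (Suc n)"
  then obtain w i y where w: "w \<in> tree N D n" "i < N" "y \<in> K" "x = wmap (w @ [i]) y"
    using N_pos by (auto simp: cylinders_def split: if_splits)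
  then have "g i y \<in> K" using g_K[of i] by auto
  moreover have "x = wmap w (g i y)" using w by (simp add: wmap_append)
  ultimately show "x \<in> cylinders D n" using w(1) by (auto simp: cylinders_def)
qed

lemma cylinders_antimono: "m \<le> n \<Longrightarrow> cylinders D n \<subseteq> cylinders D m"
  using lift_Suc_antimono_le[of "cylinders D"] cylinders_Suc by blast

lemma limit_set_subset: "limit_set D \<subseteq> K"
proof -
  have "limit_set D \<subseteq> cylinders D 0" unfolding limit_set_def by (rule INT_lower) simp
  then show ?thesis by (simp add: cylinders_def)
qed

lemma limit_set_mono: "D \<subseteq> E \<Longrightarrow> limit_set D \<subseteq> limit_set E"
  unfolding limit_set_def cylinders_def
  by (intro INT_anti_mono UN_mono tree_mono N_pos) auto

text \<open>The images of \<open>V\<close> are disjoint and contain balls of radius comparable to \<open>\<rho> ^ l\<close>.\<close>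

lemma card_words_meeting_ball:
  "\<exists>M>0. \<forall>l y d A. A \<subseteq> wset l \<longrightarrow> d \<le> \<rho> ^ l \<longrightarrow>
    (\<forall>w\<in>A. wmap w ` K \<inter> ball y d \<noteq> {}) \<longrightarrow> real (card A) \<le> M"
proof -
  obtain v where "v \<in> V" using nonempty_V by auto
  then obtain c where c: "0 < c" "ball v c \<subseteq> V" using open_V openE by blast
  obtain x0 where x0: "x0 \<in> K" using nonempty_K by auto
  obtain R where R: "\<And>x. x \<in> K \<Longrightarrow> dist v x \<le> R"
    using compact_imp_bounded[OF compact_K] unfolding bounded_any_center[of K v] by auto
  have R0: "0 \<le> R" using R[OF x0] zero_le_dist[of v x0] by linarith
  \<comment> \<open>In units of \<open>\<rho> ^ l\<close>: at most 1 from \<open>y\<close> to a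
    point of the image of \<open>K\<close>, at most \<open>R\<close> from there to the image of
    \<open>v\<close>, and \<open>c\<close> for the ball about that image.\<close>
  define b where "b = R + 1 + c"
  have b: "0 < b" using R0 c by (simp add: b_def)
  define M where "M = (b / c) ^ DIM('a)"
  show ?thesis
  proof (intro exI[of _ M] conjI allI impI)
    show "0 < M" using b c by (simp add: M_def)
    fix l y d A
    assume A: "A \<subseteq> wset l" and d: "d \<le> \<rho> ^ l" and meet: "\<forall>w\<in>A. wmap w ` K \<inter> ball y d \<noteq> {}"
    have pl: "0 < \<rho> ^ l" using rho by simp
    have wA: "set w \<subseteq> {..<N}" "length w = l" if "w \<in> A" for w
      using A that by (auto simp: wset_def)
    have im: "wmap w ` ball v c = ball (wmap w v) (\<rho> ^ l * c)" if "w \<in> A" for w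
      using wA[OF that] pl wmap_sim[of w] by (intro similarity_image_ball) (auto simp: wratio_eq)
    have "real (card A) * (\<rho> ^ l * c) ^ DIM('a) \<le> (\<rho> ^ l * b) ^ DIM('a)"
    proof (rule card_disjoint_balls_le[where p = "\<lambda>w. wmap w v" and y = y])
      show "finite A" using A finite_wset by (rule finite_subset)
      show "0 \<le> \<rho> ^ l * c" "0 \<le> \<rho> ^ l * b" using pl b c by auto
      fix w assume w: "w \<in> A"
      obtain x where x: "x \<in> K" "dist y (wmap w x) < d" using meet w by fastforce
      have "dist (wmap w x) (wmap w v) \<le> \<rho> ^ l * R"
        using wmap_sim[OF wA(1)[OF w], of x v] R[OF x(1)] pl wA[OF w]
        by (simp add: wratio_eq dist_commute)
      then have "dist y (wmap w v) \<le> \<rho> ^ l * (R + 1)"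
        using x(2) d dist_triangle[of y "wmap w v" "wmap w x"] by (simp add: algebra_simps)
      then show "ball (wmap w v) (\<rho> ^ l * c) \<subseteq> ball y (\<rho> ^ l * b)"
      proof (intro subsetI)
        fix z assume "z \<in> ball (wmap w v) (\<rho> ^ l * c)"
        then show "z \<in> ball y (\<rho> ^ l * b)"
          using \<open>dist y (wmap w v) \<le> \<rho> ^ l * (R + 1)\<close> dist_triangle[of y z "wmap w v"]
          by (simp add: b_def algebra_simps)
      qed
      fix u assume u: "u \<in> A" "w \<noteq> u"
      have "wmap w ` ball v c \<inter> wmap u ` ball v c \<subseteq> wmap w ` V \<inter> wmap u ` V"
        using c by auto
      also have "\<dots> = {}"
        using wA[OF w] wA[OF u(1)] u(2) by (intro wmap_V_disjoint) auto
      finally show "ball (wmap w v) (\<rho> ^ l * c) \<inter> ball (wmap u v) (\<rho> ^ l * c) = {}"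
        using im[OF w] im[OF u(1)] by simp
    qed
    then have "(real (card A) * c ^ DIM('a)) * (\<rho> ^ l) ^ DIM('a) \<le> b ^ DIM('a) * (\<rho> ^ l) ^ DIM('a)"
      by (simp add: power_mult_distrib mult_ac)
    then have "real (card A) * c ^ DIM('a) \<le> b ^ DIM('a)"
      using pl by (simp add: mult_le_cancel_right)
    then show "real (card A) \<le> M"
      using c by (simp add: M_def power_divide field_simps)
  qed
qed

text \<open>Counting words stands in for a mass distribution. Among the words of a deep generation,
  a ball of radius \<open>d\<close> comparable to \<open>\<rho> ^ l\<close> catches only those with
  one of at most \<open>M\<close> prefixes of length \<open>l\<close>. Each prefix accounts for a
  fraction of at most \<open>1 / N ^ k l\<close>, which by the hypothesis on \<open>D\<close> is at
  most \<open>(\<rho> ^ l) powr t\<close>. The fractions caught by all the balls add up to at least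
  1.\<close>

lemma cover_sum_lower_bound:
  assumes t: "0 < t" and D: "\<And>n. 1 \<le> real (N ^ card (D \<inter> {..<n})) * (\<rho> ^ n) powr t"
  shows "\<exists>c>0. \<forall>y d. (\<forall>j::nat. 0 < d j \<and> d j < 1) \<longrightarrow> limit_set D \<subseteq> (\<Union>j. ball (y j) (d j)) \<longrightarrow>
    (\<exists>J. finite J \<and> c \<le> (\<Sum>j\<in>J. d j powr t))"
proof -
  obtain M where M': "0 < M \<and> (\<forall>l y d A. A \<subseteq> wset l \<longrightarrow> d \<le> \<rho> ^ l \<longrightarrow>
    (\<forall>w\<in>A. wmap w ` K \<inter> ball y d \<noteq> {}) \<longrightarrow> real (card A) \<le> M)"
    using card_words_meeting_ball ..
  then have M: "0 < M" "\<And>l y d A. A \<subseteq> wset l \<Longrightarrow> d \<le> \<rho> ^ l \<Longrightarrow>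
    \<forall>w\<in>A. wmap w ` K \<inter> ball y d \<noteq> {} \<Longrightarrow> real (card A) \<le> M"
    by simp_all
  define k where "k n = card (D \<inter> {..<n})" for n
  obtain x0 where x0: "x0 \<in> K" using nonempty_K by auto
  show ?thesis
  proof (intro exI[of _ "\<rho> powr t / M"] conjI allI impI)
    show "0 < \<rho> powr t / M" using rho M(1) by simp
    fix y :: "nat \<Rightarrow> 'a" and d :: "nat \<Rightarrow> real"
    assume d: "\<forall>j. 0 < d j \<and> d j < 1" and cov: "limit_set D \<subseteq> (\<Union>j. ball (y j) (d j))"
    \<comment> \<open>Otherwise the compact sets left over by the open cover would be nested and
      nonempty, and a common point would be an uncovered point of the limit set.\<close>
    have "\<exists>n. cylinders D n \<subseteq> (\<Union>j. ball (y j) (d j))"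
    proof (rule ccontr)
      assume no: "\<not> ?thesis"
      have "(\<Inter>n. cylinders D n - (\<Union>j. ball (y j) (d j))) \<noteq> {}"
      proof (rule compact_nest)
        show "compact (cylinders D n - (\<Union>j. ball (y j) (d j)))" for n
          by (intro compact_diff compact_cylinders) auto
        show "cylinders D n - (\<Union>j. ball (y j) (d j)) \<noteq> {}" for n using no by auto
        show "cylinders D n - (\<Union>j. ball (y j) (d j)) \<subseteq> cylinders D m - (\<Union>j. ball (y j) (d j))"
          if "m \<le> n" for m n
          using cylinders_antimono[OF that] by blast
      qed
      then show False using cov by (auto simp: limit_set_def)
    qed
    then obtain n where n: "cylinders D n \<subseteq> (\<Union>j\<in>UNIV. ball (y j) (d j))" by auto
    obtain J where J: "finite J" "cylinders D n \<subseteq> (\<Union>j\<in>J. ball (y j) (d j))"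
      by (rule compactE_image[OF compact_cylinders _ n]) auto
    have "\<exists>l. \<rho> ^ Suc l \<le> d j \<and> d j < \<rho> ^ l" for j
      using power_scale[OF rho, of "d j"] d by metis
    then obtain l where l: "\<And>j. \<rho> ^ Suc (l j) \<le> d j" "\<And>j. d j < \<rho> ^ l j" by metis
    \<comment> \<open>Deep enough for the cylinders to lie in the finite subcover and for every word
      to have a prefix of each length \<open>l j\<close>.\<close>
    define n' where "n' = n + (\<Sum>j\<in>J. l j)"
    have ln': "l j \<le> n'" if "j \<in> J" for j
      using member_le_sum[of j J l] that J(1) by (simp add: n'_def)
    define W where "W j = {w \<in> tree N D n'. wmap w x0 \<in> ball (y j) (d j)}" for j
    have "tree N D n' \<subseteq> (\<Union>j\<in>J. W j)"
    proof
      fix w assume w: "w \<in> tree N D n'"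
      then have "wmap w x0 \<in> cylinders D n'" using x0 by (auto simp: cylinders_def)
      also have "\<dots> \<subseteq> cylinders D n" by (rule cylinders_antimono) (simp add: n'_def)
      also note J(2)
      finally show "w \<in> (\<Union>j\<in>J. W j)" using w by (auto simp: W_def)
    qed
    then have "card (tree N D n') \<le> card (\<Union>j\<in>J. W j)"
      using J(1) by (intro card_mono) (auto simp: W_def finite_tree)
    also have "\<dots> \<le> (\<Sum>j\<in>J. card (W j))" by (rule card_UN_le[OF J(1)])
    finally have tot: "N ^ k n' \<le> (\<Sum>j\<in>J. card (W j))" by (simp add: card_tree k_def)
    have each: "real (card (W j)) \<le> real (N ^ k n') * (M / \<rho> powr t * d j powr t)" if j: "j \<in> J" for j
    proof -
      define A where "A = take (l j) ` W j"
      have wW: "length w = n'" "set w \<subseteq> {..<N}" if "w \<in> W j" for w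
        using tree_set[of w D n'] that by (auto simp: W_def)
      have finW: "finite (W j)" by (auto simp: W_def finite_tree)
      have "real (card A) \<le> M"
      proof (rule M(2)[OF _ _ ballI])
        show "A \<subseteq> wset (l j)"
          using wW ln'[OF j] by (fastforce simp: A_def wset_def dest: in_set_takeD)
        show "d j \<le> \<rho> ^ l j" using l(2)[of j] by simp
        fix u assume "u \<in> A"
        then obtain w where w: "w \<in> W j" "u = take (l j) w" by (auto simp: A_def)
        have "set (drop (l j) w) \<subseteq> {..<N}" using wW[OF w(1)] by (meson set_drop_subset subset_trans)
        then have "wmap (drop (l j) w) x0 \<in> K" using wmap_K x0 by blast
        moreover have "wmap w x0 = wmap u (wmap (drop (l j) w) x0)"
          using wmap_append[of u "drop (l j) w"] w(2) by simp
        ultimately show "wmap u ` K \<inter> ball (y j) (d j) \<noteq> {}"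
          using w(1) by (auto simp: W_def)
      qed
      have "W j \<subseteq> (\<Union>u\<in>A. {w \<in> tree N D n'. take (l j) w = u})"
        by (auto simp: A_def W_def)
      then have "card (W j) \<le> card (\<Union>u\<in>A. {w \<in> tree N D n'. take (l j) w = u})"
        using finW by (intro card_mono) (auto simp: A_def finite_tree)
      also have "\<dots> \<le> (\<Sum>u\<in>A. card {w \<in> tree N D n'. take (l j) w = u})"
        using finW by (intro card_UN_le) (simp add: A_def)
      finally have "card (W j) * N ^ k (l j) \<le> (\<Sum>u\<in>A. card {w \<in> tree N D n'. take (l j) w = u} * N ^ k (l j))"
        by (simp add: mult_right_mono flip: sum_distrib_right)
      also have "\<dots> \<le> (\<Sum>u\<in>A. N ^ k n')"
        unfolding k_def by (intro sum_mono card_tree_extensions ln'[OF j] N_pos)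
      finally have "card (W j) * N ^ k (l j) \<le> card A * N ^ k n'" by simp
      then have "real (card (W j)) * real (N ^ k (l j)) \<le> real (card A) * real (N ^ k n')"
        by (simp only: of_nat_le_iff flip: of_nat_mult)
      also have "\<dots> \<le> M * real (N ^ k n')"
        using \<open>real (card A) \<le> M\<close> by (intro mult_right_mono) auto
      finally have 1: "real (card (W j)) * real (N ^ k (l j)) \<le> M * real (N ^ k n')" .
      \<comment> \<open>Rounding the radius to a power of \<open>\<rho>\<close> costs one
        generation, the source of \<open>\<rho> powr t\<close> in the constant.\<close>
      have "\<rho> ^ l j \<le> d j / \<rho>" using l(1)[of j] rho by (simp add: field_simps)
      then have 2: "(\<rho> ^ l j) powr t \<le> (d j / \<rho>) powr t"
        using rho t by (intro powr_mono2) auto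
      have "real (card (W j)) \<le> real (card (W j)) * (real (N ^ k (l j)) * (\<rho> ^ l j) powr t)"
        using D[of "l j"] unfolding k_def by (intro mult_le_cancel_left1[THEN iffD2]) auto
      also have "\<dots> = (real (card (W j)) * real (N ^ k (l j))) * (\<rho> ^ l j) powr t"
        by (rule mult.assoc[symmetric])
      also have "\<dots> \<le> (M * real (N ^ k n')) * (d j / \<rho>) powr t"
        by (rule mult_mono[OF 1 2]) (use M(1) in auto)
      also have "\<dots> = real (N ^ k n') * (M / \<rho> powr t * d j powr t)"
        using rho d by (simp add: powr_divide less_imp_le)
      finally show ?thesis .
    qed
    have "real (N ^ k n') \<le> (\<Sum>j\<in>J. real (card (W j)))"
      using tot by (simp only: of_nat_le_iff flip: of_nat_sum)
    also have "\<dots> \<le> (\<Sum>j\<in>J. real (N ^ k n') * (M / \<rho> powr t * d j powr t))"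
      by (intro sum_mono each)
    also have "\<dots> = real (N ^ k n') * (M / \<rho> powr t * (\<Sum>j\<in>J. d j powr t))"
      by (simp only: sum_distrib_left)
    finally have "real (N ^ k n') * 1 \<le> real (N ^ k n') * (M / \<rho> powr t * (\<Sum>j\<in>J. d j powr t))"
      by simp
    then have "1 \<le> M / \<rho> powr t * (\<Sum>j\<in>J. d j powr t)"
      using N_pos by (subst (asm) mult_le_cancel_left_pos) auto
    then have "\<rho> powr t / M \<le> (\<Sum>j\<in>J. d j powr t)"
      using M(1) rho by (simp add: field_simps)
    then show "\<exists>J. finite J \<and> \<rho> powr t / M \<le> (\<Sum>j\<in>J. d j powr t)" using J(1) by blast
  qed
qed

text \<open>Arbitrary covering sets, possibly of diameter 0, are enclosed in open balls of slightly
  larger radius at a small total extra cost, so that \<open>cover_sum_lower_bound\<close>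
  applies.\<close>

lemma hausdorff_measure_limit_set:
  assumes t: "0 < t" and D: "\<And>n. 1 \<le> real (N ^ card (D \<inter> {..<n})) * (\<rho> ^ n) powr t"
  shows "hausdorff_measure t (limit_set D) \<noteq> 0"
proof
  assume null: "hausdorff_measure t (limit_set D) = 0"
  obtain c where c': "0 < c \<and> (\<forall>y d. (\<forall>j::nat. 0 < d j \<and> d j < 1) \<longrightarrow>
      limit_set D \<subseteq> (\<Union>j. ball (y j) (d j)) \<longrightarrow> (\<exists>J. finite J \<and> c \<le> (\<Sum>j\<in>J. d j powr t)))"
    using cover_sum_lower_bound[OF t D] ..
  then have c: "0 < c" by simp
  have half: "(1 / 2) powr t < (1::real)"
    using t powr_less_mono'[of "1/2" 0 t] by simp
  \<comment> \<open>The bound \<open>c / 3\<close> keeps the total, at most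
    \<open>2 * \<epsilon>\<close>, below \<open>c\<close>; the other one keeps the radii below 1 for
    sets of diameter at most 1/2.\<close>
  define \<epsilon> where "\<epsilon> = min (c / 3) ((1 - (1 / 2) powr t) / 2)"
  have \<epsilon>: "0 < \<epsilon>" "\<epsilon> \<le> c / 3" "(1 / 2) powr t + \<epsilon> < 1"
    using c half by (auto simp: \<epsilon>_def min_def field_simps)
  have "hausdorff_premeasure t (1 / 2) (limit_set D) < ennreal \<epsilon>"
    using hausdorff_premeasure_le[of "1/2" t "limit_set D"] null \<epsilon> by simp
  then obtain U where U: "limit_set D \<subseteq> (\<Union>i. U i)" "\<And>i. bounded (U i)"
    "\<And>i. diameter (U i) \<le> 1 / 2" "(\<Sum>i. diam_powr t (U i)) < ennreal \<epsilon>"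
    by (rule hausdorff_premeasure_cover) blast
  define e where "e i = \<epsilon> * (1 / 2) ^ Suc i" for i :: nat
  have e: "0 < e i" for i using \<epsilon> by (simp add: e_def)
  have e_le: "e i \<le> \<epsilon>" for i
    unfolding e_def using \<epsilon> by (intro mult_left_le power_le_one) auto
  \<comment> \<open>Defined through its power: \<open>d i powr t\<close> exceeds
    \<open>diameter (U i) powr t\<close> by exactly \<open>e i\<close>, so the excesses are summable
    directly.\<close>
  define d where "d i = (diameter (U i) powr t + e i) powr (1 / t)" for i
  have dU: "0 \<le> diameter (U i)" for i by (rule diameter_ge_0[OF U(2)])
  have dpt: "d i powr t = diameter (U i) powr t + e i" for i
    using t e[of i] by (simp add: d_def powr_powr add_nonneg_pos[THEN less_imp_le])
  have d_pos: "0 < d i" for i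
    using e[of i] add_nonneg_pos[of "diameter (U i) powr t" "e i"] by (auto simp: d_def)
  have d_less: "d i < 1" for i
  proof (rule ccontr)
    assume "\<not> d i < 1"
    then have "1 \<le> d i powr t" using t by (simp add: ge_one_powr_ge_zero)
    moreover have "diameter (U i) powr t \<le> (1 / 2) powr t"
      using U(3) dU t by (intro powr_mono2) auto
    ultimately show False using dpt[of i] e_le[of i] \<epsilon>(3) by linarith
  qed
  have d_diam: "diameter (U i) < d i" for i
  proof (rule ccontr)
    assume "\<not> diameter (U i) < d i"
    then have "d i powr t \<le> diameter (U i) powr t" using t d_pos[of i] by (intro powr_mono2) auto
    then show False using dpt[of i] e[of i] by linarith
  qed
  define y where "y i = (SOME y. y \<in> U i)" for i
  have sub: "U i \<subseteq> ball (y i) (d i)" for i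
  proof
    fix x assume x: "x \<in> U i"
    then have "y i \<in> U i" unfolding y_def by (rule someI)
    then have "dist (y i) x \<le> diameter (U i)" using x U(2) by (intro diameter_bounded_bound)
    then show "x \<in> ball (y i) (d i)" using d_diam[of i] by simp
  qed
  have "limit_set D \<subseteq> (\<Union>i. ball (y i) (d i))"
    by (rule order.trans[OF U(1) UN_mono[OF order_refl sub]])
  have "\<exists>J. finite J \<and> c \<le> (\<Sum>j\<in>J. d j powr t)"
    by (rule c'[THEN conjunct2, rule_format])
      (use d_pos d_less \<open>limit_set D \<subseteq> (\<Union>i. ball (y i) (d i))\<close> in auto)
  then obtain J where J': "finite J \<and> c \<le> (\<Sum>j\<in>J. d j powr t)" ..
  then have J: "finite J" "c \<le> (\<Sum>j\<in>J. d j powr t)" by simp_all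
  have "(\<Sum>j\<in>J. ennreal (diameter (U j) powr t)) \<le> (\<Sum>i. diam_powr t (U i))"
    using t J(1) by (subst diam_powr_pos[symmetric]) (auto intro: sum_le_suminf)
  then have "ennreal (\<Sum>j\<in>J. diameter (U j) powr t) < ennreal \<epsilon>"
    using U(4) by (simp add: sum_ennreal)
  then have 1: "(\<Sum>j\<in>J. diameter (U j) powr t) < \<epsilon>"
    by (subst (asm) ennreal_less_iff) (auto simp: sum_nonneg)
  have "(\<Sum>j\<in>J. e j) \<le> \<epsilon>"
  proof -
    have "e sums \<epsilon>" unfolding e_def using sums_mult[OF power_half_series, of \<epsilon>] by simp
    then have "summable e" "suminf e = \<epsilon>" by (auto simp: sums_iff)
    then show ?thesis using sum_le_suminf[of e J] J(1) less_imp_le[OF e] by simp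
  qed
  then show False
    using 1 J(2) \<epsilon> c by (simp add: dpt sum.distrib)
qed

lemma limit_set_net:
  assumes x0: "x0 \<in> K"
  shows "\<exists>C>0. \<forall>D n. limit_set D \<subseteq> (\<Union>w\<in>tree N D n. ball (wmap w x0) (C * \<rho> ^ n))"
proof -
  define C where "C = diameter K + 1"
  have dK: "0 \<le> diameter K" by (rule diameter_ge_0[OF compact_imp_bounded[OF compact_K]])
  show ?thesis
  proof (intro exI[of _ C] conjI allI)
    show "0 < C" using dK by (simp add: C_def)
    fix D n
    show "limit_set D \<subseteq> (\<Union>w\<in>tree N D n. ball (wmap w x0) (C * \<rho> ^ n))"
    proof
      fix x assume "x \<in> limit_set D"
      then have "x \<in> cylinders D n" by (simp add: limit_set_def)
      then obtain w z where w: "w \<in> tree N D n" "z \<in> K" "x = wmap w z"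
        by (auto simp: cylinders_def)
      have "dist x0 z < C"
        using diameter_bounded_bound[OF compact_imp_bounded[OF compact_K] x0 w(2)] by (simp add: C_def)
      then have "dist (wmap w x0) x < C * \<rho> ^ n"
        using tree_set[OF w(1)] rho w(3) by (simp add: wmap_sim wratio_eq mult.commute)
      then show "x \<in> (\<Union>w\<in>tree N D n. ball (wmap w x0) (C * \<rho> ^ n))" using w(1) by auto
    qed
  qed
qed

end

section \<open>Nested position sets of prescribed density\<close>

text \<open>
  In the block of positions from \<open>k\<^sup>2\<close> to \<open>k\<^sup>2 + 2 k\<close> the first positions, in proportion \<open>a\<close>, are
  free. The set increases with \<open>a\<close>, the number of free positions below \<open>n\<close> is at least \<open>a n\<close>
  since the free positions come first, and it exceeds \<open>a n\<close> by \<open>O(\<surd>n)\<close> only.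
\<close>

definition positions :: "real \<Rightarrow> nat set" where
  "positions a = {k\<^sup>2 + j | k j. j \<le> 2 * k \<and> real j \<le> a * (2 * real k + 1)}"

lemma positions_mono: "a \<le> b \<Longrightarrow> positions a \<subseteq> positions b"
proof -
  assume ab: "a \<le> b"
  have "real j \<le> b * (2 * real k + 1)" if "real j \<le> a * (2 * real k + 1)" for j k :: nat
    using that mult_right_mono[OF ab, of "2 * real k + 1"] by linarith
  then show ?thesis unfolding positions_def by blast
qed

text \<open>The blocks are the gaps between consecutive squares, so \<open>k\<close> and
  \<open>j\<close> are determined by \<open>k\<^sup>2 + j\<close>.\<close>

lemma positions_iff:
  assumes "j \<le> 2 * k"
  shows "k\<^sup>2 + j \<in> positions a \<longleftrightarrow> real j \<le> a * (2 * real k + 1)"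
proof
  assume "k\<^sup>2 + j \<in> positions a"
  then obtain k' j' where *: "k\<^sup>2 + j = k'\<^sup>2 + j'" "j' \<le> 2 * k'" "real j' \<le> a * (2 * real k' + 1)"
    by (auto simp: positions_def)
  have "k\<^sup>2 < (Suc k')\<^sup>2" "k'\<^sup>2 < (Suc k)\<^sup>2" using * assms by (auto simp: power2_eq_square)
  then have "k < Suc k'" "k' < Suc k" by (auto dest: power_less_imp_less_base)
  then have "k = k'" by simp
  then show "real j \<le> a * (2 * real k + 1)" using * by simp
qed (use assms in \<open>auto simp: positions_def\<close>)

text \<open>A full block contributes at least \<open>a * (2 * real k + 1)\<close> positions and, by
  rounding, at most one more; the \<open>k\<close> earlier blocks account for the term
  \<open>k\<close>. Inside a block the minimum records that the free positions come first. The end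
  of one block is the start of the next.\<close>

lemma card_positions_block:
  assumes a: "0 \<le> a" "a \<le> 1" and j: "j \<le> 2 * k + 1"
  shows "a * (real k)\<^sup>2 + min (real j) (a * (2 * real k + 1)) \<le> card (positions a \<inter> {..<k\<^sup>2 + j})"
    and "card (positions a \<inter> {..<k\<^sup>2 + j}) \<le> a * (real k)\<^sup>2 + k + min (real j) (a * (2 * real k + 1) + 1)"
proof -
  define P where "P k j \<longleftrightarrow> a * (real k)\<^sup>2 + min (real j) (a * (2 * real k + 1)) \<le> card (positions a \<inter> {..<k\<^sup>2 + j}) \<and>
    card (positions a \<inter> {..<k\<^sup>2 + j}) \<le> a * (real k)\<^sup>2 + k + min (real j) (a * (2 * real k + 1) + 1)" for k j :: nat
  have inner: "P k j" if P0: "P k 0" and "j \<le> 2 * k + 1" for j k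
    using that(2)
  proof (induction j)
    case (Suc j)
    then have j: "j \<le> 2 * k" and IH: "P k j" by auto
    have c: "card (positions a \<inter> {..<k\<^sup>2 + Suc j})
        = card (positions a \<inter> {..<k\<^sup>2 + j}) + (if real j \<le> a * (2 * real k + 1) then 1 else 0)"
      using card_Int_lessThan_Suc[of "positions a" "k\<^sup>2 + j"] positions_iff[OF j] by simp
    show ?case
      using IH unfolding P_def c by (auto simp: min_def split: if_splits)
  qed (rule P0)
  have "P k 0" for k
  proof (induction k)
    case 0
    then show ?case using a by (simp add: P_def)
  next
    case (Suc k)
    define c where "c = real (card (positions a \<inter> {..<(Suc k)\<^sup>2}))"
    have sq: "k\<^sup>2 + (2 * k + 1) = (Suc k)\<^sup>2" by (simp add: power2_eq_square)
    have "P k (2 * k + 1)" by (rule inner[OF Suc]) simp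
    then have c: "a * (real k)\<^sup>2 + min (real (2 * k + 1)) (a * (2 * real k + 1)) \<le> c"
      "c \<le> a * (real k)\<^sup>2 + k + min (real (2 * k + 1)) (a * (2 * real k + 1) + 1)"
      unfolding P_def sq c_def by simp_all
    have "a * (2 * real k + 1) \<le> real (2 * k + 1)"
    proof -
      have "a * (2 * real k + 1) \<le> 1 * (2 * real k + 1)"
        using a by (intro mult_right_mono) auto
      also have "\<dots> = real (2 * k + 1)" by simp
      finally show ?thesis .
    qed
    then have "min (real (2 * k + 1)) (a * (2 * real k + 1)) = a * (2 * real k + 1)"
      by (rule min_absorb2)
    moreover have "a * (real (Suc k))\<^sup>2 = a * (real k)\<^sup>2 + a * (2 * real k + 1)"
      by (simp add: power2_eq_square algebra_simps)
    moreover have "min (real (2 * k + 1)) (a * (2 * real k + 1) + 1) \<le> a * (2 * real k + 1) + 1"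
      by simp
    ultimately have "a * (real (Suc k))\<^sup>2 \<le> c" "c \<le> a * (real (Suc k))\<^sup>2 + real (Suc k)"
      using c by linarith+
    moreover have "min (real 0) x = 0" if "0 \<le> x" for x using that by simp
    moreover have "0 \<le> a * (2 * real (Suc k) + 1)" using a by simp
    ultimately show ?case by (simp add: P_def c_def)
  qed
  from inner[OF this j] show "a * (real k)\<^sup>2 + min (real j) (a * (2 * real k + 1)) \<le> card (positions a \<inter> {..<k\<^sup>2 + j})"
    "card (positions a \<inter> {..<k\<^sup>2 + j}) \<le> a * (real k)\<^sup>2 + k + min (real j) (a * (2 * real k + 1) + 1)"
    by (simp_all add: P_def)
qed

lemma square_block: "\<exists>k j. n = k\<^sup>2 + j \<and> j \<le> 2 * k" for n :: nat
proof (induction n)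
  case (Suc n)
  then obtain k j where "n = k\<^sup>2 + j" "j \<le> 2 * k" by auto
  then show ?case
    by (cases "j = 2 * k") (auto simp: power2_eq_square intro: exI[of _ "Suc k"] exI[of _ k])
qed auto

lemma card_positions:
  assumes a: "0 \<le> a" "a \<le> 1"
  shows "a * real n \<le> card (positions a \<inter> {..<n})"
    and "card (positions a \<inter> {..<n}) \<le> a * real n + 3 * sqrt (real n) + 2"
proof -
  obtain k j where kj: "n = k\<^sup>2 + j" "j \<le> 2 * k" using square_block by blast
  have "j \<le> 2 * k + 1" using kj(2) by simp
  note block = card_positions_block[OF a this, folded kj(1)]
  have "a * real j \<le> 1 * real j" using a by (intro mult_right_mono) auto
  moreover have "a * real j \<le> a * (2 * real k + 1)" using a kj by (intro mult_left_mono) auto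
  ultimately have "a * real j \<le> min (real j) (a * (2 * real k + 1))" by simp
  moreover have an: "a * real n = a * (real k)\<^sup>2 + a * real j"
    by (simp add: kj(1) distrib_left)
  ultimately show "a * real n \<le> card (positions a \<inter> {..<n})"
    using block(1) by linarith
  have "real k = sqrt (k\<^sup>2)" by simp
  also have "\<dots> \<le> sqrt (real n)" using kj by (intro real_sqrt_le_mono) simp
  finally have k: "real k \<le> sqrt (real n)" .
  \<comment> \<open>The error terms are \<open>k\<close> for rounding, at most
    \<open>2 * k + 1\<close> for the current block and 1 for its own rounding, together
    \<open>3 * k + 2\<close>.\<close>
  have "a * (2 * real k + 1) \<le> 1 * (2 * real k + 1)" using a by (intro mult_right_mono) auto
  then have "a * (2 * real k + 1) \<le> 2 * real k + 1" by (simp only: mult_1)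
  moreover have "0 \<le> a * real j" using a by simp
  moreover have "card (positions a \<inter> {..<n}) \<le> a * (real k)\<^sup>2 + k + (a * (2 * real k + 1) + 1)"
    by (rule order.trans[OF block(2)]) simp
  ultimately show "card (positions a \<inter> {..<n}) \<le> a * real n + 3 * sqrt (real n) + 2"
    using k an by linarith
qed

section \<open>A universal atomic measure\<close>

text \<open>Nets in \<open>K\<close> of mesh \<open>R * \<rho> ^ n\<close> whose cardinality stays
  below \<open>(\<rho> ^ n) powr (- b)\<close> by an exponentially small factor. The factor
  \<open>\<theta> ^ n\<close> pays for the weight of generation \<open>n\<close> when all the nets
  are combined into one measure.\<close>

definition net_bound :: "'a::metric_space set \<Rightarrow> 'a set \<Rightarrow> real \<Rightarrow> bool" where
  "net_bound K F b \<longleftrightarrow> (\<exists>\<rho> \<theta> R C Q. 0 < \<rho> \<and> \<rho> < 1 \<and> 0 < \<theta> \<and> \<theta> < 1 \<and> 0 < R \<and> 0 < C \<and>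
    (\<forall>n. finite (Q n) \<and> Q n \<noteq> {} \<and> Q n \<subseteq> K \<and> F \<subseteq> (\<Union>y\<in>Q n. ball y (R * \<rho> ^ n)) \<and>
      real (card (Q n)) * (\<rho> ^ n) powr b \<le> C * \<theta> ^ n))"

lemma pmf_bind_ge: "pmf N x * pmf (f x) y \<le> pmf (bind_pmf N f) y"
proof -
  have "pmf N x * pmf (f x) y = (LINT z|measure_pmf N. pmf (f x) y * indicator {x} z)"
    by (simp add: measure_pmf_single)
  also have "\<dots> \<le> (LINT z|measure_pmf N. pmf (f z) y)"
  proof (rule integral_mono)
    show "integrable (measure_pmf N) (\<lambda>z. pmf (f x) y * indicator {x} z)"
      by (rule measure_pmf.integrable_const_bound[where B = 1]) (auto simp: indicator_def pmf_le_1)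
    show "integrable (measure_pmf N) (\<lambda>z. pmf (f z) y)"
      by (rule measure_pmf.integrable_const_bound[where B = 1]) (auto simp: pmf_le_1)
    show "pmf (f x) y * indicator {x} z \<le> pmf (f z) y" for z
      by (auto simp: indicator_def)
  qed
  finally show ?thesis by (simp add: pmf_bind)
qed

text \<open>The uniform measures on the nets are mixed with the geometric weights
  \<open>(1 - \<theta>) * \<theta> ^ n\<close>; a point of the net \<open>Q n\<close> then has mass
  at least \<open>(1 - \<theta>) / C * (\<rho> ^ n) powr b\<close>.\<close>

lemma net_bound_pmf:
  assumes "net_bound K F b" and b: "0 \<le> b"
  shows "\<exists>P. set_pmf P \<subseteq> K \<and>
    (\<exists>c>0. \<exists>R>0. \<forall>x\<in>F. \<forall>r. 0 < r \<longrightarrow> r < R \<longrightarrow> (\<exists>y\<in>ball x r. c * r powr b \<le> pmf P y))"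
proof -
  obtain \<rho> \<theta> R C Q where par: "0 < \<rho>" "\<rho> < 1" "0 < \<theta>" "\<theta> < 1" "0 < R" "0 < C"
    and Q: "\<And>n. finite (Q n)" "\<And>n. Q n \<noteq> {}" "\<And>n. Q n \<subseteq> K"
      "\<And>n. F \<subseteq> (\<Union>y\<in>Q n. ball y (R * \<rho> ^ n))"
      "\<And>n. real (card (Q n)) * (\<rho> ^ n) powr b \<le> C * \<theta> ^ n"
    using assms(1) unfolding net_bound_def by metis
  define P where "P = bind_pmf (geometric_pmf (1 - \<theta>)) (\<lambda>n. pmf_of_set (Q n))"
  \<comment> \<open>For radius \<open>r\<close> the first generation with
    \<open>R * \<rho> ^ n \<le> r\<close> is used; it satisfies
    \<open>\<rho> ^ n \<ge> \<rho> / R * r\<close>, which produces the factor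
    \<open>(\<rho> / R) powr b\<close>.\<close>
  define c where "c = (1 - \<theta>) / C * (\<rho> / R) powr b"
  have "set_pmf P \<subseteq> K"
    using Q by (auto simp: P_def set_pmf_of_set)
  moreover have "0 < c" using par by (simp add: c_def)
  moreover have "\<exists>y\<in>ball x r. c * r powr b \<le> pmf P y" if x: "x \<in> F" and r: "0 < r" "r < R" for x r
  proof -
    have "0 < r / R" "r / R < 1" using r by auto
    then obtain l where l: "\<rho> ^ Suc l \<le> r / R" "r / R < \<rho> ^ l"
      by (rule power_scale[OF par(1,2)])
    define n where "n = Suc l"
    obtain y where y: "y \<in> Q n" "x \<in> ball y (R * \<rho> ^ n)" using Q(4)[of n] x by auto
    have "R * \<rho> ^ n \<le> r" using l(1) par by (simp add: n_def field_simps)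
    then have yx: "y \<in> ball x r" using y(2) by (simp add: dist_commute)
    have card: "0 < real (card (Q n))" using Q(1,2)[of n] by (simp add: card_gt_0_iff)
    have "\<rho> / R * r \<le> \<rho> ^ n"
      using l(2) par mult_left_mono[of "r / R" "\<rho> ^ l" \<rho>] by (simp add: n_def)
    then have "(\<rho> / R * r) powr b \<le> (\<rho> ^ n) powr b"
      using par r b by (intro powr_mono2) auto
    then have "(1 - \<theta>) / C * (\<rho> / R * r) powr b \<le> (1 - \<theta>) / C * (\<rho> ^ n) powr b"
      using par by (intro mult_left_mono) auto
    moreover have "(\<rho> / R * r) powr b = (\<rho> / R) powr b * r powr b"
      by (rule powr_mult)
    ultimately have "c * r powr b \<le> (1 - \<theta>) / C * (\<rho> ^ n) powr b"
      by (simp only: c_def mult.assoc)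
    also have "\<dots> \<le> (1 - \<theta>) / C * (C * \<theta> ^ n / real (card (Q n)))"
      using Q(5)[of n] card par by (intro mult_left_mono) (auto simp: field_simps)
    also have "\<dots> = pmf (geometric_pmf (1 - \<theta>)) n * pmf (pmf_of_set (Q n)) y"
      using par Q(1,2)[of n] y(1) by (simp add: pmf_geometric field_simps)
    also have "\<dots> \<le> pmf P y"
      unfolding P_def by (rule pmf_bind_ge)
    finally show ?thesis using yx by blast
  qed
  ultimately show ?thesis using par(5) by blast
qed

text \<open>The measures for the single indices are mixed with geometric weights. The weight of an
  index only shrinks its constant \<open>c\<close>, which local dimensions do not see.\<close>

lemma universal_pmf:
  fixes F :: "'i \<Rightarrow> 'a::metric_space set"
  assumes I: "countable I" and K: "K \<noteq> {}"
    and net: "\<And>i. i \<in> I \<Longrightarrow> net_bound K (F i) (b i)" and b: "\<And>i. i \<in> I \<Longrightarrow> 0 \<le> b i"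
  shows "\<exists>P. set_pmf P \<subseteq> K \<and> (\<forall>i\<in>I. \<exists>c>0. \<exists>R>0. \<forall>x\<in>F i. \<forall>r. 0 < r \<longrightarrow> r < R \<longrightarrow>
    c * r powr b i \<le> measure (measure_pmf P) (ball x r))"
proof (cases "I = {}")
  case True
  obtain k where "k \<in> K" using K by auto
  then show ?thesis using True by (intro exI[of _ "return_pmf k"]) simp
next
  case False
  have "\<forall>i\<in>I. \<exists>P. set_pmf P \<subseteq> K \<and>
    (\<exists>c>0. \<exists>R>0. \<forall>x\<in>F i. \<forall>r. 0 < r \<longrightarrow> r < R \<longrightarrow> (\<exists>y\<in>ball x r. c * r powr b i \<le> pmf P y))"
    using net_bound_pmf net b by blast
  from bchoice[OF this] obtain P where P: "\<forall>i\<in>I. set_pmf (P i) \<subseteq> K \<and>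
    (\<exists>c>0. \<exists>R>0. \<forall>x\<in>F i. \<forall>r. 0 < r \<longrightarrow> r < R \<longrightarrow> (\<exists>y\<in>ball x r. c * r powr b i \<le> pmf (P i) y))" ..
  define U where "U = bind_pmf (geometric_pmf (1 / 2)) (\<lambda>k. P (from_nat_into I k))"
  have "set_pmf U \<subseteq> K"
    using P from_nat_into[OF False] by (auto simp: U_def)
  moreover have "\<exists>c>0. \<exists>R>0. \<forall>x\<in>F i. \<forall>r. 0 < r \<longrightarrow> r < R \<longrightarrow> c * r powr b i \<le> measure (measure_pmf U) (ball x r)"
    if i: "i \<in> I" for i
  proof -
    obtain c R where c: "0 < c" "0 < R"
      "\<And>x r. x \<in> F i \<Longrightarrow> 0 < r \<Longrightarrow> r < R \<Longrightarrow> \<exists>y\<in>ball x r. c * r powr b i \<le> pmf (P i) y"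
      using P i by meson
    define w where "w = pmf (geometric_pmf (1 / 2)) (to_nat_on I i)"
    have w: "0 < w" by (simp add: w_def pmf_geometric)
    have "w * c * r powr b i \<le> measure (measure_pmf U) (ball x r)" if x: "x \<in> F i" and r: "0 < r" "r < R" for x r
    proof -
      obtain y where y: "y \<in> ball x r" "c * r powr b i \<le> pmf (P i) y" using c(3)[OF x r] by auto
      have "w * c * r powr b i \<le> w * pmf (P i) y"
        using y(2) w by (simp add: mult.assoc)
      also have "\<dots> \<le> pmf U y"
        using pmf_bind_ge[of "geometric_pmf (1 / 2)" "to_nat_on I i" "\<lambda>k. P (from_nat_into I k)" y]
          from_nat_into_to_nat_on[OF I i] by (simp add: w_def U_def)
      also have "\<dots> = measure (measure_pmf U) {y}" by (simp add: measure_pmf_single)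
      also have "\<dots> \<le> measure (measure_pmf U) (ball x r)"
        using y(1) by (intro measure_pmf.finite_measure_mono) auto
      finally show ?thesis .
    qed
    then show ?thesis using c(1,2) w by (intro exI[of _ "w * c"] conjI exI[of _ R]) auto
  qed
  ultimately show ?thesis by blast
qed

section \<open>Net bounds and positive measure for limit sets with positions of prescribed
  density\<close>

context homogeneous_ifs
begin

text \<open>The net consists of the images of one point under the words of the tree. Their number is
  at most \<open>\<rho> powr (- s * (a * n + 3 * sqrt n + 2))\<close>, and the slack
  \<open>(b - a) * n\<close> in the exponent is split in half: one half absorbs the square root, the
  other becomes \<open>\<theta> ^ n\<close>.\<close>

lemma net_bound_limit_set:
  assumes N: "real N = \<rho> powr (- s)" and s: "0 < s" and a: "0 \<le> a" "a < b" "b \<le> 1"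
  shows "net_bound K (limit_set (positions a)) (b * s)"
proof -
  obtain x0 where x0: "x0 \<in> K" using nonempty_K by auto
  obtain C where C: "0 < C" "\<And>D n. limit_set D \<subseteq> (\<Union>w\<in>tree N D n. ball (wmap w x0) (C * \<rho> ^ n))"
    using limit_set_net[OF x0] by auto
  define \<delta> where "\<delta> = b - a"
  have \<delta>: "0 < \<delta>" using a by (simp add: \<delta>_def)
  \<comment> \<open>From \<open>3 * u \<le> \<delta> * u * u / 2 + 9 / (2 * \<delta>)\<close> with
    \<open>u = sqrt n\<close>, a consequence of \<open>0 \<le> (\<delta> * u - 3)\<^sup>2\<close>,
    and the additive 2 in \<open>card_positions\<close>.\<close>
  define B where "B = 9 / (2 * \<delta>) + 2"
  define Q where "Q n = (\<lambda>w. wmap w x0) ` tree N (positions a) n" for n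
  define \<theta> where "\<theta> = \<rho> powr (s * \<delta> / 2)"
  have "real (card (Q n)) * (\<rho> ^ n) powr (b * s) \<le> \<rho> powr (- (s * B)) * \<theta> ^ n" for n
  proof -
    define k where "k = card (positions a \<inter> {..<n})"
    have "card (Q n) \<le> N ^ k"
      unfolding Q_def k_def card_tree[symmetric] by (rule card_image_le[OF finite_tree])
    then have "real (card (Q n)) \<le> real N ^ k"
      by (simp flip: of_nat_power)
    also have "\<dots> = \<rho> powr (- (s * k))"
      using rho by (simp add: N powr_powr flip: powr_realpow)
    finally have "real (card (Q n)) * (\<rho> ^ n) powr (b * s) \<le> \<rho> powr (- (s * k)) * \<rho> powr (n * (b * s))"
      using rho by (simp add: powr_powr mult_right_mono flip: powr_realpow)
    also have "\<dots> = \<rho> powr (s * (b * n - k))"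
      by (simp add: algebra_simps flip: powr_add)
    also have "\<dots> \<le> \<rho> powr (s * (\<delta> * n / 2 - B))"
    proof (rule powr_mono')
      define u where "u = sqrt (real n)"
      have u: "u * u = real n" by (simp add: u_def)
      have "0 \<le> (\<delta> * u - 3)\<^sup>2" by simp
      then have "6 * \<delta> * u \<le> \<delta> * \<delta> * real n + 9"
        by (simp add: power2_eq_square algebra_simps flip: u)
      then have "3 * u \<le> \<delta> * n / 2 + 9 / (2 * \<delta>)"
        using \<delta> by (simp add: field_simps)
      moreover have "real k \<le> a * real n + 3 * u + 2"
        using card_positions(2)[of a n] a by (simp add: k_def u_def)
      moreover have "b * real n = a * real n + \<delta> * real n" by (simp add: \<delta>_def algebra_simps)
      ultimately have "\<delta> * n / 2 - B \<le> b * n - k" unfolding B_def by linarith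
      then show "s * (\<delta> * n / 2 - B) \<le> s * (b * n - k)" using s by simp
    qed (use rho in auto)
    also have "\<dots> = \<rho> powr (- (s * B)) * ((\<rho> powr (s * \<delta> / 2)) powr n)"
      by (simp add: powr_powr algebra_simps flip: powr_add)
    also have "(\<rho> powr (s * \<delta> / 2)) powr n = \<theta> ^ n"
      using rho by (simp add: \<theta>_def powr_realpow)
    finally show ?thesis .
  qed
  moreover have "finite (Q n)" "Q n \<noteq> {}" for n
  proof -
    have "0 < card (tree N (positions a) n)" using N_pos by (simp add: card_tree)
    then show "finite (Q n)" "Q n \<noteq> {}" by (auto simp: Q_def finite_tree card_gt_0_iff)
  qed
  moreover have "Q n \<subseteq> K" for n
    using tree_set wmap_K x0 by (fastforce simp: Q_def)
  moreover have "limit_set (positions a) \<subseteq> (\<Union>y\<in>Q n. ball y (C * \<rho> ^ n))" for n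
    using C(2)[of "positions a" n] by (simp add: Q_def)
  moreover have "0 < \<theta>" "\<theta> < 1"
    using rho s \<delta> powr_less_mono'[of \<rho> 0 "s * \<delta> / 2"] by (auto simp: \<theta>_def)
  moreover have "0 < \<rho> powr (- (s * B))" using rho by simp
  ultimately show ?thesis
    unfolding net_bound_def using rho C(1)
    by (intro exI[of _ \<rho>] exI[of _ \<theta>] exI[of _ C] exI[of _ "\<rho> powr (- (s * B))"] exI[of _ Q]) auto
qed

text \<open>The lower bound in \<open>card_positions\<close> carries no error term, so the
  hypothesis of \<open>hausdorff_measure_limit_set\<close> holds for every \<open>n\<close> at the
  exact exponent \<open>t\<close>.\<close>

lemma hausdorff_measure_limit_set_positions:
  assumes N: "real N = \<rho> powr (- s)" and t: "0 < t" "t < s"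
  shows "hausdorff_measure t (limit_set (positions (t / s))) \<noteq> 0"
proof (rule hausdorff_measure_limit_set[OF t(1)])
  fix n
  define k where "k = card (positions (t / s) \<inter> {..<n})"
  have "t / s * real n \<le> real k"
    unfolding k_def using t by (intro card_positions(1)) auto
  then have "t * n \<le> s * k" using t by (simp add: field_simps)
  have "1 = \<rho> powr 0" using rho by simp
  also have "\<dots> \<le> \<rho> powr (n * t - s * k)"
    using rho \<open>t * n \<le> s * k\<close> by (intro powr_mono') (auto simp: mult.commute)
  also have "\<dots> = \<rho> powr (- (s * k)) * \<rho> powr (n * t)"
    by (simp flip: powr_add)
  also have "\<dots> = real (N ^ k) * (\<rho> ^ n) powr t"
    using rho by (simp add: N powr_powr flip: powr_realpow)
  finally show "1 \<le> real (N ^ card (positions (t / s) \<inter> {..<n})) * (\<rho> ^ n) powr t"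
    unfolding k_def .
qed

end

lemma osc_ifs_of_self_similar:
  assumes "self_similar_by m S K" "open_set_condition m S"
  obtains r V where "osc_ifs m S r K V" "K = (\<Union>i<m. S i ` K)" "compact K" "K \<noteq> {}"
proof -
  have S: "compact K" "K \<noteq> {}" "\<forall>i<m. contractive_similarity (S i)" "K = (\<Union>i<m. S i ` K)"
    using assms(1) by (auto simp: self_similar_by_def)
  have "\<forall>i. \<exists>c. i < m \<longrightarrow> 0 < c \<and> c < 1 \<and> (\<forall>x y. dist (S i x) (S i y) = c * dist x y)"
    using S(3) unfolding contractive_similarity_def by blast
  from choice[OF this] obtain r where
    r: "\<forall>i. i < m \<longrightarrow> 0 < r i \<and> r i < 1 \<and> (\<forall>x y. dist (S i x) (S i y) = r i * dist x y)" ..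
  obtain V where V: "open V" "V \<noteq> {}" "\<forall>i<m. S i ` V \<subseteq> V"
    "\<forall>i<m. \<forall>j<m. i \<noteq> j \<longrightarrow> S i ` V \<inter> S j ` V = {}"
    using assms(2) unfolding open_set_condition_def by blast
  have "S i ` K \<subseteq> K" if "i < m" for i using S(4) that by blast
  then have "osc_ifs m S r K V"
    using r V S(1,2) by unfold_locales simp_all
  then show ?thesis using that S by blast
qed

lemma nested_subsets:
  assumes K: "self_similar_by m S K" "open_set_condition m S"
    and \<tau>: "0 < \<tau>" "ereal \<tau> < hausdorff_dim K"
  shows "\<exists>s F. \<tau> \<le> s \<and> (\<forall>a b. a \<le> b \<longrightarrow> F a \<subseteq> F b) \<and> (\<forall>a. F a \<subseteq> K) \<and>
    (\<forall>t. 0 < t \<longrightarrow> t < s \<longrightarrow> hausdorff_measure t (F (t / s)) \<noteq> 0) \<and>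
    (\<forall>a b. 0 \<le> a \<longrightarrow> a < b \<longrightarrow> b \<le> 1 \<longrightarrow> net_bound K (F a) (b * s))"
proof -
  obtain r V where V: "osc_ifs m S r K V" "K = (\<Union>i<m. S i ` K)"
    using osc_ifs_of_self_similar[OF K] by metis
  interpret osc_ifs m S r K V by (rule V(1))
  obtain N g \<rho> s where h: "osc_ifs N g (\<lambda>_. \<rho>) K V" "\<tau> \<le> s" "0 < \<rho>" "\<rho> < 1" "real N = \<rho> powr (- s)"
    using homogeneous_subsystem[OF V(2) \<tau>] by blast
  have "0 < real N" unfolding h(5) using h(3) by simp
  then have "0 < N" by simp
  then have "homogeneous_ifs N g \<rho> K V"
    using h by (simp add: homogeneous_ifs_def homogeneous_ifs_axioms_def)
  then interpret H: homogeneous_ifs N g \<rho> K V .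
  have s: "0 < s" using h \<tau> by simp
  show ?thesis
    using h(2,5) s H.net_bound_limit_set H.hausdorff_measure_limit_set_positions
      H.limit_set_subset H.limit_set_mono[OF positions_mono]
    by (intro exI[of _ s] exI[of _ "\<lambda>a. H.limit_set (positions a)"]) auto
qed

text \<open>A rational \<open>q\<close> selects a subsystem of dimension \<open>s q \<ge> q\<close>,
  and rationals \<open>a < b\<close> a set and an exponent in it. For real \<open>t\<close> the set
  is that of the real density \<open>t / s q\<close>, fixed before \<open>b\<close>; for each
  \<open>b\<close> it is enclosed in a set of rational density, whose estimate it inherits.\<close>

lemma exists_universal_pmf:
  assumes K: "self_similar_by m S K" "open_set_condition m S"
  shows "\<exists>P. set_pmf P \<subseteq> K \<and> (\<forall>t. 0 < t \<longrightarrow> ereal t < hausdorff_dim K \<longrightarrow>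
    (\<exists>F\<subseteq>K. hausdorff_measure t F \<noteq> 0 \<and> (\<forall>b>t. \<exists>c>0. \<exists>R>0. \<forall>x\<in>F. \<forall>r. 0 < r \<longrightarrow> r < R \<longrightarrow>
      c * r powr b \<le> measure (measure_pmf P) (ball x r))))"
proof -
  define T where "T = {q :: rat. 0 < real_of_rat q \<and> ereal (real_of_rat q) < hausdorff_dim K}"
  have "\<forall>q\<in>T. \<exists>sF. real_of_rat q \<le> fst sF \<and> (\<forall>a b. a \<le> b \<longrightarrow> snd sF a \<subseteq> snd sF b) \<and> (\<forall>a. snd sF a \<subseteq> K) \<and>
    (\<forall>t. 0 < t \<longrightarrow> t < fst sF \<longrightarrow> hausdorff_measure t (snd sF (t / fst sF)) \<noteq> 0) \<and>
    (\<forall>a b. 0 \<le> a \<longrightarrow> a < b \<longrightarrow> b \<le> 1 \<longrightarrow> net_bound K (snd sF a) (b * fst sF))"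
    using nested_subsets[OF K] unfolding T_def by auto
  from bchoice[OF this] obtain sF where sF: "\<forall>q\<in>T. real_of_rat q \<le> fst (sF q) \<and>
    (\<forall>a b. a \<le> b \<longrightarrow> snd (sF q) a \<subseteq> snd (sF q) b) \<and> (\<forall>a. snd (sF q) a \<subseteq> K) \<and>
    (\<forall>t. 0 < t \<longrightarrow> t < fst (sF q) \<longrightarrow> hausdorff_measure t (snd (sF q) (t / fst (sF q))) \<noteq> 0) \<and>
    (\<forall>a b. 0 \<le> a \<longrightarrow> a < b \<longrightarrow> b \<le> 1 \<longrightarrow> net_bound K (snd (sF q) a) (b * fst (sF q)))" ..
  define s where "s q = fst (sF q)" for q
  define F where "F q = snd (sF q)" for q
  have s: "real_of_rat q \<le> s q" "0 < s q" if "q \<in> T" for q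
  proof -
    show "real_of_rat q \<le> s q" using sF that by (auto simp: s_def)
    moreover have "0 < real_of_rat q" using that unfolding T_def by blast
    ultimately show "0 < s q" by linarith
  qed
  have F: "a \<le> b \<Longrightarrow> F q a \<subseteq> F q b" "F q a \<subseteq> K"
    "0 < t \<Longrightarrow> t < s q \<Longrightarrow> hausdorff_measure t (F q (t / s q)) \<noteq> 0"
    "0 \<le> a \<Longrightarrow> a < b \<Longrightarrow> b \<le> 1 \<Longrightarrow> net_bound K (F q a) (b * s q)" if "q \<in> T" for q a b t
    using sF that by (auto simp: s_def F_def)
  define I where "I = {(q, a, b). q \<in> T \<and> 0 \<le> real_of_rat a \<and> real_of_rat a < real_of_rat b \<and> real_of_rat b \<le> 1}"
  have "\<exists>P. set_pmf P \<subseteq> K \<and> (\<forall>i\<in>I. \<exists>c>0. \<exists>R>0. \<forall>x\<in>(case i of (q, a, b) \<Rightarrow> F q (real_of_rat a)).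
      \<forall>r. 0 < r \<longrightarrow> r < R \<longrightarrow>
      c * r powr (case i of (q, a, b) \<Rightarrow> real_of_rat b * s q) \<le> measure (measure_pmf P) (ball x r))"
  proof (rule universal_pmf)
    show "countable I" by simp
    show "K \<noteq> {}" using K by (simp add: self_similar_by_def)
    show "net_bound K (case i of (q, a, b) \<Rightarrow> F q (real_of_rat a)) (case i of (q, a, b) \<Rightarrow> real_of_rat b * s q)"
      if "i \<in> I" for i
      using that F(4) by (auto simp: I_def)
    show "0 \<le> (case i of (q, a, b) \<Rightarrow> real_of_rat b * s q)" if iI: "i \<in> I" for i
    proof -
      obtain q a b where i: "i = (q, a, b)" "q \<in> T" "0 \<le> real_of_rat a" "real_of_rat a < real_of_rat b"
        using iI unfolding I_def by blast
      have "0 \<le> real_of_rat b" using i(3,4) by linarith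
      then show ?thesis using s(2)[OF i(2)] i(1) by simp
    qed
  qed
  then obtain P where P: "set_pmf P \<subseteq> K"
    "\<And>q a b. (q, a, b) \<in> I \<Longrightarrow> \<exists>c>0. \<exists>R>0. \<forall>x\<in>F q (real_of_rat a). \<forall>r. 0 < r \<longrightarrow> r < R \<longrightarrow>
      c * r powr (real_of_rat b * s q) \<le> measure (measure_pmf P) (ball x r)"
    by force
  have "\<exists>F\<subseteq>K. hausdorff_measure t F \<noteq> 0 \<and> (\<forall>b>t. \<exists>c>0. \<exists>R>0. \<forall>x\<in>F. \<forall>r. 0 < r \<longrightarrow> r < R \<longrightarrow>
      c * r powr b \<le> measure (measure_pmf P) (ball x r))"
    if t: "0 < t" "ereal t < hausdorff_dim K" for t
  proof -
    \<comment> \<open>The dimension is an \<open>ereal\<close>; a real \<open>t'\<close> below it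
      makes room for a rational \<open>q\<close> above \<open>t\<close>.\<close>
    obtain t' where t': "t < t'" "ereal t' < hausdorff_dim K"
      using ereal_dense2[OF t(2)] by auto
    obtain q where q: "t < real_of_rat q" "real_of_rat q < t'" using of_rat_dense[OF t'(1)] by auto
    have "ereal (real_of_rat q) < hausdorff_dim K"
      using q(2) t'(2) by (meson ereal_less_eq(3) less_imp_le order.strict_trans1)
    moreover have "0 < real_of_rat q" using q t(1) by linarith
    ultimately have qT: "q \<in> T" unfolding T_def by blast
    have ts: "t < s q" using s(1)[OF qT] q by simp
    have "\<exists>c>0. \<exists>R>0. \<forall>x\<in>F q (t / s q). \<forall>r. 0 < r \<longrightarrow> r < R \<longrightarrow>
      c * r powr b \<le> measure (measure_pmf P) (ball x r)" if b: "t < b" for b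
    proof -
      \<comment> \<open>The densities indexed by \<open>I\<close> do not exceed 1, and
        \<open>b' * s q \<le> b\<close> is needed to compare the exponents at radii below 1.\<close>
      have "t / s q < min 1 (b / s q)" using ts b s(2)[OF qT] by (simp add: divide_strict_right_mono)
      then obtain b' where b': "t / s q < real_of_rat b'" "real_of_rat b' < min 1 (b / s q)"
        using of_rat_dense by blast
      obtain a where a: "t / s q < real_of_rat a" "real_of_rat a < real_of_rat b'"
        using of_rat_dense[OF b'(1)] by blast
      have a0: "0 \<le> real_of_rat a" using a(1) divide_pos_pos[OF t(1) s(2)[OF qT]] by linarith
      have "(q, a, b') \<in> I" using qT a a0 b' by (simp add: I_def)
      then obtain c R where c: "0 < c" "0 < R" "\<And>x r. x \<in> F q (real_of_rat a) \<Longrightarrow> 0 < r \<Longrightarrow> r < R \<Longrightarrow>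
          c * r powr (real_of_rat b' * s q) \<le> measure (measure_pmf P) (ball x r)"
        using P(2) by meson
      have sub: "F q (t / s q) \<subseteq> F q (real_of_rat a)" using F(1)[OF qT] a(1) by simp
      have bs: "real_of_rat b' * s q \<le> b"
        using b'(2) s(2)[OF qT] by (simp add: field_simps)
      have "c * r powr b \<le> measure (measure_pmf P) (ball x r)"
        if "x \<in> F q (t / s q)" "0 < r" "r < min R 1" for x r
      proof -
        have "r powr b \<le> r powr (real_of_rat b' * s q)"
          using that bs by (intro powr_mono') auto
        then have "c * r powr b \<le> c * r powr (real_of_rat b' * s q)" using c(1) by simp
        also have "\<dots> \<le> measure (measure_pmf P) (ball x r)" using c(3) that sub by auto
        finally show ?thesis .
      qed
      then show ?thesis using c(1,2) by (intro exI[of _ c] conjI exI[of _ "min R 1"]) auto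
    qed
    then show ?thesis
      using F(2)[OF qT] F(3)[OF qT t(1) ts] by blast
  qed
  then show ?thesis using P(1) by blast
qed

section \<open>Level sets of the local dimension\<close>

lemma ereal_ln_ratio_less_iff:
  assumes "0 < r" "r < 1"
  shows "ereal_ln m / ereal (ln r) < ereal b \<longleftrightarrow> r powr b < m"
proof -
  have ln: "ln r < 0" using assms by simp
  show ?thesis
  proof (cases "m \<le> 0")
    \<comment> \<open>A ball without mass has logarithm \<open>- \<infinity>\<close>, and division
      by the negative \<open>ln r\<close> gives the ratio \<open>\<infinity>\<close>.\<close>
    case True
    then have "ereal_ln m / ereal (ln r) = \<infinity>"
      using ln by (simp add: ereal_ln_def divide_ereal_def)
    moreover have "0 < r powr b" using assms by simp
    then have "\<not> r powr b < m" using True by linarith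
    ultimately show ?thesis by simp
  next
    case False
    then have "ereal_ln m / ereal (ln r) = ereal (ln m / ln r)"
      using ln by (simp add: ereal_ln_def)
    moreover have "ln m / ln r < b \<longleftrightarrow> b * ln r < ln m"
      using ln by (simp add: neg_divide_less_eq)
    moreover have "b * ln r < ln m \<longleftrightarrow> r powr b < m"
      using False assms ln_less_cancel_iff[of "r powr b" m] by (simp add: ln_powr)
    ultimately show ?thesis by simp
  qed
qed

lemma ereal_ln_ratio_le:
  assumes "0 < r" "r < 1" "r powr b \<le> m"
  shows "ereal_ln m / ereal (ln r) \<le> ereal b"
proof -
  have ln: "ln r < 0" using assms by simp
  have "0 < r powr b" using assms by simp
  then have m: "0 < m" using assms(3) by linarith
  have "b * ln r \<le> ln m"
    using assms m ln_le_cancel_iff[of "r powr b" m] by (simp add: ln_powr)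
  then have "ln m / ln r \<le> b" using ln by (simp add: neg_divide_le_eq)
  then show ?thesis using m ln by (simp add: ereal_ln_def)
qed

lemma eventually_at_right_01: "\<forall>\<^sub>F r in at_right (0::real). 0 < r \<and> r < 1"
  using eventually_at_right_real[of 0 1] by simp

lemma ereal_le_if_less:
  assumes "\<And>b. a < b \<Longrightarrow> x \<le> ereal b"
  shows "x \<le> ereal a"
proof (rule ccontr)
  assume "\<not> x \<le> ereal a"
  then have "ereal a < x" by simp
  then obtain b where "ereal a < ereal b" "ereal b < x" using ereal_dense2 by blast
  then show False using assms[of b] by simp
qed

lemma eventually_ge_if_upper_local_dim_less:
  assumes "upper_local_dim \<mu> x < ereal b"
  shows "\<forall>\<^sub>F r in at_right 0. r powr b \<le> smeas \<mu> (ball x r)"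
proof -
  have "\<forall>\<^sub>F r in at_right 0. ereal_ln (smeas \<mu> (ball x r)) / ereal (ln r) < ereal b"
    using Limsup_lessD assms unfolding upper_local_dim_def by blast
  with eventually_at_right_01 show ?thesis
    by eventually_elim (auto simp: ereal_ln_ratio_less_iff)
qed

lemma frequently_ge_if_lower_local_dim_less:
  assumes "lower_local_dim \<mu> x < ereal b"
  shows "\<exists>\<^sub>F r in at_right 0. r powr b \<le> smeas \<mu> (ball x r)"
proof -
  have "\<not> (\<forall>\<^sub>F r in at_right 0. ereal b \<le> ereal_ln (smeas \<mu> (ball x r)) / ereal (ln r))"
  proof
    assume "\<forall>\<^sub>F r in at_right 0. ereal b \<le> ereal_ln (smeas \<mu> (ball x r)) / ereal (ln r)"
    then have "ereal b \<le> lower_local_dim \<mu> x"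
      unfolding lower_local_dim_def by (rule Liminf_bounded)
    then show False using assms by (simp add: not_less[symmetric])
  qed
  then have "\<exists>\<^sub>F r in at_right 0. ereal_ln (smeas \<mu> (ball x r)) / ereal (ln r) < ereal b"
    by (simp add: frequently_def not_less)
  from frequently_eventually_conj[OF this eventually_at_right_01] show ?thesis
    by (rule frequently_elim1) (auto simp: ereal_ln_ratio_less_iff)
qed

lemma prob_measure_pos_part:
  assumes "\<mu> \<in> prob_measures_on K" "A \<in> sets borel"
  shows "measure (pos_part \<mu>) A = smeas \<mu> A"
  using assms by (intro measure_pos_part_nonneg) (auto simp: prob_measures_on_def)

lemma hausdorff_measure_lower_local_dim_less:
  fixes \<mu> :: "'a::euclidean_space signed_measure"
  assumes \<mu>: "\<mu> \<in> prob_measures_on K" and a: "0 < a"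
  shows "hausdorff_measure a {x. lower_local_dim \<mu> x < ereal a} = 0"
proof -
  \<comment> \<open>Exponents strictly below \<open>a\<close> that exhaust the strict inequality;
    the maximum meets the requirement of a nonnegative exponent in the covering argument.\<close>
  define q where "q n = max 0 (a - 1 / real (Suc n))" for n
  define L where "L n = {x. \<exists>\<^sub>F r in at_right 0. r powr (q n) \<le> measure (pos_part \<mu>) (ball x r)}" for n
  have "hausdorff_measure a (L n) = 0" for n
    by (rule hausdorff_measure_null_if_frequently_ge[OF finite_measure_pos_part sets_pos_part, of "q n"])
      (use a in \<open>auto simp: q_def L_def\<close>)
  then have "hausdorff_measure a (\<Union>n. L n) = 0"
    by (rule hausdorff_measure_UN_null)
  moreover have "{x. lower_local_dim \<mu> x < ereal a} \<subseteq> (\<Union>n. L n)"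
  proof
    fix x assume "x \<in> {x. lower_local_dim \<mu> x < ereal a}"
    then obtain b where b: "lower_local_dim \<mu> x < ereal b" "b < a"
      using ereal_dense2[of "lower_local_dim \<mu> x" "ereal a"] by auto
    obtain n where "inverse (real (Suc n)) < a - b" using reals_Archimedean[of "a - b"] b by auto
    then have "b \<le> q n" unfolding q_def inverse_eq_divide by linarith
    then have "lower_local_dim \<mu> x < ereal (q n)" using b(1) by (meson ereal_less_eq(3) order.strict_trans2)
    then have "x \<in> L n"
      using frequently_ge_if_lower_local_dim_less prob_measure_pos_part[OF \<mu>] by (simp add: L_def)
    then show "x \<in> (\<Union>n. L n)" by auto
  qed
  ultimately show ?thesis
    using hausdorff_measure_mono[of _ "\<Union>n. L n" a] by (metis le_zero_eq)
qed

text \<open>For \<open>b > a\<close> the upper local dimension is below the midpoint of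
  \<open>a\<close> and \<open>b\<close>, so the mass bound holds at all small radii with an exponent
  less than \<open>b\<close>.\<close>

lemma packing_dim_local_dim_level_le:
  fixes \<mu> :: "'a::euclidean_space signed_measure"
  assumes \<mu>: "\<mu> \<in> prob_measures_on K" and a: "0 \<le> a"
  shows "packing_dim (local_dim_level K \<mu> a) \<le> ereal a"
proof (rule ereal_le_if_less)
  fix b assume b: "a < b"
  show "packing_dim (local_dim_level K \<mu> a) \<le> ereal b"
  proof (rule packing_dim_le)
    show "packing_measure b (local_dim_level K \<mu> a) = 0"
    proof (rule packing_measure_null_if_eventually_ge[OF finite_measure_pos_part sets_pos_part])
      show "0 \<le> (a + b) / 2" "(a + b) / 2 < b" using a b by auto
      fix x assume "x \<in> local_dim_level K \<mu> a"
      then have "upper_local_dim \<mu> x < ereal ((a + b) / 2)" using b by (simp add: local_dim_level_def)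
      from eventually_ge_if_upper_local_dim_less[OF this]
      show "\<forall>\<^sub>F r in at_right 0. r powr ((a + b) / 2) \<le> measure (pos_part \<mu>) (ball x r)"
        by (simp add: prob_measure_pos_part[OF \<mu>])
    qed
  qed (use a b in simp)
qed

lemma upper_local_dim_le:
  assumes "\<And>b. a < b \<Longrightarrow> \<exists>c>0. \<forall>\<^sub>F r in at_right 0. c * r powr b \<le> smeas \<mu> (ball x r)"
  shows "upper_local_dim \<mu> x \<le> ereal a"
proof (rule ereal_le_if_less)
  fix b assume "a < b"
  \<comment> \<open>The constant \<open>c\<close> is swallowed by the gap:
    \<open>r powr (b - b')\<close> drops below \<open>c\<close> for small \<open>r\<close>.\<close>
  then obtain b' where b': "a < b'" "b' < b" using dense by blast
  obtain c where c: "0 < c" "\<forall>\<^sub>F r in at_right 0. c * r powr b' \<le> smeas \<mu> (ball x r)"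
    using assms[OF b'(1)] by blast
  have "((\<lambda>r::real. r powr (b - b')) \<longlongrightarrow> 0 powr (b - b')) (at_right 0)"
  proof (rule tendsto_powr'[OF tendsto_ident_at tendsto_const])
    have "\<forall>\<^sub>F r::real in at_right 0. 0 \<le> r"
      by (rule eventually_mono[OF eventually_at_right_less]) simp
    then show "0 \<noteq> (0::real) \<or> 0 < b - b' \<and> (\<forall>\<^sub>F r::real in at_right 0. 0 \<le> r)"
      using b' by simp
  qed
  then have "\<forall>\<^sub>F r::real in at_right 0. r powr (b - b') < c"
    using c(1) by (intro order_tendstoD(2)) auto
  with c(2) eventually_at_right_01
  have "\<forall>\<^sub>F r in at_right 0. ereal_ln (smeas \<mu> (ball x r)) / ereal (ln r) \<le> ereal b"
  proof eventually_elim
    case (elim r)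
    have "r powr b = r powr (b - b') * r powr b'" by (simp flip: powr_add)
    also have "\<dots> \<le> c * r powr b'" using elim by (intro mult_right_mono) auto
    also have "\<dots> \<le> smeas \<mu> (ball x r)" using elim by simp
    finally show ?case using elim by (intro ereal_ln_ratio_le) auto
  qed
  then show "upper_local_dim \<mu> x \<le> ereal b"
    unfolding upper_local_dim_def by (rule Limsup_bounded)
qed

lemma lower_le_upper_local_dim: "lower_local_dim \<mu> x \<le> upper_local_dim \<mu> x"
  unfolding lower_local_dim_def upper_local_dim_def
  by (rule Liminf_le_Limsup) (simp add: trivial_limit_at_right_real)

text \<open>Otherwise \<open>F\<close> would be covered by three null sets: the level set, the point
  \<open>p\<close>, and the set where the lower local dimension is below \<open>a\<close>.\<close>

lemma hausdorff_dim_local_dim_level_ge: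
  fixes \<mu> :: "'a::euclidean_space signed_measure"
  assumes \<mu>: "\<mu> \<in> prob_measures_on K" and a: "0 < a"
    and F: "F \<subseteq> K" "hausdorff_measure a F \<noteq> 0"
    and le: "\<And>x b. x \<in> F \<Longrightarrow> x \<noteq> p \<Longrightarrow> a < b \<Longrightarrow>
      \<exists>c>0. \<forall>\<^sub>F r in at_right 0. c * r powr b \<le> smeas \<mu> (ball x r)"
  shows "ereal a \<le> hausdorff_dim (local_dim_level K \<mu> a)"
proof (rule hausdorff_dim_ge, rule notI)
  assume null: "hausdorff_measure a (local_dim_level K \<mu> a) = 0"
  let ?L = "{x. lower_local_dim \<mu> x < ereal a}"
  have "F \<subseteq> local_dim_level K \<mu> a \<union> ({p} \<union> ?L)"
  proof
    fix x assume x: "x \<in> F"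
    show "x \<in> local_dim_level K \<mu> a \<union> ({p} \<union> ?L)"
    proof (cases "x = p \<or> x \<in> ?L")
      case False
      then have "upper_local_dim \<mu> x \<le> ereal a" using le x by (intro upper_local_dim_le) auto
      moreover have "\<not> lower_local_dim \<mu> x < ereal a" using False by simp
      then have "ereal a \<le> lower_local_dim \<mu> x" by (rule leI)
      ultimately have "lower_local_dim \<mu> x = ereal a" "upper_local_dim \<mu> x = ereal a"
        using lower_le_upper_local_dim[of \<mu> x] by auto
      then show ?thesis using x F(1) by (auto simp: local_dim_level_def)
    qed auto
  qed
  moreover have "hausdorff_measure a (local_dim_level K \<mu> a \<union> ({p} \<union> ?L)) = 0"
    using null a \<mu>
    by (intro hausdorff_measure_Un_null hausdorff_measure_singleton hausdorff_measure_lower_local_dim_less)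
  ultimately show False
    using F(2) hausdorff_measure_mono[of F _ a] by (metis le_zero_eq)
qed

theorem theorem1p7:
  fixes K :: "'a::euclidean_space set" and m :: nat and S :: "nat \<Rightarrow> 'a \<Rightarrow> 'a"
  assumes "self_similar_by m S K"
    and "open_set_condition m S"
  shows "prevalent (weak_topology K) (prob_measures_on K)
    {\<mu> \<in> prob_measures_on K. \<forall>\<alpha>::real. 0 \<le> \<alpha> \<and> ereal \<alpha> < hausdorff_dim K \<longrightarrow>
        hausdorff_dim (local_dim_level K \<mu> \<alpha>) = ereal \<alpha> \<and>
        packing_dim (local_dim_level K \<mu> \<alpha>) = ereal \<alpha>}"
proof -
  have K: "compact K" "K \<noteq> {}" using assms(1) by (auto simp: self_similar_by_def)
  obtain p where p: "p \<in> K" using K by auto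
  obtain P where P: "set_pmf P \<subseteq> K"
    "\<And>t. 0 < t \<Longrightarrow> ereal t < hausdorff_dim K \<Longrightarrow>
      \<exists>F\<subseteq>K. hausdorff_measure t F \<noteq> 0 \<and> (\<forall>b>t. \<exists>c>0. \<exists>R>0. \<forall>x\<in>F. \<forall>r. 0 < r \<longrightarrow> r < R \<longrightarrow>
        c * r powr b \<le> measure (measure_pmf P) (ball x r))"
    using exists_universal_pmf[OF assms] by blast
  show ?thesis
  proof (rule prevalent_dominating[OF K(1) p])
    show "pmf_measure P \<in> prob_measures_on K"
      using K(1) P(1) by (intro pmf_measure_prob_measures_on borel_compact)
    fix \<mu> c
    assume \<mu>: "\<mu> \<in> prob_measures_on K" and c: "0 < c"
      and dom: "\<And>X. X \<in> sets borel \<Longrightarrow> p \<notin> X \<Longrightarrow> c * smeas (pmf_measure P) X \<le> smeas \<mu> X"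
    have "hausdorff_dim (local_dim_level K \<mu> \<alpha>) = ereal \<alpha> \<and> packing_dim (local_dim_level K \<mu> \<alpha>) = ereal \<alpha>"
      if \<alpha>: "0 \<le> \<alpha>" "ereal \<alpha> < hausdorff_dim K" for \<alpha>
    proof -
      have "ereal \<alpha> \<le> hausdorff_dim (local_dim_level K \<mu> \<alpha>)"
      proof (cases "\<alpha> = 0")
        case True
        then show ?thesis using hausdorff_dim_nonneg by (simp add: zero_ereal_def[symmetric])
      next
        case False
        then have \<alpha>0: "0 < \<alpha>" using \<alpha> by simp
        obtain F where F: "F \<subseteq> K" "hausdorff_measure \<alpha> F \<noteq> 0"
          "\<forall>b>\<alpha>. \<exists>c>0. \<exists>R>0. \<forall>x\<in>F. \<forall>r. 0 < r \<longrightarrow> r < R \<longrightarrow> c * r powr b \<le> measure (measure_pmf P) (ball x r)"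
          using P(2)[OF \<alpha>0 \<alpha>(2)] by blast
        show ?thesis
        proof (rule hausdorff_dim_local_dim_level_ge[OF \<mu> \<alpha>0 F(1,2)])
          fix x b assume x: "x \<in> F" "x \<noteq> p" and b: "\<alpha> < b"
          obtain c' R where c': "0 < c'" "0 < R"
            "\<forall>x\<in>F. \<forall>r. 0 < r \<longrightarrow> r < R \<longrightarrow> c' * r powr b \<le> measure (measure_pmf P) (ball x r)"
            using F(3) b by blast
          \<comment> \<open>Radii below \<open>dist x p\<close> keep \<open>p\<close> outside the
            ball, so the domination off \<open>p\<close> applies to it.\<close>
          have "\<forall>\<^sub>F r in at_right 0. r \<in> {0<..<min R (dist x p)}"
            using c'(2) x(2) by (intro eventually_at_right_real) auto
          then have "\<forall>\<^sub>F r in at_right 0. (c * c') * r powr b \<le> smeas \<mu> (ball x r)"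
          proof eventually_elim
            case (elim r)
            have "c * (c' * r powr b) \<le> c * smeas (pmf_measure P) (ball x r)"
              using c'(3) x(1) elim c by (intro mult_left_mono) (auto simp: pmf_measure.rep_eq)
            also have "\<dots> \<le> smeas \<mu> (ball x r)"
              using elim by (intro dom) auto
            finally show ?case by (simp add: mult.assoc)
          qed
          then show "\<exists>c>0. \<forall>\<^sub>F r in at_right 0. c * r powr b \<le> smeas \<mu> (ball x r)"
            using c c'(1) by (intro exI[of _ "c * c'"]) simp
        qed
      qed
      then show ?thesis
        using packing_dim_local_dim_level_le[OF \<mu> \<alpha>(1)]
          hausdorff_dim_le_packing_dim[of "local_dim_level K \<mu> \<alpha>"] by (auto intro: antisym order.trans)
    qed
    then show "\<mu> \<in> {\<mu> \<in> prob_measures_on K. \<forall>\<alpha>::real. 0 \<le> \<alpha> \<and> ereal \<alpha> < hausdorff_dim K \<longrightarrow>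
        hausdorff_dim (local_dim_level K \<mu> \<alpha>) = ereal \<alpha> \<and>
        packing_dim (local_dim_level K \<mu> \<alpha>) = ereal \<alpha>}"
      using \<mu> by simp
  qed auto
qed

end
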